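(* Let $k$ be an algebraically closed field of characteristic zero and let $n,m,d$ be any positive integers with $n\ge m$. Every (faithful) rational action $\varrho$ of a finite cyclic group $G$ of order $d$ on an $n$-dimensional irreducible variety $X$ is obtained by a nontrivial base change from a linear action $\lambda\colon G\hookrightarrow\mathrm{GL}_m(k)$ on $\mathbf A^m$ such that $\lambda(G)=T_m(d)$.
   Context: $T_m(d):=\{(tx_1,x_2,\ldots,x_m)\mid t\in k,\ t^d=1\}\subset\mathrm{GL}_m(k)$. Varieties are algebraic varieties over $k$. A (faithful) rational action of $G$ on an irreducible variety $X$ is an injective homomorphism $\varrho\colon G\hookrightarrow\mathrm{Bir}(X)$. A rational action $\varrho_1\colon G\hookrightarrow\mathrm{Bir}(X_1)$ is obtained by a nontrivial base change from a rational action $\varrho_2\colon G\hookrightarrow\mathrm{Bir}(X_2)$ if there is a $G$-equivariant dominant rational map $X_1\dashrightarrow X_2$ which is not a birational isomorphism. *)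

theory Defs
  imports
    "HOL-Analysis.Abstract_Topology"
    "HOL-Library.Extended_Nat"
    "HOL-Algebra.Elementary_Groups"
    "HOL-Computational_Algebra.Polynomial"
    "Jordan_Normal_Form.Matrix"
begin

text \<open>
  Varieties are taken in the classical sense: spaces of closed points carrying a sheaf of
  \<open>k\<close>-valued functions, glued from finitely many affine algebraic sets, and separated.
  Affine \<open>N\<close>-space over \<open>k\<close> is \<^term>\<open>carrier_vec N\<close>.
\<close>

section \<open>Spaces with functions\<close>

text \<open>
  Sections over an open set \<open>U\<close> are extensional functions on \<open>U\<close>;
  the value of the field \<open>sections\<close> on sets that are not open is irrelevant.
\<close>

record ('a, 'k) fspace =
  ztop :: "'a topology"
  sections :: "'a set \<Rightarrow> ('a \<Rightarrow> 'k) set"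

abbreviation points :: "('a, 'k, 'z) fspace_scheme \<Rightarrow> 'a set" where
  "points X \<equiv> topspace (ztop X)"

definition sheaf_of_functions :: "('a, 'k::field) fspace \<Rightarrow> bool" where
  "sheaf_of_functions X \<longleftrightarrow>
     (\<forall>U. openin (ztop X) U \<longrightarrow>
        sections X U \<subseteq> extensional U \<and>
        (\<forall>c. (\<lambda>x\<in>U. c) \<in> sections X U) \<and>
        (\<forall>f\<in>sections X U. \<forall>g\<in>sections X U.
           (\<lambda>x\<in>U. f x + g x) \<in> sections X U \<and> (\<lambda>x\<in>U. f x * g x) \<in> sections X U)) \<and>
     (\<forall>U V. openin (ztop X) U \<longrightarrow> openin (ztop X) V \<longrightarrow> V \<subseteq> U \<longrightarrow>
        (\<forall>f\<in>sections X U. restrict f V \<in> sections X V)) \<and>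
     (\<forall>\<U> f. (\<forall>U\<in>\<U>. openin (ztop X) U) \<longrightarrow> f \<in> extensional (\<Union>\<U>) \<longrightarrow>
        (\<forall>U\<in>\<U>. restrict f U \<in> sections X U) \<longrightarrow> f \<in> sections X (\<Union>\<U>))"

definition open_subspace :: "('a, 'k) fspace \<Rightarrow> 'a set \<Rightarrow> ('a, 'k) fspace" where
  "open_subspace X U = \<lparr>ztop = subtopology (ztop X) U, sections = sections X\<rparr>"

definition morphism :: "('a, 'k) fspace \<Rightarrow> ('b, 'k) fspace \<Rightarrow> ('a \<Rightarrow> 'b) \<Rightarrow> bool" where
  "morphism X Y f \<longleftrightarrow>
     continuous_map (ztop X) (ztop Y) f \<and>
     (\<forall>V. openin (ztop Y) V \<longrightarrow>
        (\<forall>s\<in>sections Y V.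
           (\<lambda>x\<in>{x \<in> points X. f x \<in> V}. s (f x)) \<in> sections X {x \<in> points X. f x \<in> V}))"

definition isomorphic_fspaces :: "('a, 'k) fspace \<Rightarrow> ('b, 'k) fspace \<Rightarrow> bool" where
  "isomorphic_fspaces X Y \<longleftrightarrow>
     (\<exists>f g. morphism X Y f \<and> morphism Y X g \<and>
        (\<forall>x\<in>points X. g (f x) = x) \<and> (\<forall>y\<in>points Y. f (g y) = y))"


section \<open>Affine algebraic sets\<close>

text \<open>Only the values of a polynomial function on \<^term>\<open>carrier_vec N\<close> matter.\<close>

inductive_set polynomial_functions :: "nat \<Rightarrow> ('k::field vec \<Rightarrow> 'k) set" for N :: nat where
  const: "(\<lambda>v. c) \<in> polynomial_functions N"
| coord: "i < N \<Longrightarrow> (\<lambda>v. v $ i) \<in> polynomial_functions N"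
| add: "f \<in> polynomial_functions N \<Longrightarrow> g \<in> polynomial_functions N \<Longrightarrow>
    (\<lambda>v. f v + g v) \<in> polynomial_functions N"
| mult: "f \<in> polynomial_functions N \<Longrightarrow> g \<in> polynomial_functions N \<Longrightarrow>
    (\<lambda>v. f v * g v) \<in> polynomial_functions N"

definition zero_locus :: "nat \<Rightarrow> ('k::field vec \<Rightarrow> 'k) set \<Rightarrow> 'k vec set" where
  "zero_locus N F = {v \<in> carrier_vec N. \<forall>f\<in>F. f v = 0}"

definition algebraic_set :: "nat \<Rightarrow> 'k::field vec set \<Rightarrow> bool" where
  "algebraic_set N V \<longleftrightarrow> (\<exists>F \<subseteq> polynomial_functions N. V = zero_locus N F)"

definition zariski :: "nat \<Rightarrow> 'k::field vec topology" where
  "zariski N = topology (\<lambda>U. U \<subseteq> carrier_vec N \<and> algebraic_set N (carrier_vec N - U))"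

lemma istopology_zariski:
  "istopology (\<lambda>U :: 'k::field vec set.
     U \<subseteq> carrier_vec N \<and> algebraic_set N (carrier_vec N - U))"
proof -
  have un: "algebraic_set N (A \<union> B)"
    if "algebraic_set N A" "algebraic_set N B" for A B :: "'k vec set"
  proof -
    from that obtain F G where F: "F \<subseteq> polynomial_functions N" "A = zero_locus N F"
      and G: "G \<subseteq> polynomial_functions N" "B = zero_locus N G"
      unfolding algebraic_set_def by blast
    define H where "H = (\<lambda>(f, g). (\<lambda>v. f v * g v)) ` (F \<times> G)"
    have "H \<subseteq> polynomial_functions N"
      using F(1) G(1) by (auto simp: H_def intro: polynomial_functions.mult)
    moreover have "A \<union> B = zero_locus N H"
    proof (rule Set.set_eqI)
      fix v
      have "(\<forall>h\<in>H. h v = 0) \<longleftrightarrow> (\<forall>f\<in>F. \<forall>g\<in>G. f v = 0 \<or> g v = 0)"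
        by (simp add: H_def)
      then show "v \<in> A \<union> B \<longleftrightarrow> v \<in> zero_locus N H"
        unfolding F(2) G(2) zero_locus_def by blast
    qed
    ultimately show ?thesis unfolding algebraic_set_def by blast
  qed
  have int: "algebraic_set N (carrier_vec N - \<Union>\<K>)"
    if K: "\<And>K. K \<in> \<K> \<Longrightarrow> algebraic_set N (carrier_vec N - K)" for \<K> :: "'k vec set set"
  proof -
    from K obtain F where F: "\<And>K. K \<in> \<K> \<Longrightarrow> F K \<subseteq> polynomial_functions N"
      "\<And>K. K \<in> \<K> \<Longrightarrow> carrier_vec N - K = zero_locus N (F K)"
      unfolding algebraic_set_def by metis
    have "carrier_vec N - \<Union>\<K> = zero_locus N (\<Union>K\<in>\<K>. F K)"
    proof (rule Set.set_eqI)
      fix v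
      have "v \<in> carrier_vec N - K \<longleftrightarrow> v \<in> carrier_vec N \<and> (\<forall>f\<in>F K. f v = 0)" if "K \<in> \<K>" for K
        unfolding F(2)[OF that] zero_locus_def by simp
      then have "v \<in> carrier_vec N \<Longrightarrow> v \<notin> K \<longleftrightarrow> (\<forall>f\<in>F K. f v = 0)" if "K \<in> \<K>" for K
        using that by simp
      then show "v \<in> carrier_vec N - \<Union>\<K> \<longleftrightarrow> v \<in> zero_locus N (\<Union>K\<in>\<K>. F K)"
        unfolding zero_locus_def by (simp add: Ball_def) metis
    qed
    moreover have "(\<Union>K\<in>\<K>. F K) \<subseteq> polynomial_functions N"
      using F(1) by (rule UN_least)
    ultimately show ?thesis unfolding algebraic_set_def by blast
  qed
  show ?thesis
    unfolding istopology_def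
  proof (intro conjI allI impI)
    fix S T :: "'k vec set"
    assume S: "S \<subseteq> carrier_vec N \<and> algebraic_set N (carrier_vec N - S)"
      and T: "T \<subseteq> carrier_vec N \<and> algebraic_set N (carrier_vec N - T)"
    then show "S \<inter> T \<subseteq> carrier_vec N" by blast
    show "algebraic_set N (carrier_vec N - S \<inter> T)"
      using un[of "carrier_vec N - S" "carrier_vec N - T"] S T by (simp add: Diff_Int)
  next
    fix \<K> :: "'k vec set set"
    assume "\<forall>K\<in>\<K>. K \<subseteq> carrier_vec N \<and> algebraic_set N (carrier_vec N - K)"
    then show "\<Union>\<K> \<subseteq> carrier_vec N" "algebraic_set N (carrier_vec N - \<Union>\<K>)"
      using int by blast+
  qed
qed

lemma openin_zariski:
  "openin (zariski N) U \<longleftrightarrow> U \<subseteq> carrier_vec N \<and> algebraic_set N (carrier_vec N - U)"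
  by (simp add: zariski_def istopology_zariski)

text \<open>A function is regular if it is locally a quotient of polynomial functions.\<close>

definition affine_variety :: "nat \<Rightarrow> 'k::field vec set \<Rightarrow> ('k vec, 'k) fspace" where
  "affine_variety N V =
     \<lparr>ztop = subtopology (zariski N) V,
      sections = (\<lambda>U. {f \<in> extensional U. \<forall>x\<in>U.
        \<exists>W. openin (subtopology (zariski N) V) W \<and> x \<in> W \<and> W \<subseteq> U \<and>
          (\<exists>g\<in>polynomial_functions N. \<exists>h\<in>polynomial_functions N.
             \<forall>y\<in>W. h y \<noteq> 0 \<and> f y = g y / h y)})\<rparr>"

abbreviation affine_space :: "nat \<Rightarrow> ('k::field vec, 'k) fspace" where
  "affine_space m \<equiv> affine_variety m (carrier_vec m)"


section \<open>Varieties\<close>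

definition prevariety :: "('a, 'k::field) fspace \<Rightarrow> bool" where
  "prevariety X \<longleftrightarrow> sheaf_of_functions X \<and>
     (\<exists>\<U>. finite \<U> \<and> \<Union>\<U> = points X \<and>
        (\<forall>U\<in>\<U>. openin (ztop X) U \<and>
           (\<exists>N V. algebraic_set N V \<and>
              isomorphic_fspaces (open_subspace X U) (affine_variety N V))))"

text \<open>Closedness is local, so it suffices to test separatedness on affine sources.\<close>

definition separated :: "('a, 'k::field) fspace \<Rightarrow> bool" where
  "separated X \<longleftrightarrow>
     (\<forall>N Z f g. algebraic_set N Z \<longrightarrow>
        morphism (affine_variety N Z) X f \<longrightarrow> morphism (affine_variety N Z) X g \<longrightarrow>
        closedin (ztop (affine_variety N Z)) {z \<in> Z. f z = g z})"

definition variety :: "('a, 'k::field) fspace \<Rightarrow> bool" where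
  "variety X \<longleftrightarrow> prevariety X \<and> separated X"

definition irreducible_topology :: "'a topology \<Rightarrow> bool" where
  "irreducible_topology T \<longleftrightarrow> topspace T \<noteq> {} \<and>
     (\<forall>A B. closedin T A \<longrightarrow> closedin T B \<longrightarrow> A \<union> B = topspace T \<longrightarrow>
        A = topspace T \<or> B = topspace T)"

definition irreducible_variety :: "('a, 'k::field) fspace \<Rightarrow> bool" where
  "irreducible_variety X \<longleftrightarrow> variety X \<and> irreducible_topology (ztop X)"

definition krull_dim :: "'a topology \<Rightarrow> enat" where
  "krull_dim T = Sup {enat n | n.
     \<exists>Z. (\<forall>i\<le>n. closedin T (Z i) \<and> irreducible_topology (subtopology T (Z i))) \<and>
         (\<forall>i<n. Z i \<subset> Z (Suc i))}"

definition dimension :: "('a, 'k) fspace \<Rightarrow> enat" where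
  "dimension X = krull_dim (ztop X)"


section \<open>Rational maps\<close>

text \<open>
  The source is meant to be irreducible, so that nonempty open subsets are dense.
\<close>

type_synonym ('a, 'b) partial_map = "'a set \<times> ('a \<Rightarrow> 'b)"

definition rational_reps ::
    "('a, 'k) fspace \<Rightarrow> ('b, 'k) fspace \<Rightarrow> ('a, 'b) partial_map set" where
  "rational_reps X Y = {(U, f). openin (ztop X) U \<and> U \<noteq> {} \<and> f \<in> extensional U \<and>
     morphism (open_subspace X U) Y f}"

definition rational_eq ::
    "('a, 'k) fspace \<Rightarrow> ('b, 'k) fspace \<Rightarrow> ('a, 'b) partial_map rel" where
  "rational_eq X Y = {((U, f), (V, g)).
     (U, f) \<in> rational_reps X Y \<and> (V, g) \<in> rational_reps X Y \<and>
     (\<exists>W. openin (ztop X) W \<and> W \<noteq> {} \<and> W \<subseteq> U \<inter> V \<and> (\<forall>x\<in>W. f x = g x))}"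

definition rational_maps ::
    "('a, 'k) fspace \<Rightarrow> ('b, 'k) fspace \<Rightarrow> ('a, 'b) partial_map set set" where
  "rational_maps X Y = rational_reps X Y // rational_eq X Y"

definition dominant ::
    "('a, 'k) fspace \<Rightarrow> ('b, 'k) fspace \<Rightarrow> ('a, 'b) partial_map set \<Rightarrow> bool" where
  "dominant X Y \<Phi> \<longleftrightarrow> (\<forall>(U, f)\<in>\<Phi>. ztop Y closure_of (f ` U) = points Y)"

text \<open>
  The composite of \<open>\<Phi>\<close> from \<open>X\<close> to \<open>Y\<close> with \<open>\<Psi>\<close> from \<open>Y\<close> to \<open>Z\<close>, for dominant \<open>\<Phi>\<close>:
  the class of any composite of representatives.
\<close>

definition compose_reps ::
    "('a, 'b) partial_map \<Rightarrow> ('b, 'c) partial_map \<Rightarrow> ('a, 'c) partial_map" where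
  "compose_reps p q = (case (p, q) of ((U, f), (V, g)) \<Rightarrow>
     ({x \<in> U. f x \<in> V}, \<lambda>x\<in>{x \<in> U. f x \<in> V}. g (f x)))"

definition rational_comp ::
    "('a, 'k) fspace \<Rightarrow> ('c, 'k) fspace \<Rightarrow>
     ('b, 'c) partial_map set \<Rightarrow> ('a, 'b) partial_map set \<Rightarrow> ('a, 'c) partial_map set" where
  "rational_comp X Z \<Psi> \<Phi> = (\<Union>p\<in>\<Phi>. \<Union>q\<in>\<Psi>. rational_eq X Z `` {compose_reps p q})"

definition rational_of_morphism ::
    "('a, 'k) fspace \<Rightarrow> ('b, 'k) fspace \<Rightarrow> ('a \<Rightarrow> 'b) \<Rightarrow> ('a, 'b) partial_map set" where
  "rational_of_morphism X Y f = rational_eq X Y `` {(points X, restrict f (points X))}"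

definition birational ::
    "('a, 'k) fspace \<Rightarrow> ('b, 'k) fspace \<Rightarrow> ('a, 'b) partial_map set \<Rightarrow> bool" where
  "birational X Y \<Phi> \<longleftrightarrow> \<Phi> \<in> rational_maps X Y \<and> dominant X Y \<Phi> \<and>
     (\<exists>\<Psi>\<in>rational_maps Y X. dominant Y X \<Psi> \<and>
        rational_comp X X \<Psi> \<Phi> = rational_of_morphism X X id \<and>
        rational_comp Y Y \<Phi> \<Psi> = rational_of_morphism Y Y id)"

definition Bir :: "('a, 'k) fspace \<Rightarrow> ('a, 'a) partial_map set monoid" where
  "Bir X = \<lparr>carrier = {\<Phi>. birational X X \<Phi>},
            monoid.mult = rational_comp X X,
            one = rational_of_morphism X X id\<rparr>"


section \<open>Rational actions\<close>

definition rational_action ::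
    "('g, 'r) monoid_scheme \<Rightarrow> ('a, 'k::field) fspace \<Rightarrow> ('g \<Rightarrow> ('a, 'a) partial_map set) \<Rightarrow> bool"
  where
  "rational_action G X \<rho> \<longleftrightarrow>
     irreducible_variety X \<and> \<rho> \<in> hom G (Bir X) \<and> inj_on \<rho> (carrier G)"

definition nontrivial_base_change ::
    "('g, 'r) monoid_scheme \<Rightarrow>
     ('a, 'k::field) fspace \<Rightarrow> ('g \<Rightarrow> ('a, 'a) partial_map set) \<Rightarrow>
     ('b, 'k) fspace \<Rightarrow> ('g \<Rightarrow> ('b, 'b) partial_map set) \<Rightarrow> bool" where
  "nontrivial_base_change G X\<^sub>1 \<rho>\<^sub>1 X\<^sub>2 \<rho>\<^sub>2 \<longleftrightarrow>
     rational_action G X\<^sub>1 \<rho>\<^sub>1 \<and> rational_action G X\<^sub>2 \<rho>\<^sub>2 \<and>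
     (\<exists>\<Phi>\<in>rational_maps X\<^sub>1 X\<^sub>2. dominant X\<^sub>1 X\<^sub>2 \<Phi> \<and>
        (\<forall>g\<in>carrier G. rational_comp X\<^sub>1 X\<^sub>2 \<Phi> (\<rho>\<^sub>1 g) = rational_comp X\<^sub>1 X\<^sub>2 (\<rho>\<^sub>2 g) \<Phi>) \<and>
        \<not> birational X\<^sub>1 X\<^sub>2 \<Phi>)"

definition GL :: "nat \<Rightarrow> 'k::field mat monoid" where
  "GL m = units_of (ring_mat TYPE('k) m ())"

definition linear_rational_action ::
    "nat \<Rightarrow> ('g \<Rightarrow> 'k::field mat) \<Rightarrow> 'g \<Rightarrow> ('k vec, 'k vec) partial_map set" where
  "linear_rational_action m \<Lambda> g =
     rational_of_morphism (affine_space m) (affine_space m) (\<lambda>v. \<Lambda> g *\<^sub>v v)"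

text \<open>The matrices of \<open>(x\<^sub>1, x\<^sub>2, \<dots>, x\<^sub>m) \<mapsto> (t x\<^sub>1, x\<^sub>2, \<dots>, x\<^sub>m)\<close> with \<open>t\<^sup>d = 1\<close>; indices start at 0.\<close>

definition T_group :: "nat \<Rightarrow> nat \<Rightarrow> 'k::field mat set" where
  "T_group m d = {mat m m (\<lambda>(i, j). if i = j then (if i = 0 then t else 1) else 0) | t. t ^ d = 1}"

end

theory Submission
  imports Defs "HOL-Algebra.Multiplicative_Group"
begin

text \<open>
  The group acts by honest automorphisms on a nonempty open subset \<open>W\<close> of an affine chart of \<open>X\<close>.
  A chain of irreducible closed sets of length \<open>m\<close> in \<open>X\<close> yields \<open>m\<close> algebraically independent
  regular functions on \<open>W\<close>. Lagrange resolvents split the regular functions on \<open>W\<close> into eigenspaces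
  of a generator; by exchange there are \<open>m\<close> independent eigenfunctions, whose \<open>d\<close>-th powers
  \<open>h\<^sub>0, \<dots>, h\<^sub>m\<^sub>-\<^sub>1\<close> are independent invariants. Faithfulness gives a nonzero function \<open>f\<close> of
  weight one, and \<open>f\<close> and \<open>f h\<^sub>0\<close> cannot both be algebraic over \<open>h\<^sub>1, \<dots>, h\<^sub>m\<^sub>-\<^sub>1\<close>; call a
  transcendental one \<open>F\<close>. The map \<open>(F\<^sup>d\<^sup>+\<^sup>1, h\<^sub>1, \<dots>, h\<^sub>m\<^sub>-\<^sub>1)\<close> is dominant and equivariant.
  It is not birational, because \<open>x\<^sub>0\<close> is not a \<open>(d+1)\<close>-st power in the function field of affine
  space; no dimension theory is needed for this.
\<close>

section \<open>Algebras of functions\<close>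

text \<open>No function field is formed: functions are total, are compared on \<open>W\<close> only,
  and division is replaced by clearing denominators. Faithfulness enters through weights: those
  carried by nonzero functions form a subgroup modulo d, and if it were proper, a nontrivial power
  of the generator would fix every function. \<open>f\<close> and \<open>f h_0\<close> cannot both
  be algebraic over the remaining invariants, since their quotient \<open>h_0\<close> would be too.
  Passing to d-th powers keeps independence because every element of k has a d-th root. The exponent
  d+1 serves two ends: it is 1 modulo d, so the weight of \<open>F\<close> survives, and it exceeds
  1, so no rational inverse can exist. With \<open>F\<close> itself the map could well be
  birational, for instance when X is the affine space with the linear action. Chains witnessing the
  dimension live in all of X, functions only on a chart; the chart is therefore taken around a point
  of the smallest member of the chain.\<close>

inductive_set adjoin :: "('x \<Rightarrow> 'k::field) set \<Rightarrow> ('x \<Rightarrow> 'k) set" for S where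
  const: "(\<lambda>x. c) \<in> adjoin S"
| incl: "s \<in> S \<Longrightarrow> s \<in> adjoin S"
| add: "f \<in> adjoin S \<Longrightarrow> g \<in> adjoin S \<Longrightarrow> (\<lambda>x. f x + g x) \<in> adjoin S"
| mult: "f \<in> adjoin S \<Longrightarrow> g \<in> adjoin S \<Longrightarrow> (\<lambda>x. f x * g x) \<in> adjoin S"

definition subalg :: "('x \<Rightarrow> 'k::field) set \<Rightarrow> bool" where
  "subalg B \<longleftrightarrow> (\<forall>c. (\<lambda>x. c) \<in> B) \<and>
     (\<forall>f\<in>B. \<forall>g\<in>B. (\<lambda>x. f x + g x) \<in> B \<and> (\<lambda>x. f x * g x) \<in> B)"

lemma subalg_adjoin: "subalg (adjoin S)"
  unfolding subalg_def by (auto intro: adjoin.intros)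

lemma adjoin_least: "subalg B \<Longrightarrow> S \<subseteq> B \<Longrightarrow> adjoin S \<subseteq> B"
proof
  fix f assume B: "subalg B" "S \<subseteq> B" and "f \<in> adjoin S"
  from this(3) show "f \<in> B"
    by induction (use B in \<open>auto simp: subalg_def\<close>)
qed

lemma adjoin_mono: "S \<subseteq> T \<Longrightarrow> adjoin S \<subseteq> adjoin T"
  by (rule adjoin_least[OF subalg_adjoin]) (auto intro: adjoin.incl)

context
  fixes B :: "('x \<Rightarrow> 'k::field) set"
  assumes B: "subalg B"
begin

lemma subalg_const: "(\<lambda>x. c) \<in> B"
  using B by (simp add: subalg_def)

lemma subalg_add: "f \<in> B \<Longrightarrow> g \<in> B \<Longrightarrow> (\<lambda>x. f x + g x) \<in> B"
  using B by (simp add: subalg_def)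

lemma subalg_mult: "f \<in> B \<Longrightarrow> g \<in> B \<Longrightarrow> (\<lambda>x. f x * g x) \<in> B"
  using B by (simp add: subalg_def)

lemma subalg_uminus: "f \<in> B \<Longrightarrow> (\<lambda>x. - f x) \<in> B"
  using subalg_mult[OF subalg_const[of "-1"], of f] by simp

lemma subalg_diff: "f \<in> B \<Longrightarrow> g \<in> B \<Longrightarrow> (\<lambda>x. f x - g x) \<in> B"
  using subalg_add[OF _ subalg_uminus, of f g] by simp

lemma subalg_power: "f \<in> B \<Longrightarrow> (\<lambda>x. f x ^ n) \<in> B"
  by (induction n) (auto intro: subalg_const subalg_mult)

lemma subalg_sum: "(\<And>i. i \<in> I \<Longrightarrow> f i \<in> B) \<Longrightarrow> (\<lambda>x. \<Sum>i\<in>I. f i x) \<in> B"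
proof (induction I rule: infinite_finite_induct)
  case (insert i I)
  have "(\<lambda>x. f i x + (\<Sum>i\<in>I. f i x)) \<in> B"
    by (rule subalg_add) (use insert in auto)
  then show ?case using insert by simp
qed (auto intro: subalg_const)

end

text \<open>The B-module generated by T, for finite T. The generators index their own coefficients,
  and members are equal as total functions; equality on \<open>W\<close> alone is imposed where the
  span is used.\<close>

definition lin_span :: "('x \<Rightarrow> 'k::field) set \<Rightarrow> ('x \<Rightarrow> 'k) set \<Rightarrow> ('x \<Rightarrow> 'k) set" where
  "lin_span B T = {(\<lambda>x. \<Sum>t\<in>T. b t x * t x) | b. \<forall>t\<in>T. b t \<in> B}"

context
  fixes B :: "('x \<Rightarrow> 'k::field) set"
  assumes B: "subalg B"
begin

lemma span_zero: "(\<lambda>x. 0) \<in> lin_span B T"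
  unfolding lin_span_def using subalg_const[OF B, of 0] by (intro CollectI exI[of _ "\<lambda>t x. 0"]) auto

lemma span_base:
  assumes "finite T" "t \<in> T" "b \<in> B"
  shows "(\<lambda>x. b x * t x) \<in> lin_span B T"
proof -
  have "(\<Sum>u\<in>T. (if u = t then b x else 0) * u x) = b x * t x" for x
  proof -
    have "(\<Sum>u\<in>T. (if u = t then b x else 0) * u x) = (\<Sum>u\<in>T. if u = t then b x * t x else 0)"
      by (intro sum.cong) auto
    then show ?thesis using assms by simp
  qed
  then have "(\<lambda>x. b x * t x) = (\<lambda>x. \<Sum>u\<in>T. (\<lambda>u x. if u = t then b x else 0) u x * u x)"
    by auto
  moreover have "(\<lambda>x. if u = t then b x else 0) \<in> B" for u
    using assms subalg_const[OF B, of 0] by (cases "u = t") simp_all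
  ultimately show ?thesis
    unfolding lin_span_def by (intro CollectI exI[of _ "\<lambda>u x. if u = t then b x else 0"]) auto
qed

lemma span_add:
  assumes "u \<in> lin_span B T" "v \<in> lin_span B T"
  shows "(\<lambda>x. u x + v x) \<in> lin_span B T"
proof -
  from assms obtain a b where *: "\<forall>t\<in>T. a t \<in> B" "\<forall>t\<in>T. b t \<in> B"
    "u = (\<lambda>x. \<Sum>t\<in>T. a t x * t x)" "v = (\<lambda>x. \<Sum>t\<in>T. b t x * t x)"
    unfolding lin_span_def by blast
  have "(\<lambda>x. u x + v x) = (\<lambda>x. \<Sum>t\<in>T. (\<lambda>x. a t x + b t x) x * t x)"
    by (simp add: * algebra_simps sum.distrib)
  then show ?thesis
    unfolding lin_span_def using subalg_add[OF B] *
    by (intro CollectI exI[of _ "\<lambda>t x. a t x + b t x"]) auto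
qed

lemma span_scale:
  assumes "u \<in> lin_span B T" "c \<in> B"
  shows "(\<lambda>x. c x * u x) \<in> lin_span B T"
proof -
  from assms obtain a where *: "\<forall>t\<in>T. a t \<in> B" "u = (\<lambda>x. \<Sum>t\<in>T. a t x * t x)"
    unfolding lin_span_def by blast
  have "(\<lambda>x. c x * u x) = (\<lambda>x. \<Sum>t\<in>T. (\<lambda>x. c x * a t x) x * t x)"
    by (simp add: * sum_distrib_left mult.assoc)
  then show ?thesis
    unfolding lin_span_def using subalg_mult[OF B] * assms
    by (intro CollectI exI[of _ "\<lambda>t x. c x * a t x"]) auto
qed

lemma span_sum: "(\<And>i. i \<in> I \<Longrightarrow> f i \<in> lin_span B T) \<Longrightarrow> (\<lambda>x. \<Sum>i\<in>I. f i x) \<in> lin_span B T"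
proof (induction I rule: infinite_finite_induct)
  case (insert i I)
  have "(\<lambda>x. f i x + (\<Sum>i\<in>I. f i x)) \<in> lin_span B T"
    by (rule span_add) (use insert in auto)
  then show ?case using insert by simp
qed (auto intro: span_zero)

lemma span_mult:
  assumes "finite T" "finite U" "u \<in> lin_span B T" "v \<in> lin_span B U"
  shows "(\<lambda>x. u x * v x) \<in> lin_span B ((\<lambda>(t, s) x. t x * s x) ` (T \<times> U))" (is "_ \<in> lin_span B ?TU")
proof -
  from assms obtain a b where *: "\<forall>t\<in>T. a t \<in> B" "\<forall>t\<in>U. b t \<in> B"
    "u = (\<lambda>x. \<Sum>t\<in>T. a t x * t x)" "v = (\<lambda>x. \<Sum>t\<in>U. b t x * t x)"
    unfolding lin_span_def by blast
  have "(\<lambda>x. u x * v x) = (\<lambda>x. \<Sum>p\<in>T \<times> U. (\<lambda>p x. (a (fst p) x * b (snd p) x) * (fst p x * snd p x)) p x)"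
    by (simp add: * sum_product sum.cartesian_product case_prod_beta mult_ac)
  also have "\<dots> \<in> lin_span B ?TU"
  proof (rule span_sum)
    fix p assume p: "p \<in> T \<times> U"
    have "(\<lambda>x. (\<lambda>x. a (fst p) x * b (snd p) x) x * (\<lambda>x. fst p x * snd p x) x) \<in> lin_span B ?TU"
      by (rule span_base) (use assms p * in \<open>force intro: subalg_mult[OF B]\<close>)+
    then show "(\<lambda>x. (a (fst p) x * b (snd p) x) * (fst p x * snd p x)) \<in> lin_span B ?TU"
      by simp
  qed
  finally show ?thesis .
qed

end

text \<open>The restrictions to \<open>W\<close> of the functions in \<open>A\<close> form an
  integral domain. Instead of passing to the quotient, "nonzero" is always spelled out as
  nonvanishing at some point of \<open>W\<close>.\<close>

locale function_domain =
  fixes W :: "'x set" and A :: "('x \<Rightarrow> 'k::field) set"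
  assumes subalg: "subalg A" and nonempty: "W \<noteq> {}"
    and domain: "f \<in> A \<Longrightarrow> g \<in> A \<Longrightarrow> \<forall>x\<in>W. f x * g x = 0 \<Longrightarrow>
      (\<forall>x\<in>W. f x = 0) \<or> (\<forall>x\<in>W. g x = 0)"
begin

lemma mult_nonzero:
  assumes "f \<in> A" "g \<in> A" "\<exists>x\<in>W. f x \<noteq> 0" "\<exists>x\<in>W. g x \<noteq> 0"
  shows "\<exists>x\<in>W. f x * g x \<noteq> 0"
  using domain[of f g] assms by blast

lemma power_nonzero:
  assumes "f \<in> A" "\<exists>x\<in>W. f x \<noteq> 0"
  shows "\<exists>x\<in>W. f x ^ n \<noteq> 0"
  using assms by auto

text \<open>Gaussian elimination without division: a homogeneous system with more unknowns than
  equations has a nonzero solution, and cross-multiplication with the pivot keeps it inside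
  \<open>B\<close>. The induction removes one equation and one unknown at a time.\<close>

lemma linear_system:
  assumes "finite J" "finite I" "card J < card I" "subalg B" "B \<subseteq> A"
    and "\<And>i j. i \<in> I \<Longrightarrow> j \<in> J \<Longrightarrow> M i j \<in> B"
  shows "\<exists>b. (\<forall>i\<in>I. b i \<in> B) \<and> (\<exists>i\<in>I. \<exists>x\<in>W. b i x \<noteq> 0) \<and>
           (\<forall>j\<in>J. \<forall>x\<in>W. (\<Sum>i\<in>I. b i x * M i j x) = 0)"
  using assms(1-3,6)
proof (induction J arbitrary: I M rule: finite_induct)
  case empty
  then have "I \<noteq> {}" by auto
  then show ?case
    using subalg_const[OF assms(4), of 1] nonempty by (intro exI[of _ "\<lambda>i x. 1"]) auto
next
  case (insert j J)
  show ?case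
  proof (cases "\<forall>i\<in>I. \<forall>x\<in>W. M i j x = 0")
    case True
    have "card J < card I" using insert by simp
    from insert.IH[OF insert.prems(1) this, of M] insert.prems obtain b where
      "\<forall>i\<in>I. b i \<in> B" "\<exists>i\<in>I. \<exists>x\<in>W. b i x \<noteq> 0" "\<forall>j\<in>J. \<forall>x\<in>W. (\<Sum>i\<in>I. b i x * M i j x) = 0"
      by auto
    then show ?thesis using True by (intro exI[of _ b]) auto
  next
    case False
    then obtain p where p: "p \<in> I" "\<exists>x\<in>W. M p j x \<noteq> 0" by blast
    \<comment> \<open>The coefficients left after eliminating equation \<open>j\<close> with pivot
      \<open>M p j\<close>; they vanish identically for \<open>l = j\<close>.\<close>
    define M' where "M' = (\<lambda>i l x. M p j x * M i l x - M i j x * M p l x)"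
    have "card J < card (I - {p})" using insert p by simp
    moreover have "M' i l \<in> B" if "i \<in> I - {p}" "l \<in> J" for i l
      unfolding M'_def using that p insert.prems
      by (intro subalg_diff subalg_mult assms) auto
    ultimately obtain b where b: "\<forall>i\<in>I-{p}. b i \<in> B" "\<exists>i\<in>I-{p}. \<exists>x\<in>W. b i x \<noteq> 0"
      "\<forall>l\<in>J. \<forall>x\<in>W. (\<Sum>i\<in>I-{p}. b i x * M' i l x) = 0"
      using insert.IH[of "I - {p}" M'] insert.prems by auto
    \<comment> \<open>The unknown \<open>p\<close> is chosen so that equation \<open>j\<close>
      holds. Scaling the others by the pivot spares the division, and the solution stays nonzero
      because \<open>A\<close> is a domain.\<close>
    define c where "c = (\<lambda>i x. if i = p then - (\<Sum>i\<in>I-{p}. b i x * M i j x) else b i x * M p j x)"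
    have "c i \<in> B" if "i \<in> I" for i
    proof (cases "i = p")
      case True
      have "c p = (\<lambda>x. - (\<Sum>i\<in>I-{p}. b i x * M i j x))"
        by (simp add: c_def fun_eq_iff)
      moreover have "\<dots> \<in> B"
        by (intro subalg_uminus subalg_sum subalg_mult assms) (use b insert.prems in auto)
      ultimately show ?thesis using True by simp
    next
      case False
      then have "c i = (\<lambda>x. b i x * M p j x)"
        by (simp add: c_def fun_eq_iff)
      moreover have "\<dots> \<in> B"
        by (intro subalg_mult assms) (use False that b insert.prems p in auto)
      ultimately show ?thesis by simp
    qed
    moreover have "\<exists>i\<in>I. \<exists>x\<in>W. c i x \<noteq> 0"
    proof -
      from b obtain i where i: "i \<in> I - {p}" "\<exists>x\<in>W. b i x \<noteq> 0" by blast
      have "\<exists>x\<in>W. b i x * M p j x \<noteq> 0"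
      proof (rule mult_nonzero)
        show "b i \<in> A" using b(1) i(1) assms(5) by blast
        show "M p j \<in> A" using insert.prems(3)[OF p(1)] assms(5) by blast
      qed (use i p in blast)+
      then show ?thesis using i by (intro bexI[of _ i]) (auto simp: c_def)
    qed
    moreover have "(\<Sum>i\<in>I. c i x * M i l x) = 0" if "l \<in> insert j J" "x \<in> W" for l x
    proof -
      have "(\<Sum>i\<in>I. c i x * M i l x) = c p x * M p l x + (\<Sum>i\<in>I-{p}. c i x * M i l x)"
        using p insert.prems by (simp add: sum.remove)
      also have "(\<Sum>i\<in>I-{p}. c i x * M i l x) = (\<Sum>i\<in>I-{p}. b i x * M p j x * M i l x)"
        by (intro sum.cong) (auto simp: c_def)
      also have "c p x * M p l x = (\<Sum>i\<in>I-{p}. - (b i x * M i j x * M p l x))"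
        by (simp add: c_def sum_distrib_right sum_negf)
      also have "\<dots> + (\<Sum>i\<in>I-{p}. b i x * M p j x * M i l x) = (\<Sum>i\<in>I-{p}. b i x * M' i l x)"
        unfolding sum.distrib[symmetric] by (intro sum.cong) (auto simp: M'_def algebra_simps)
      also have "\<dots> = 0"
      proof (cases "l = j")
        case True
        then show ?thesis by (simp add: M'_def mult.commute)
      next
        case False
        then show ?thesis using b that by auto
      qed
      finally show ?thesis .
    qed
    ultimately show ?thesis by (intro exI[of _ c]) auto
  qed
qed

text \<open>
  Algebraicity over \<open>B\<close> is compared with the existence of a finitely generated \<open>B\<close>-module that is
  stable under \<open>a\<close> after clearing a denominator. The latter is visibly preserved by sums and
  products; the way back is the pigeonhole principle \<open>linear_system\<close>.
\<close>

definition alg_over :: "('x \<Rightarrow> 'k) set \<Rightarrow> ('x \<Rightarrow> 'k) \<Rightarrow> bool" where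
  "alg_over B a \<longleftrightarrow> (\<exists>e c. (\<forall>i\<le>e. c i \<in> B) \<and> (\<exists>i\<le>e. \<exists>x\<in>W. c i x \<noteq> 0) \<and>
     (\<forall>x\<in>W. (\<Sum>i\<le>e. c i x * a x ^ i) = 0))"

text \<open>The function \<open>c\<close> is the common denominator. The nonzero member
  \<open>t\<^sub>0\<close> excludes the zero module, for which stability would say nothing; it is
  what gets cancelled when an algebraic relation is recovered.\<close>

definition finite_over :: "('x \<Rightarrow> 'k) set \<Rightarrow> ('x \<Rightarrow> 'k) \<Rightarrow> bool" where
  "finite_over B a \<longleftrightarrow> (\<exists>T t\<^sub>0 c. finite T \<and> T \<subseteq> A \<and> t\<^sub>0 \<in> T \<and> (\<exists>x\<in>W. t\<^sub>0 x \<noteq> 0) \<and>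
     c \<in> B \<and> (\<exists>x\<in>W. c x \<noteq> 0) \<and>
     (\<forall>t\<in>T. \<exists>v\<in>lin_span B T. \<forall>x\<in>W. c x * a x * t x = v x))"

text \<open>In a relation of least degree the leading coefficient is nonzero, since otherwise it
  could be dropped. The constant coefficient is nonzero too unless \<open>a\<close> vanishes on
  \<open>W\<close>, since otherwise a factor \<open>a\<close> could be cancelled. Degree zero is
  impossible, whence \<open>Suc e\<close>.\<close>

lemma alg_over_minimal:
  assumes "alg_over B a" "a \<in> A" "subalg B" "B \<subseteq> A"
  shows "\<exists>e c. (\<forall>i\<le>Suc e. c i \<in> B) \<and> (\<exists>x\<in>W. c 0 x \<noteq> 0 \<or> (\<forall>y\<in>W. a y = 0)) \<and>
    (\<exists>x\<in>W. c (Suc e) x \<noteq> 0) \<and> (\<forall>x\<in>W. (\<Sum>i\<le>Suc e. c i x * a x ^ i) = 0)"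
proof -
  define P where "P e \<longleftrightarrow> (\<exists>c. (\<forall>i\<le>e. c i \<in> B) \<and> (\<exists>i\<le>e. \<exists>x\<in>W. c i x \<noteq> 0) \<and>
     (\<forall>x\<in>W. (\<Sum>i\<le>e. c i x * a x ^ i) = 0))" for e
  have "\<exists>e. P e" using assms(1) by (auto simp: alg_over_def P_def)
  define e where "e = (LEAST e. P e)"
  have "P e" using \<open>\<exists>e. P e\<close> unfolding e_def by (rule LeastI_ex)
  have least: "\<not> P e'" if "e' < e" for e' using that unfolding e_def by (rule not_less_Least)
  from \<open>P e\<close> obtain c where c: "\<And>i. i \<le> e \<Longrightarrow> c i \<in> B" "\<exists>i\<le>e. \<exists>x\<in>W. c i x \<noteq> 0"
     "\<And>x. x \<in> W \<Longrightarrow> (\<Sum>i\<le>e. c i x * a x ^ i) = 0" unfolding P_def by auto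
  have "e \<noteq> 0"
  proof
    assume "e = 0"
    then show False using c(2,3) by auto
  qed
  then obtain e' where e': "e = Suc e'" by (cases e) auto
  have 1: "\<exists>x\<in>W. c (Suc e') x \<noteq> 0"
  proof (rule ccontr)
    assume no: "\<not> ?thesis"
    have "\<exists>i\<le>e'. \<exists>x\<in>W. c i x \<noteq> 0" using c(2) no unfolding e' by (metis le_Suc_eq)
    moreover have "\<forall>x\<in>W. (\<Sum>i\<le>e'. c i x * a x ^ i) = 0" using c(3) no unfolding e' by auto
    ultimately have "P e'" unfolding P_def using c(1) e' by (intro exI[of _ c]) auto
    then show False using least e' by auto
  qed
  have 2: "\<exists>x\<in>W. c 0 x \<noteq> 0 \<or> (\<forall>y\<in>W. a y = 0)"
  proof (rule ccontr)
    assume no: "\<not> ?thesis"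
    then have a: "\<exists>y\<in>W. a y \<noteq> 0" using nonempty by blast
    \<comment> \<open>With a vanishing constant coefficient the relation is \<open>a\<close> times
      one of lower degree.\<close>
    have eq: "a x * (\<Sum>i\<le>e'. c (Suc i) x * a x ^ i) = 0" if "x \<in> W" for x
    proof -
      have "0 = c 0 x + (\<Sum>i\<le>e'. c (Suc i) x * a x ^ Suc i)"
        using c(3)[OF that] unfolding e' by (simp only: sum.atMost_Suc_shift) simp
      then show ?thesis using no that by (auto simp: sum_distrib_left algebra_simps)
    qed
    have "(\<lambda>x. \<Sum>i\<le>e'. c (Suc i) x * a x ^ i) \<in> A"
      using assms(4) c(1) e' by (intro subalg_sum subalg_mult subalg_power subalg assms(2)) auto
    then have "\<forall>x\<in>W. (\<Sum>i\<le>e'. c (Suc i) x * a x ^ i) = 0"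
      using domain[of a] assms(2) a eq by blast
    moreover have "\<exists>i\<le>e'. \<exists>x\<in>W. c (Suc i) x \<noteq> 0" using 1 by blast
    ultimately have "P e'" unfolding P_def using c(1) e' by (intro exI[of _ "\<lambda>i. c (Suc i)"]) auto
    then show False using least e' by auto
  qed
  show ?thesis
    by (intro exI[of _ e'] exI[of _ c] conjI) (use c 1 2 e' in auto)
qed

text \<open>The powers of \<open>a\<close> up to degree \<open>e\<close> generate the module. The
  leading coefficient of a relation of degree \<open>Suc e\<close> is the denominator: it makes the
  next power expressible through the lower ones.\<close>

lemma alg_imp_finite_over:
  assumes "alg_over B a" "a \<in> A" "subalg B" "B \<subseteq> A"
  shows "finite_over B a"
proof -
  obtain e c where c: "\<And>i. i \<le> Suc e \<Longrightarrow> c i \<in> B"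
    "\<exists>x\<in>W. c 0 x \<noteq> 0 \<or> (\<forall>y\<in>W. a y = 0)" and c': "\<exists>x\<in>W. c (Suc e) x \<noteq> 0"
    "\<And>x. x \<in> W \<Longrightarrow> (\<Sum>i\<le>Suc e. c i x * a x ^ i) = 0"
    using alg_over_minimal[OF assms] by auto
  note c = c(1) c'
  define T where "T = (\<lambda>i x. a x ^ i) ` {..e}"
  have T: "finite T" "T \<subseteq> A" unfolding T_def using subalg_power[OF subalg assms(2)] by auto
  have base: "(\<lambda>x. b x * a x ^ i) \<in> lin_span B T" if "i \<le> e" "b \<in> B" for i b
    using span_base[OF assms(3) T(1), of "\<lambda>x. a x ^ i" b] that unfolding T_def by auto
  have "\<exists>v\<in>lin_span B T. \<forall>x\<in>W. c (Suc e) x * a x * t x = v x" if "t \<in> T" for t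
  proof -
    from that obtain i where i: "i \<le> e" "t = (\<lambda>x. a x ^ i)" unfolding T_def by auto
    show ?thesis
    proof (cases "i = e")
      case False
      then show ?thesis using i base[of "Suc i" "c (Suc e)"] c(1)[of "Suc e"]
        by (intro bexI[of _ "\<lambda>x. c (Suc e) x * a x ^ Suc i"]) (auto simp: mult.assoc)
    next
      case True
      have "(\<lambda>x. \<Sum>i\<le>e. - c i x * a x ^ i) \<in> lin_span B T"
        by (rule span_sum[OF assms(3)], rule base) (use c(1) subalg_uminus[OF assms(3)] in auto)
      moreover have "c (Suc e) x * a x * t x = (\<Sum>i\<le>e. - c i x * a x ^ i)" if "x \<in> W" for x
        using c(3)[OF that] i True by (simp add: sum_negf eq_neg_iff_add_eq_0 mult.assoc add.commute)
      ultimately show ?thesis by (intro bexI[of _ "\<lambda>x. \<Sum>i\<le>e. - c i x * a x ^ i"] ballI)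
    qed
  qed
  moreover have "(\<lambda>x. 1) \<in> T" unfolding T_def by (rule image_eqI[of _ _ 0]) auto
  ultimately show ?thesis unfolding finite_over_def using T c(1)[of "Suc e"] c(2) nonempty
    by (intro exI[of _ T] exI[of _ "\<lambda>x. 1"] exI[of _ "c (Suc e)"]) auto
qed

text \<open>Takes the place of the determinant trick. The elements \<open>(c a)^i t\<^sub>0\<close>
  with \<open>i \<le> card T\<close> are one more than the generators of the module containing them,
  hence dependent over \<open>B\<close>; cancelling \<open>t\<^sub>0\<close> leaves a relation for
  \<open>a\<close>.\<close>

lemma finite_over_imp_alg:
  assumes "finite_over B a" "a \<in> A" "subalg B" "B \<subseteq> A"
  shows "alg_over B a"
proof -
  obtain T t\<^sub>0 c where T: "finite T" "T \<subseteq> A" "t\<^sub>0 \<in> T" "\<exists>x\<in>W. t\<^sub>0 x \<noteq> 0" "c \<in> B" "\<exists>x\<in>W. c x \<noteq> 0"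
    "\<forall>t\<in>T. \<exists>v\<in>lin_span B T. \<forall>x\<in>W. c x * a x * t x = v x"
    using assms(1) unfolding finite_over_def by blast
  note T = T(1-6) T(7)[rule_format]
  have step: "\<exists>w\<in>lin_span B T. \<forall>x\<in>W. c x * a x * v x = w x" if v: "v \<in> lin_span B T" for v
  proof -
    from v obtain b where b: "\<forall>t\<in>T. b t \<in> B" "v = (\<lambda>x. \<Sum>t\<in>T. b t x * t x)"
      unfolding lin_span_def by blast
    from T(7) obtain w where w: "\<And>t. t \<in> T \<Longrightarrow> w t \<in> lin_span B T"
      "\<And>t x. t \<in> T \<Longrightarrow> x \<in> W \<Longrightarrow> c x * a x * t x = w t x" by metis
    have "(\<lambda>x. \<Sum>t\<in>T. b t x * w t x) \<in> lin_span B T"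
      using w b by (intro span_sum span_scale assms(3)) auto
    moreover have "c x * a x * v x = (\<Sum>t\<in>T. b t x * w t x)" if "x \<in> W" for x
    proof -
      have "c x * a x * v x = (\<Sum>t\<in>T. b t x * (c x * a x * t x))"
        by (simp add: b sum_distrib_left mult_ac)
      then show ?thesis using w(2) that by simp
    qed
    ultimately show ?thesis by (intro bexI[of _ "\<lambda>x. \<Sum>t\<in>T. b t x * w t x"] ballI)
  qed
  have "\<exists>w\<in>lin_span B T. \<forall>x\<in>W. (c x * a x) ^ i * t\<^sub>0 x = w x" for i
  proof (induction i)
    case 0
    show ?case using span_base[OF assms(3) T(1) T(3) subalg_const[OF assms(3), of 1]] by auto
  next
    case (Suc i)
    then obtain w where w: "w \<in> lin_span B T" "\<forall>x\<in>W. (c x * a x) ^ i * t\<^sub>0 x = w x" by blast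
    from step[OF w(1)] obtain w' where "w' \<in> lin_span B T" "\<forall>x\<in>W. c x * a x * w x = w' x" by blast
    then show ?case using w(2) by (intro bexI[of _ w']) (auto simp: mult.assoc)
  qed
  note powers = this
  have "\<exists>M. (\<forall>t\<in>T. M t \<in> B) \<and> (\<forall>x\<in>W. (c x * a x) ^ i * t\<^sub>0 x = (\<Sum>t\<in>T. M t x * t x))" for i
  proof -
    from powers[of i] obtain w where "w \<in> lin_span B T" "\<forall>x\<in>W. (c x * a x) ^ i * t\<^sub>0 x = w x"
      by blast
    then show ?thesis unfolding lin_span_def by auto
  qed
  from choice[OF allI[OF this]] obtain M where
    "\<forall>i. (\<forall>t\<in>T. M i t \<in> B) \<and> (\<forall>x\<in>W. (c x * a x) ^ i * t\<^sub>0 x = (\<Sum>t\<in>T. M i t x * t x))" ..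
  then have M: "\<And>i t. t \<in> T \<Longrightarrow> M i t \<in> B"
    "\<And>i x. x \<in> W \<Longrightarrow> (c x * a x) ^ i * t\<^sub>0 x = (\<Sum>t\<in>T. M i t x * t x)" by simp_all
  \<comment> \<open>One unknown per power from 0 to \<open>card T\<close>, one equation per
    generator: exactly one unknown too many.\<close>
  have "\<exists>b. (\<forall>i\<in>{..card T}. b i \<in> B) \<and> (\<exists>i\<in>{..card T}. \<exists>x\<in>W. b i x \<noteq> 0) \<and>
    (\<forall>t\<in>T. \<forall>x\<in>W. (\<Sum>i\<le>card T. b i x * M i t x) = 0)"
    by (rule linear_system) (simp_all only: finite_atMost card_atMost T(1) M(1) assms(3,4) lessI)
  then obtain b where b: "\<forall>i\<in>{..card T}. b i \<in> B" "\<exists>i\<in>{..card T}. \<exists>x\<in>W. b i x \<noteq> 0"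
    "\<forall>t\<in>T. \<forall>x\<in>W. (\<Sum>i\<le>card T. b i x * M i t x) = 0"
    by blast
  \<comment> \<open>The powers of the denominator \<open>c\<close> are absorbed into the
    coefficients, so that the relation is one for \<open>a\<close> and not for
    \<open>c a\<close>.\<close>
  let ?p = "\<lambda>x. \<Sum>i\<le>card T. (b i x * c x ^ i) * a x ^ i"
  have "?p x * t\<^sub>0 x = 0" if "x \<in> W" for x
  proof -
    have "?p x * t\<^sub>0 x = (\<Sum>i\<le>card T. b i x * ((c x * a x) ^ i * t\<^sub>0 x))"
      by (simp add: sum_distrib_right sum_distrib_left power_mult_distrib mult_ac)
    also have "\<dots> = (\<Sum>i\<le>card T. \<Sum>t\<in>T. b i x * M i t x * t x)"
      by (simp add: M(2)[OF that] sum_distrib_left mult.assoc)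
    also have "\<dots> = (\<Sum>t\<in>T. (\<Sum>i\<le>card T. b i x * M i t x) * t x)"
      by (subst sum.swap) (simp add: sum_distrib_right)
    finally show ?thesis using b(3) that by simp
  qed
  moreover have cf: "(\<lambda>x. b i x * c x ^ i) \<in> B" if "i \<le> card T" for i
    using b T that by (intro subalg_mult subalg_power assms(3)) auto
  moreover have "?p \<in> A"
  proof (rule subalg_sum[OF subalg])
    fix i assume "i \<in> {..card T}"
    then have "(\<lambda>x. b i x * c x ^ i) \<in> A" using cf assms(4) by auto
    from subalg_mult[OF subalg this subalg_power[OF subalg assms(2)]]
    show "(\<lambda>x. b i x * c x ^ i * a x ^ i) \<in> A" .
  qed
  ultimately have "\<forall>x\<in>W. ?p x = 0" using domain[of ?p t\<^sub>0] T by blast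
  moreover have "\<exists>i\<le>card T. \<exists>x\<in>W. b i x * c x ^ i \<noteq> 0"
  proof -
    from b obtain i where i: "i \<le> card T" "\<exists>x\<in>W. b i x \<noteq> 0" by blast
    have "\<exists>x\<in>W. b i x * c x ^ i \<noteq> 0"
      using i b T assms(4) power_nonzero[of c i]
      by (intro mult_nonzero[where f = "b i" and g = "\<lambda>x. c x ^ i"]) (auto intro!: subalg_power[OF subalg])
    then show ?thesis using i by blast
  qed
  ultimately show ?thesis
    unfolding alg_over_def using cf
    by (intro exI[of _ "card T"] exI[of _ "\<lambda>i x. b i x * c x ^ i"]) auto
qed

lemma finite_over_base:
  assumes "subalg B" "a \<in> B"
  shows "finite_over B a"
proof -
  have "(\<lambda>x. a x * (\<lambda>x. 1) x) \<in> lin_span B {\<lambda>x. 1}"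
    by (rule span_base) (use assms in auto)
  then show ?thesis unfolding finite_over_def
    using nonempty subalg_const[OF subalg, of 1] subalg_const[OF assms(1), of 1]
    by (intro exI[of _ "{\<lambda>x. 1}"] exI[of _ "\<lambda>x. 1"]) auto
qed

text \<open>The pairwise products of the two generating sets, with the product of the two
  denominators, serve for the sum and for the product alike.\<close>

lemma finite_over_add_mult:
  assumes "finite_over B a" "finite_over B a'" "subalg B" "B \<subseteq> A"
  shows "finite_over B (\<lambda>x. a x + a' x)" "finite_over B (\<lambda>x. a x * a' x)"
proof -
  obtain T t\<^sub>0 c where T: "finite T" "T \<subseteq> A" "t\<^sub>0 \<in> T" "\<exists>x\<in>W. t\<^sub>0 x \<noteq> 0" "c \<in> B" "\<exists>x\<in>W. c x \<noteq> 0"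
    "\<forall>t\<in>T. \<exists>v\<in>lin_span B T. \<forall>x\<in>W. c x * a x * t x = v x"
    using assms(1) unfolding finite_over_def by blast
  note T = T(1-6) T(7)[rule_format]
  obtain U u\<^sub>0 d where U: "finite U" "U \<subseteq> A" "u\<^sub>0 \<in> U" "\<exists>x\<in>W. u\<^sub>0 x \<noteq> 0" "d \<in> B" "\<exists>x\<in>W. d x \<noteq> 0"
    "\<forall>t\<in>U. \<exists>v\<in>lin_span B U. \<forall>x\<in>W. d x * a' x * t x = v x"
    using assms(2) unfolding finite_over_def by blast
  note U = U(1-6) U(7)[rule_format]
  define TU where "TU = (\<lambda>(t, s) x. t x * s x) ` (T \<times> U)"
  have 1: "finite TU" "TU \<subseteq> A" "(\<lambda>x. t\<^sub>0 x * u\<^sub>0 x) \<in> TU" "\<exists>x\<in>W. t\<^sub>0 x * u\<^sub>0 x \<noteq> 0"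
    "(\<lambda>x. c x * d x) \<in> B" "\<exists>x\<in>W. c x * d x \<noteq> 0"
    unfolding TU_def using T U assms(4) subalg_mult[OF subalg] mult_nonzero subalg_mult[OF assms(3)]
    by (auto simp: subset_iff simp del: mult_eq_0_iff)
  have "(\<exists>v\<in>lin_span B TU. \<forall>x\<in>W. (c x * d x) * (a x + a' x) * t x = v x) \<and>
        (\<exists>v\<in>lin_span B TU. \<forall>x\<in>W. (c x * d x) * (a x * a' x) * t x = v x)" if tTU: "t \<in> TU" for t
  proof -
    from tTU obtain r s where rs: "r \<in> T" "s \<in> U" "t = (\<lambda>x. r x * s x)" unfolding TU_def by auto
    from T(7)[OF rs(1)] obtain v where v: "v \<in> lin_span B T" "\<And>x. x \<in> W \<Longrightarrow> c x * a x * r x = v x" by blast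
    from U(7)[OF rs(2)] obtain w where w: "w \<in> lin_span B U" "\<And>x. x \<in> W \<Longrightarrow> d x * a' x * s x = w x" by blast
    have r: "(\<lambda>x. c x * r x) \<in> lin_span B T" and s: "(\<lambda>x. d x * s x) \<in> lin_span B U"
      using span_base[OF assms(3)] T U rs by auto
    have "(\<lambda>x. v x * (d x * s x)) \<in> lin_span B TU" "(\<lambda>x. (c x * r x) * w x) \<in> lin_span B TU"
       and vw: "(\<lambda>x. v x * w x) \<in> lin_span B TU"
      unfolding TU_def
      using span_mult[OF assms(3) T(1) U(1) v(1) s] span_mult[OF assms(3) T(1) U(1) r w(1)]
        span_mult[OF assms(3) T(1) U(1) v(1) w(1)] by auto
    from span_add[OF assms(3) this(1,2)]
    have "(\<lambda>x. v x * (d x * s x) + c x * r x * w x) \<in> lin_span B TU" .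
    moreover have "(c x * d x) * (a x + a' x) * t x = v x * (d x * s x) + c x * r x * w x" 
      "(c x * d x) * (a x * a' x) * t x = v x * w x" if "x \<in> W" for x
      using v(2)[OF that, symmetric] w(2)[OF that, symmetric] rs by (auto simp: algebra_simps)
    ultimately show ?thesis using vw
      by (intro conjI bexI[of _ "\<lambda>x. v x * (d x * s x) + c x * r x * w x"]
            bexI[of _ "\<lambda>x. v x * w x"] ballI)
  qed
  then show "finite_over B (\<lambda>x. a x + a' x)" "finite_over B (\<lambda>x. a x * a' x)"
    unfolding finite_over_def using 1
    by (intro exI[of _ TU] exI[of _ "\<lambda>x. t\<^sub>0 x * u\<^sub>0 x"] exI[of _ "\<lambda>x. c x * d x"], simp)+
qed

lemma alg_over_adjoin:
  assumes "subalg B" "B \<subseteq> A" "E \<subseteq> A" "\<And>e. e \<in> E \<Longrightarrow> alg_over B e" "a \<in> adjoin E"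
  shows "alg_over B a"
proof -
  have "finite_over B a"
    using assms(5)
  proof induction
    case (const c)
    show ?case using finite_over_base subalg_const assms(1) by blast
  next
    case (incl s)
    then show ?case using alg_imp_finite_over assms by blast
  qed (use finite_over_add_mult assms in blast)+
  moreover have "a \<in> A" using adjoin_least[OF subalg assms(3)] assms(5) by blast
  ultimately show ?thesis using finite_over_imp_alg assms by blast
qed

text \<open>Division in disguise, with \<open>h\<close> as the quotient of \<open>f h\<close> by
  \<open>f\<close>. A relation of \<open>f\<close> with nonzero constant coefficient
  \<open>c 0\<close> writes \<open>c 0\<close> as \<open>f\<close> times a polynomial in
  \<open>f\<close>. Hence \<open>c 0 h\<close> is a polynomial in \<open>f\<close> and
  \<open>f h\<close>, and \<open>c 0\<close> can be moved into the denominator allowed by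
  \<open>finite_over\<close>.\<close>

lemma alg_over_quotient:
  assumes "subalg B" "B \<subseteq> A" "f \<in> A" "h \<in> A" "\<exists>x\<in>W. f x \<noteq> 0"
    and "alg_over B f" "alg_over B (\<lambda>x. f x * h x)"
  shows "alg_over B h"
proof -
  obtain e c where c: "\<And>i. i \<le> Suc e \<Longrightarrow> c i \<in> B" "\<exists>x\<in>W. c 0 x \<noteq> 0 \<or> (\<forall>y\<in>W. f y = 0)"
    and "\<exists>x\<in>W. c (Suc e) x \<noteq> 0" and c': "\<And>x. x \<in> W \<Longrightarrow> (\<Sum>i\<le>Suc e. c i x * f x ^ i) = 0"
    using alg_over_minimal[OF assms(6,3,1,2)] by auto
  note c = c c'
  let ?q = "\<lambda>x. (f x * h x) * (\<Sum>i\<le>e. - c (Suc i) x * f x ^ i)"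
  define E where "E = B \<union> {f, \<lambda>x. f x * h x}"
  have EA: "E \<subseteq> A" unfolding E_def using assms subalg_mult[OF subalg] by auto
  have "?q \<in> adjoin E"
  proof (rule adjoin.mult)
    show "(\<lambda>x. f x * h x) \<in> adjoin E" by (auto simp: E_def intro: adjoin.incl)
    show "(\<lambda>x. \<Sum>i\<le>e. - c (Suc i) x * f x ^ i) \<in> adjoin E"
      using c(1)
      by (intro subalg_sum subalg_mult subalg_power subalg_uminus subalg_adjoin)
         (auto simp: E_def intro!: adjoin.incl)
  qed
  then have fq: "finite_over B ?q"
    using alg_imp_finite_over[OF _ _ assms(1,2)] alg_over_adjoin[OF assms(1,2) EA]
      adjoin_least[OF subalg EA] assms(6,7) finite_over_imp_alg[OF finite_over_base] assms(1,2)
    unfolding E_def by blast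
  \<comment> \<open>This is the relation solved for its constant coefficient and multiplied by
    \<open>h\<close>.\<close>
  have eq: "?q x = c 0 x * h x" if "x \<in> W" for x
  proof -
    have "0 = c 0 x + (\<Sum>i\<le>e. c (Suc i) x * f x ^ Suc i)"
      using c(3)[OF that] by (simp only: sum.atMost_Suc_shift) simp
    then have "c 0 x = f x * (\<Sum>i\<le>e. - c (Suc i) x * f x ^ i)"
      by (simp add: sum_distrib_left sum_negf eq_neg_iff_add_eq_0 mult_ac)
    then show ?thesis by (simp add: mult_ac)
  qed
  obtain T t\<^sub>0 d where T: "finite T" "T \<subseteq> A" "t\<^sub>0 \<in> T" "\<exists>x\<in>W. t\<^sub>0 x \<noteq> 0" "d \<in> B" "\<exists>x\<in>W. d x \<noteq> 0"
    "\<forall>t\<in>T. \<exists>v\<in>lin_span B T. \<forall>x\<in>W. d x * ?q x * t x = v x"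
    using fq unfolding finite_over_def by blast
  note T = T(1-6) T(7)[rule_format]
  have "\<exists>x\<in>W. d x * c 0 x \<noteq> 0"
    using T c assms by (intro mult_nonzero) auto
  moreover have "(\<lambda>x. d x * c 0 x) \<in> B" using T c(1)[of 0] subalg_mult[OF assms(1)] by auto
  moreover have "\<exists>v\<in>lin_span B T. \<forall>x\<in>W. (d x * c 0 x) * h x * t x = v x" if "t \<in> T" for t
  proof -
    from T(7)[OF that] obtain v where v: "v \<in> lin_span B T" "\<forall>x\<in>W. d x * ?q x * t x = v x" by blast
    have "(d x * c 0 x) * h x * t x = v x" if "x \<in> W" for x
    proof -
      have "(d x * c 0 x) * h x * t x = d x * (c 0 x * h x) * t x" by (simp add: mult_ac)
      also have "\<dots> = d x * ?q x * t x" by (simp only: eq[OF that])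
      also have "\<dots> = v x" using v(2) that by blast
      finally show ?thesis .
    qed
    then show ?thesis using v(1) by blast
  qed
  ultimately have "finite_over B h"
    unfolding finite_over_def using T(1-4)
    by (intro exI[of _ T] exI[of _ t\<^sub>0] exI[of _ "\<lambda>x. d x * c 0 x"]) blast
  then show ?thesis using finite_over_imp_alg assms by blast
qed

end

section \<open>Algebraic independence\<close>

text \<open>
  Polynomials are treated as functions on \<open>nat \<Rightarrow> 'k\<close>, as in \<^const>\<open>polynomial_functions\<close>;
  over an infinite field nothing is lost.
\<close>

definition poly_funs :: "nat set \<Rightarrow> ((nat \<Rightarrow> 'k::field) \<Rightarrow> 'k) set" where
  "poly_funs I = adjoin ((\<lambda>i v. v i) ` I)"

definition indep :: "'x set \<Rightarrow> nat set \<Rightarrow> (nat \<Rightarrow> 'x \<Rightarrow> 'k::field) \<Rightarrow> bool" where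
  "indep W I a \<longleftrightarrow> (\<forall>P\<in>poly_funs I. (\<forall>x\<in>W. P (\<lambda>i. a i x) = 0) \<longrightarrow> (\<forall>v. P v = 0))"

lemma subalg_poly_funs: "subalg (poly_funs I)"
  unfolding poly_funs_def by (rule subalg_adjoin)

lemma poly_funs_coord: "i \<in> I \<Longrightarrow> (\<lambda>v. v i) \<in> poly_funs I"
  unfolding poly_funs_def by (auto intro: adjoin.incl)

lemma poly_funs_mono: "I \<subseteq> J \<Longrightarrow> poly_funs I \<subseteq> poly_funs J"
  unfolding poly_funs_def by (intro adjoin_mono) auto

lemma poly_funs_cong:
  assumes "P \<in> poly_funs I" "\<And>i. i \<in> I \<Longrightarrow> v i = w i"
  shows "P v = P w"
  using assms(1) unfolding poly_funs_def by induction (use assms(2) in auto)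

lemma poly_funs_subst:
  assumes "P \<in> poly_funs I" "subalg C" "\<And>i. i \<in> I \<Longrightarrow> b i \<in> C"
  shows "(\<lambda>x. P (\<lambda>i. b i x)) \<in> C"
  using assms(1) unfolding poly_funs_def
  by induction (use assms(2,3) in \<open>auto intro: subalg_const subalg_add subalg_mult\<close>)

lemma adjoin_image:
  assumes "b \<in> adjoin (a ` I)"
  shows "\<exists>P\<in>poly_funs I. b = (\<lambda>x. P (\<lambda>i. a i x))"
  using assms
proof induction
  case (const c)
  show ?case using subalg_const[OF subalg_poly_funs] by (intro bexI[of _ "\<lambda>v. c"]) auto
next
  case (incl s)
  then obtain i where "i \<in> I" "s = a i" by auto
  then show ?case using poly_funs_coord by (intro bexI[of _ "\<lambda>v. v i"]) auto
next
  case (add f g)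
  then obtain P Q where "P \<in> poly_funs I" "Q \<in> poly_funs I"
    "f = (\<lambda>x. P (\<lambda>i. a i x))" "g = (\<lambda>x. Q (\<lambda>i. a i x))" by blast
  then show ?case using subalg_add[OF subalg_poly_funs, of P I Q]
    by (intro bexI[of _ "\<lambda>v. P v + Q v"]) auto
next
  case (mult f g)
  then obtain P Q where "P \<in> poly_funs I" "Q \<in> poly_funs I"
    "f = (\<lambda>x. P (\<lambda>i. a i x))" "g = (\<lambda>x. Q (\<lambda>i. a i x))" by blast
  then show ?case using subalg_mult[OF subalg_poly_funs, of P I Q]
    by (intro bexI[of _ "\<lambda>v. P v * Q v"]) auto
qed

text \<open>Polynomials in \<open>t\<close> over \<open>C\<close> in nested form. Inductions peel
  off the constant coefficient and one factor \<open>t\<close>, which is the shape the independence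
  argument needs; no degree or coefficient function has to be defined.\<close>

inductive_set horner :: "('x \<Rightarrow> 'k::field) set \<Rightarrow> ('x \<Rightarrow> 'k) \<Rightarrow> ('x \<Rightarrow> 'k) set" for C t where
  const: "c \<in> C \<Longrightarrow> c \<in> horner C t"
| step: "c \<in> C \<Longrightarrow> q \<in> horner C t \<Longrightarrow> (\<lambda>v. c v + t v * q v) \<in> horner C t"

lemma horner_sum:
  assumes "q \<in> horner C t"
  shows "\<exists>e c. (\<forall>i\<le>e. c i \<in> C) \<and> q = (\<lambda>v. \<Sum>i\<le>e. c i v * t v ^ i)"
  using assms
proof induction
  case (const c)
  then show ?case by (intro exI[of _ "0::nat"] exI[of _ "\<lambda>i. c"]) auto
next
  case (step c q)
  then obtain e b where b: "\<forall>i\<le>e. b i \<in> C" "q = (\<lambda>v. \<Sum>i\<le>e. b i v * t v ^ i)" by blast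
  have "(\<lambda>v. c v + t v * q v) = (\<lambda>v. \<Sum>i\<le>Suc e. case_nat c b i v * t v ^ i)"
    unfolding sum.atMost_Suc_shift by (simp add: b sum_distrib_left mult_ac)
  moreover have "\<forall>i\<le>Suc e. case_nat c b i \<in> C"
    using step b by (auto split: nat.split)
  ultimately show ?case by blast
qed

context
  fixes C :: "('x \<Rightarrow> 'k::field) set" and t :: "'x \<Rightarrow> 'k"
  assumes C: "subalg C"
begin

lemma horner_add:
  assumes "p \<in> horner C t" "q \<in> horner C t"
  shows "(\<lambda>v. p v + q v) \<in> horner C t"
  using assms
proof (induction arbitrary: q)
  case (const c)
  from const(2) show ?case
  proof cases
    case const
    then show ?thesis using \<open>c \<in> C\<close> by (intro horner.const subalg_add[OF C])
  next
    case (step c' q')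
    then have "(\<lambda>v. (c v + c' v) + t v * q' v) \<in> horner C t"
      using \<open>c \<in> C\<close> by (intro horner.step subalg_add[OF C])
    then show ?thesis using step by (simp add: add.assoc)
  qed
next
  case (step c p)
  from step.prems show ?case
  proof cases
    case const
    then have "(\<lambda>v. (c v + q v) + t v * p v) \<in> horner C t"
      using step.hyps by (intro horner.step subalg_add[OF C])
    then show ?thesis by (simp add: algebra_simps)
  next
    case (step c' q')
    then have "(\<lambda>v. (c v + c' v) + t v * (p v + q' v)) \<in> horner C t"
      using \<open>c \<in> C\<close> \<open>\<And>q. q \<in> horner C t \<Longrightarrow> (\<lambda>v. p v + q v) \<in> horner C t\<close>
      by (intro horner.step subalg_add[OF C])
    then show ?thesis using step by (simp add: algebra_simps)
  qed
qed

lemma horner_scale: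
  assumes "p \<in> horner C t" "c \<in> C"
  shows "(\<lambda>v. c v * p v) \<in> horner C t"
  using assms(1)
proof induction
  case (const c')
  then show ?case using assms(2) by (intro horner.const subalg_mult[OF C])
next
  case (step c' q)
  then have "(\<lambda>v. (c v * c' v) + t v * (c v * q v)) \<in> horner C t"
    using assms(2) by (intro horner.step subalg_mult[OF C])
  then show ?case by (simp add: algebra_simps)
qed

lemma horner_mult:
  assumes "p \<in> horner C t" "q \<in> horner C t"
  shows "(\<lambda>v. p v * q v) \<in> horner C t"
  using assms(1)
proof induction
  case (const c)
  then show ?case using horner_scale assms(2) by blast
next
  case (step c p)
  have "(\<lambda>v. 0 + t v * (p v * q v)) \<in> horner C t"
    using step subalg_const[OF C, of 0] by (intro horner.step) auto
  from horner_add[OF horner_scale[OF assms(2) step(1)] this]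
  show ?case by (simp add: algebra_simps)
qed

end

lemma adjoin_insert_horner: "adjoin (insert t S) \<subseteq> horner (adjoin S) t"
proof
  fix p assume "p \<in> adjoin (insert t S)"
  then show "p \<in> horner (adjoin S) t"
  proof induction
    case (incl s)
    show ?case
    proof (cases "s = t")
      case True
      have "(\<lambda>v. 0 + t v * 1) \<in> horner (adjoin S) t"
        by (intro horner.intros adjoin.const)
      then show ?thesis using True by simp
    qed (use incl in \<open>auto intro: horner.const adjoin.incl\<close>)
  qed (auto intro: horner.const adjoin.const horner_add horner_mult subalg_adjoin)
qed

lemma poly_funs_insert:
  "P \<in> poly_funs (insert j I) \<Longrightarrow> P \<in> horner (poly_funs I) (\<lambda>v. v j)"
  unfolding poly_funs_def using adjoin_insert_horner[of "\<lambda>v. v j" "(\<lambda>i v. v i) ` I"] by auto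

section \<open>Stability and extension of algebraic independence\<close>

lemma indep_mono: "indep W I a \<Longrightarrow> W \<subseteq> W' \<Longrightarrow> J \<subseteq> I \<Longrightarrow> indep W' J a"
  unfolding indep_def using poly_funs_mono[of J I] by blast

lemma indepD:
  "indep W I a \<Longrightarrow> P \<in> poly_funs I \<Longrightarrow> (\<And>x. x \<in> W \<Longrightarrow> P (\<lambda>i. a i x) = 0) \<Longrightarrow> P v = 0"
  unfolding indep_def by simp

lemma indep_cong:
  assumes "indep W I a" "\<And>i x. i \<in> I \<Longrightarrow> x \<in> W \<Longrightarrow> a i x = b i x"
  shows "indep W I b"
  unfolding indep_def
proof (intro ballI impI allI)
  fix P v assume P: "P \<in> poly_funs I" "\<forall>x\<in>W. P (\<lambda>i. b i x) = 0"
  show "P v = 0"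
  proof (rule indepD[OF assms(1) P(1)])
    fix x assume "x \<in> W"
    then have "P (\<lambda>i. a i x) = P (\<lambda>i. b i x)"
      using assms(2) by (intro poly_funs_cong[OF P(1)]) auto
    then show "P (\<lambda>i. a i x) = 0" using P(2) \<open>x \<in> W\<close> by simp
  qed
qed

text \<open>A relation among the powers becomes a relation among the \<open>a i\<close> by
  substitution, so it vanishes at every tuple of powers. Over an algebraically closed field every
  tuple is one.\<close>

lemma indep_power:
  fixes a :: "nat \<Rightarrow> 'x \<Rightarrow> 'k::alg_closed_field"
  assumes "indep W I a" "\<And>i. n i > 0"
  shows "indep W I (\<lambda>i x. a i x ^ n i)"
  unfolding indep_def
proof (intro ballI impI allI)
  fix P and v :: "nat \<Rightarrow> 'k"
  assume P: "P \<in> poly_funs I" "\<forall>x\<in>W. P (\<lambda>i. a i x ^ n i) = 0"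
  have "(\<lambda>v. P (\<lambda>i. v i ^ n i)) \<in> poly_funs I"
    using P(1)
    by (rule poly_funs_subst) (auto intro!: subalg_power poly_funs_coord subalg_poly_funs)
  then have 0: "P (\<lambda>i. w i ^ n i) = 0" for w
    by (rule indepD[OF assms(1)]) (use P(2) in auto)
  have "\<forall>i. \<exists>y. y ^ n i = v i"
    by (intro allI nth_root_exists assms(2))
  from choice[OF this] obtain w where "\<forall>i. w i ^ n i = v i" ..
  then have "v = (\<lambda>i. w i ^ n i)" by auto
  then show "P v = 0" using 0[of w] by simp
qed

lemma power_sum_zero:
  fixes c :: "nat \<Rightarrow> 'k::field_char_0"
  assumes "\<And>t. (\<Sum>i\<le>e. c i * t ^ i) = 0" "i \<le> e"
  shows "c i = 0"
proof -
  define p where "p = (\<Sum>i\<le>e. Polynomial.monom (c i) i)"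
  have "poly p t = 0" for t
    using assms(1)[of t] by (simp add: p_def poly_sum poly_monom)
  then have "p = 0" using poly_all_0_iff_0 by blast
  moreover have "Polynomial.coeff p i = c i"
    using assms(2) by (simp add: p_def coeff_sum)
  ultimately show ?thesis by simp
qed

text \<open>A function vanishing on \<open>Y\<close> but not on the larger \<open>Y'\<close> is a
  new independent element. In a relation \<open>c + f q = 0\<close> on \<open>Y'\<close>,
  restriction to \<open>Y\<close> kills \<open>f q\<close>, so \<open>c\<close> is zero by
  independence on \<open>Y\<close>; then \<open>f\<close> cancels on \<open>Y'\<close> and the
  shorter \<open>q\<close> remains.\<close>

lemma indep_extend:
  assumes "function_domain Y' A" "Y \<subseteq> Y'" "indep Y I a" "\<And>i. i \<in> I \<Longrightarrow> a i \<in> A"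
    and f: "f \<in> A" "\<And>y. y \<in> Y \<Longrightarrow> f y = 0" "\<exists>y\<in>Y'. f y \<noteq> 0" and j: "j \<notin> I"
  shows "indep Y' (insert j I) (a(j := f))"
proof -
  interpret function_domain Y' A by fact
  let ?a = "a(j := f)"
  have c0: "\<forall>v. c v = 0" if c: "c \<in> poly_funs I" "\<forall>x\<in>Y. c (\<lambda>i. ?a i x) = 0" for c
  proof -
    have "c (\<lambda>i. ?a i x) = c (\<lambda>i. a i x)" for x
      by (rule poly_funs_cong[OF c(1)]) (use j in auto)
    then show ?thesis using c assms(3) unfolding indep_def by auto
  qed
  have "\<forall>v. q v = 0"
    if "q \<in> horner (poly_funs I) (\<lambda>v. v j)" "\<forall>x\<in>Y'. q (\<lambda>i. ?a i x) = 0" for q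
    using that
  proof induction
    case (const c)
    then show ?case using c0[of c] assms(2) by blast
  next
    case (step c q)
    have "\<forall>x\<in>Y. c (\<lambda>i. ?a i x) = 0"
    proof
      fix x assume "x \<in> Y"
      then show "c (\<lambda>i. ?a i x) = 0"
        using step.prems assms(2) f(2)[of x] by (force simp del: fun_upd_apply simp: fun_upd_same)
    qed
    then have cz: "\<forall>v. c v = 0" using c0[OF step.hyps(1)] by blast
    then have fq: "\<forall>x\<in>Y'. f x * q (\<lambda>i. ?a i x) = 0" using step.prems by auto
    have "q \<in> poly_funs (insert j I)"
      using step.hyps(2)
      by induction (use poly_funs_mono[of I "insert j I"] poly_funs_coord[of j "insert j I"]
          in \<open>auto intro!: subalg_add[OF subalg_poly_funs] subalg_mult[OF subalg_poly_funs]\<close>)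
    then have "(\<lambda>x. q (\<lambda>i. ?a i x)) \<in> A"
      by (rule poly_funs_subst[OF _ subalg]) (use assms(4) f(1) in auto)
    then have "\<forall>x\<in>Y'. q (\<lambda>i. ?a i x) = 0"
      using domain[OF f(1) _ fq] f(3) by blast
    then show ?case using step.IH cz by auto
  qed
  then show ?thesis
    unfolding indep_def using poly_funs_insert by blast
qed

context function_domain
begin

text \<open>A dependence is a polynomial in the new element, some coefficient of which is not
  identically zero. By independence of the old elements this coefficient stays nonzero after
  substitution.\<close>

lemma dependent_imp_alg:
  assumes "indep W I a" "\<not> indep W (insert j I) a"
  shows "alg_over (adjoin (a ` I)) (a j)"
proof -
  obtain P v where P: "P \<in> poly_funs (insert j I)" "\<forall>x\<in>W. P (\<lambda>i. a i x) = 0" "P v \<noteq> 0"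
    using assms(2) unfolding indep_def by blast
  obtain e c where c: "\<forall>i\<le>e. c i \<in> poly_funs I" "P = (\<lambda>v. \<Sum>i\<le>e. c i v * v j ^ i)"
    using horner_sum[OF poly_funs_insert[OF P(1)]] by blast
  obtain i where i: "i \<le> e" "c i v \<noteq> 0"
    using P(3) unfolding c(2) by (metis (no_types, lifting) atMost_iff mult_zero_left sum.neutral)
  then have "\<exists>x\<in>W. c i (\<lambda>i. a i x) \<noteq> 0"
    using assms(1) c(1) unfolding indep_def by blast
  moreover have "(\<lambda>x. c l (\<lambda>i. a i x)) \<in> adjoin (a ` I)" if "l \<le> e" for l
    by (rule poly_funs_subst[OF _ subalg_adjoin]) (use c(1) that in \<open>auto intro: adjoin.incl\<close>)
  ultimately show ?thesis
    unfolding alg_over_def using i(1) P(2) c(2)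
    by (intro exI[of _ e] exI[of _ "\<lambda>l x. c l (\<lambda>i. a i x)"]) auto
qed

end

locale char0_function_domain = function_domain W A
  for W :: "'x set" and A :: "('x \<Rightarrow> 'k::{alg_closed_field, field_char_0}) set"
begin

text \<open>An algebraic relation lifts to a polynomial that independence forces to vanish
  everywhere. Its coefficients do not see coordinate \<open>j\<close>, so letting that coordinate
  vary over the infinite field makes each of them zero.\<close>

lemma indep_imp_not_alg:
  assumes "indep W (insert j I) a" "j \<notin> I"
  shows "\<not> alg_over (adjoin (a ` I)) (a j)"
proof
  assume "alg_over (adjoin (a ` I)) (a j)"
  then obtain e c where c: "\<forall>i\<le>e. c i \<in> adjoin (a ` I)" "\<exists>i\<le>e. \<exists>x\<in>W. c i x \<noteq> 0"
     "\<forall>x\<in>W. (\<Sum>i\<le>e. c i x * a j x ^ i) = 0" unfolding alg_over_def by blast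
  have "\<forall>i. \<exists>P. i \<le> e \<longrightarrow> P \<in> poly_funs I \<and> c i = (\<lambda>x. P (\<lambda>i. a i x))"
    using c(1) adjoin_image by blast
  from choice[OF this] obtain P where P: "\<And>i. i \<le> e \<Longrightarrow> P i \<in> poly_funs I"
    "\<And>i. i \<le> e \<Longrightarrow> c i = (\<lambda>x. P i (\<lambda>i. a i x))" by blast
  let ?Q = "\<lambda>v. \<Sum>i\<le>e. P i v * v j ^ i"
  have "?Q \<in> poly_funs (insert j I)"
    using P(1) poly_funs_mono[of I "insert j I"]
    by (intro subalg_sum subalg_mult subalg_power subalg_poly_funs poly_funs_coord) auto
  moreover have "?Q (\<lambda>i. a i x) = 0" if "x \<in> W" for x
    using c(3) P(2) that by auto
  ultimately have Q: "?Q v = 0" for v by (rule indepD[OF assms(1)])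
  have "P i v = 0" if i: "i \<le> e" for i v
  proof (rule power_sum_zero[of "\<lambda>i. P i v" e])
    fix t
    have "P i v = P i (v(j := t))" if "i \<le> e" for i
      by (rule poly_funs_cong[OF P(1)[OF that]]) (use assms(2) in auto)
    then have "(\<Sum>i\<le>e. P i v * t ^ i) = (\<Sum>i\<le>e. P i (v(j := t)) * (v(j := t)) j ^ i)"
      by (intro sum.cong) (auto simp del: fun_upd_apply simp: fun_upd_same)
    then show "(\<Sum>i\<le>e. P i v * t ^ i) = 0" using Q[of "v(j := t)"] by simp
  qed fact
  then show False using c(2) P(2) by auto
qed

text \<open>Steinitz exchange, one index at a time. If no member of \<open>E\<close> could replace
  \<open>b j\<close>, all of \<open>E\<close> would be algebraic over the other elements, and so
  would \<open>b j\<close>, being a polynomial expression in \<open>E\<close>. The base stays fixed,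
  so closure of algebraic elements under sums and products suffices.\<close>

lemma exchange:
  assumes "finite I" "indep W I a" "\<And>i. i \<in> I \<Longrightarrow> a i \<in> A" "E \<subseteq> A" "A \<subseteq> adjoin E"
  shows "\<exists>b. (\<forall>i\<in>I. b i \<in> E) \<and> indep W I b"
proof -
  \<comment> \<open>Intermediate state: the indices in \<open>K\<close> are already exchanged, the
    others still carry some element of \<open>A\<close>.\<close>
  have "\<exists>b. (\<forall>i\<in>K. b i \<in> E) \<and> (\<forall>i\<in>I. b i \<in> A) \<and> indep W I b" if "finite K" "K \<subseteq> I" for K
    using that
  proof (induction K)
    case empty
    then show ?case using assms by blast
  next
    case (insert j K)
    then obtain b where b: "\<forall>i\<in>K. b i \<in> E" "\<forall>i\<in>I. b i \<in> A" "indep W I b" by auto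
    let ?I = "I - {j}" and ?B = "adjoin (b ` (I - {j}))"
    have I: "insert j ?I = I" using insert by auto
    have "?B \<subseteq> A" using b by (intro adjoin_least[OF subalg]) auto
    have "\<exists>e\<in>E. indep W I (b(j := e))"
    proof (rule ccontr)
      assume no: "\<not> ?thesis"
      have "alg_over ?B e" if "e \<in> E" for e
      proof -
        have "indep W ?I (b(j := e))"
          by (rule indep_cong[OF indep_mono[OF b(3), of W ?I]]) auto
        moreover have "\<not> indep W (insert j ?I) (b(j := e))" using no that I by auto
        ultimately have "alg_over (adjoin (b(j := e) ` ?I)) ((b(j := e)) j)"
          by (rule dependent_imp_alg)
        moreover have "b(j := e) ` ?I = b ` ?I" by auto
        ultimately show ?thesis by simp
      qed
      moreover have "b j \<in> adjoin E" using b(2) insert.prems assms(5) by auto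
      ultimately have "alg_over ?B (b j)"
        using alg_over_adjoin[OF subalg_adjoin \<open>?B \<subseteq> A\<close> assms(4)] by blast
      moreover have "\<not> alg_over ?B (b j)"
        by (rule indep_imp_not_alg) (use I b(3) in auto)
      ultimately show False by blast
    qed
    then obtain e where "e \<in> E" "indep W I (b(j := e))" by blast
    moreover have "\<forall>i\<in>insert j K. (b(j := e)) i \<in> E" "\<forall>i\<in>I. (b(j := e)) i \<in> A"
      using b(1,2) assms(4) \<open>e \<in> E\<close> by auto
    ultimately show ?case by blast
  qed
  from this[of I] assms(1) show ?thesis by blast
qed

end

section \<open>Roots of unity\<close>

text \<open>The order is built up prime by prime, with \<open>d = c p\<close> and a root
  \<open>z\<close> of exact order \<open>c\<close>. If \<open>p\<close> divides \<open>c\<close>, a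
  p-th root of \<open>z\<close> has order \<open>c p\<close>; otherwise \<open>z\<close> is
  multiplied by an element of order \<open>p\<close> and coprimality makes the orders
  multiply.\<close>

lemma primitive_root_exists:
  assumes "d > 0"
  shows "\<exists>z :: 'k::{alg_closed_field, field_char_0}. \<forall>n. z ^ n = 1 \<longleftrightarrow> d dvd n"
  using assms
proof (induction d rule: less_induct)
  case (less d)
  show ?case
  proof (cases "d = 1")
    case True
    then show ?thesis by (intro exI[of _ 1]) auto
  next
    case False
    then obtain p where p: "prime p" "p dvd d" using prime_factor_nat by blast
    then obtain c where d: "d = c * p" by (metis dvd_div_mult_self)
    have p1: "p > 1" using p(1) prime_gt_1_nat by blast
    have "c < d" "c > 0" using d p1 less.prems by auto
    then obtain z :: 'k where z: "\<And>n. z ^ n = 1 \<longleftrightarrow> c dvd n" using less.IH by blast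
    show ?thesis
    proof (cases "p dvd c")
      case True
      obtain w where w: "w ^ p = z" using nth_root_exists[of p z] p1 by auto
      have "w ^ n = 1 \<longleftrightarrow> d dvd n" for n
      proof
        assume "w ^ n = 1"
        then have "z ^ n = 1" unfolding w[symmetric] by (metis power_commutes power_mult power_one mult.commute)
        then have "p dvd n" using z True dvd_trans by blast
        then obtain k where k: "n = p * k" by auto
        then have "z ^ k = 1" using \<open>w ^ n = 1\<close> w by (simp add: power_mult)
        then show "d dvd n" using z k d by simp
      next
        assume "d dvd n"
        then obtain k where "n = d * k" by blast
        then have "n = p * (c * k)" unfolding d by (simp add: mult_ac)
        then show "w ^ n = 1" using w z[of "c * k"] by (simp add: power_mult)
      qed
      then show ?thesis by blast
    next
      case False
      then have cop: "coprime c p" using p(1) prime_imp_coprime_nat coprime_commute by blast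
      \<comment> \<open>A root of \<open>1 + w + ... + w^(p-1)\<close> is a p-th root of unity. It
        differs from 1 because the sum at 1 is \<open>p\<close>, which is nonzero in characteristic
        zero.\<close>
      obtain w :: 'k where w0: "(\<Sum>k\<le>p-1. 1 * w ^ k) = 0"
        using alg_closed[of "p - 1" "\<lambda>k. 1 :: 'k"] p1 by auto
      have "w \<noteq> 1"
      proof
        assume "w = 1"
        then have "of_nat (Suc (p - 1)) = (0 :: 'k)" using w0 by simp
        then show False by (simp only: of_nat_eq_0_iff)
      qed
      have "(w - 1) * (\<Sum>k\<le>p-1. w ^ k) = w ^ p - 1"
        using p1 power_diff_1_eq[of w p] by (simp add: lessThan_Suc_atMost[symmetric])
      then have wp: "w ^ p = 1" using w0 by simp
      have w: "w ^ n = 1 \<longleftrightarrow> p dvd n" for n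
      proof
        assume n: "w ^ n = 1"
        show "p dvd n"
        proof (rule ccontr)
          assume "\<not> p dvd n"
          then have "coprime n p" using p(1) prime_imp_coprime_nat coprime_commute by blast
          then have "n \<noteq> 0" using p1 by (cases "n = 0") auto
          then obtain x y where "n * x = p * y + 1"
            using bezout_nat[of n p] \<open>coprime n p\<close> by auto
          then have "w ^ (p * y + 1) = 1" using n by (metis power_mult power_one)
          then show False using wp \<open>w \<noteq> 1\<close> by (simp add: power_add power_mult)
        qed
      next
        assume "p dvd n"
        then show "w ^ n = 1" using wp by (auto simp: power_mult)
      qed
      have "(z * w) ^ n = 1 \<longleftrightarrow> d dvd n" for n
      proof
        assume n: "(z * w) ^ n = 1"
        \<comment> \<open>The exponent \<open>n p\<close> removes \<open>w\<close> and
          \<open>n c\<close> removes \<open>z\<close>, so the two orders can be read off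
          separately.\<close>
        have "(z * w) ^ (n * p) = 1" "(z * w) ^ (n * c) = 1" using n by (simp_all add: power_mult)
        moreover have "w ^ (n * p) = 1" "z ^ (n * c) = 1" using w z by auto
        ultimately have "z ^ (n * p) = 1" "w ^ (n * c) = 1" by (simp_all add: power_mult_distrib)
        then have "c dvd n * p" "p dvd n * c" using w z by auto
        then have "c dvd n" "p dvd n"
          using cop by (simp_all add: coprime_dvd_mult_left_iff coprime_commute)
        then show "d dvd n" unfolding d using cop divides_mult by blast
      next
        assume "d dvd n"
        then have "c dvd n" "p dvd n" unfolding d using dvd_mult_left dvd_mult_right by blast+
        then have "z ^ n = 1" "w ^ n = 1" using w[of n] z[of n] by blast+
        then show "(z * w) ^ n = 1" by (simp add: power_mult_distrib)
      qed
      then show ?thesis by blast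
    qed
  qed
qed

text \<open>The powers of \<open>z\<close> are d distinct solutions, and a polynomial of degree d
  has no more roots than that.\<close>

lemma roots_of_unity_eq_powers:
  fixes z :: "'k::{alg_closed_field, field_char_0}"
  assumes "d > 0" and z: "\<And>n. z ^ n = 1 \<longleftrightarrow> d dvd n"
  shows "{t. t ^ d = 1} = (\<lambda>i. z ^ i) ` {..<d}"
proof -
  have nz: "z \<noteq> 0" using z[of d] assms(1) by (auto simp: power_0_left)
  have inj: "inj_on (\<lambda>i. z ^ i) {..<d}"
  proof (rule linorder_inj_onI)
    fix i j assume ij: "i < j" "i \<in> {..<d}" "j \<in> {..<d}"
    show "z ^ i \<noteq> z ^ j"
    proof
      assume "z ^ i = z ^ j"
      then have "z ^ (j - i) = 1" using ij nz by (simp add: power_diff)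
      then show False using z[of "j - i"] ij by (auto dest: dvd_imp_le)
    qed
  qed auto
  let ?p = "Polynomial.monom 1 d - 1 :: 'k poly"
  have deg: "degree ?p = d" using assms(1) 
    using degree_add_eq_left[of "-1 :: 'k poly" "Polynomial.monom 1 d"] by (simp add: degree_monom_eq)
  then have "?p \<noteq> 0" using assms(1) by auto
  have eq: "{t. poly ?p t = 0} = {t. t ^ d = 1}" by (auto simp: poly_monom)
  have fin: "finite {t :: 'k. t ^ d = 1}" using poly_roots_finite[OF \<open>?p \<noteq> 0\<close>] eq by simp
  have "card {t :: 'k. t ^ d = 1} \<le> d" using card_poly_roots_bound[OF \<open>?p \<noteq> 0\<close>] eq deg by simp
  moreover have "card ((\<lambda>i. z ^ i) ` {..<d}) = d" using card_image[OF inj] by simp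
  moreover have "(z ^ i) ^ d = 1" for i using z[of "i * d"] by (simp add: power_mult)
  then have "(\<lambda>i. z ^ i) ` {..<d} \<subseteq> {t. t ^ d = 1}" by auto
  ultimately show ?thesis using card_seteq[OF fin] by metis
qed

section \<open>Semi-invariants of a cyclic group\<close>

text \<open>\<open>s\<close> is the action of a generator and \<open>z\<close> a primitive d-th root
  of unity. Faithfulness is phrased through functions: no power of \<open>s\<close> strictly between
  0 and d is invisible to all of \<open>A\<close>.\<close>

locale cyclic_function_domain = char0_function_domain W A
  for W :: "'x set" and A :: "('x \<Rightarrow> 'k::{alg_closed_field, field_char_0}) set" +
  fixes s :: "'x \<Rightarrow> 'x" and d :: nat and z :: 'k
  assumes d: "d > 0" and z: "z ^ n = 1 \<longleftrightarrow> d dvd n"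
    and s_closed: "x \<in> W \<Longrightarrow> s x \<in> W" and s_order: "x \<in> W \<Longrightarrow> (s ^^ d) x = x"
    and pullback: "a \<in> A \<Longrightarrow> (\<lambda>x. a (s x)) \<in> A"
    and faithful: "0 < i \<Longrightarrow> i < d \<Longrightarrow> \<exists>a\<in>A. \<exists>x\<in>W. a ((s ^^ i) x) \<noteq> a x"
    and cong: "a \<in> A \<Longrightarrow> (\<And>x. x \<in> W \<Longrightarrow> a x = b x) \<Longrightarrow> b \<in> A"
begin

text \<open>Weights are natural numbers that matter only modulo d (\<open>eig_add_period\<close>); a
  negative weight is reached by adding multiples of d.\<close>

definition eig :: "nat \<Rightarrow> ('x \<Rightarrow> 'k) set" where
  "eig j = {a \<in> A. \<forall>x\<in>W. a (s x) = z ^ j * a x}"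

text \<open>The Lagrange resolvent, which is d times the projection to weight j. The inverse of
  \<open>z\<close> makes the shift by \<open>s\<close> produce the factor
  \<open>z ^ j\<close>.\<close>

definition resolvent :: "nat \<Rightarrow> ('x \<Rightarrow> 'k) \<Rightarrow> 'x \<Rightarrow> 'k" where
  "resolvent j a = (\<lambda>x. \<Sum>i<d. inverse z ^ (i * j) * a ((s ^^ i) x))"

lemma z_nonzero: "z \<noteq> 0"
  using z[of d] d by (auto simp: power_0_left)

lemma eig_subset: "eig j \<subseteq> A"
  by (auto simp: eig_def)

lemma eig_mult: "a \<in> eig i \<Longrightarrow> b \<in> eig j \<Longrightarrow> (\<lambda>x. a x * b x) \<in> eig (i + j)"
  by (auto simp: eig_def power_add intro: subalg_mult[OF subalg])

lemma eig_power: "a \<in> eig j \<Longrightarrow> (\<lambda>x. a x ^ n) \<in> eig (n * j)"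
  by (auto simp: eig_def power_mult power_mult_distrib mult.commute[of n] intro: subalg_power[OF subalg])

lemma eig_add_period: "eig (j + k * d) = eig j"
proof -
  have "z ^ (k * d) = 1" using z by simp
  then show ?thesis by (simp add: eig_def power_add)
qed

lemma funpow_closed: "x \<in> W \<Longrightarrow> (s ^^ i) x \<in> W"
  by (induction i) (auto intro: s_closed)

lemma pullback_funpow: "a \<in> A \<Longrightarrow> (\<lambda>x. a ((s ^^ i) x)) \<in> A"
proof (induction i)
  case (Suc i)
  then show ?case using pullback[of "\<lambda>x. a ((s ^^ i) x)"] by (simp add: funpow_swap1)
qed simp

lemma eig_funpow:
  assumes "a \<in> eig j" "x \<in> W"
  shows "a ((s ^^ i) x) = z ^ (i * j) * a x"
proof (induction i)
  case (Suc i)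
  then show ?case using assms funpow_closed[OF assms(2), of i] by (simp add: eig_def power_add)
qed simp

text \<open>Precomposition with \<open>s\<close> shifts the summation index by one. The sum is
  cyclic, since the terms with index d and 0 agree by \<open>s_order\<close> and
  \<open>z ^ d = 1\<close>.\<close>

lemma resolvent_eig:
  assumes "a \<in> A"
  shows "resolvent j a \<in> eig j"
proof -
  have "resolvent j a \<in> A"
    unfolding resolvent_def
    by (intro subalg_sum subalg_mult subalg_const pullback_funpow subalg assms)
  moreover have "resolvent j a (s x) = z ^ j * resolvent j a x" if "x \<in> W" for x
  proof -
    define g where "g i = inverse z ^ (i * j) * a ((s ^^ i) x)" for i
    have gd: "g d = g 0"
    proof -
      have "z ^ (d * j) = 1" using z by simp
      then show ?thesis unfolding g_def using s_order[OF that] by (simp add: power_inverse)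
    qed
    have "(\<Sum>i<d. g (Suc i)) + g 0 = (\<Sum>i<Suc d. g i)"
      by (simp only: sum.lessThan_Suc_shift add.commute)
    then have "(\<Sum>i<d. g (Suc i)) = (\<Sum>i<d. g i)" using gd by simp
    moreover have "inverse z ^ (i * j) * a ((s ^^ i) (s x)) = z ^ j * g (Suc i)" for i
      unfolding g_def using z_nonzero by (simp add: power_add funpow_swap1 power_inverse)
    ultimately show ?thesis
      unfolding resolvent_def by (simp add: sum_distrib_left[symmetric] g_def)
  qed
  ultimately show ?thesis by (auto simp: eig_def)
qed

text \<open>Orthogonality of characters: summed over \<open>j\<close>, the coefficients of the i-th
  translate form a geometric sum that vanishes for \<open>0 < i < d\<close>.\<close>

lemma sum_resolvent:
  "(\<Sum>j<d. resolvent j a x) = of_nat d * a x"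
proof -
  have "(\<Sum>j<d. inverse z ^ (i * j)) = (if i = 0 then of_nat d else 0)" if "i < d" for i
  proof (cases "i = 0")
    case False
    define u where "u = inverse z ^ i"
    have "z ^ i \<noteq> 1" using z[of i] that False by (auto dest: dvd_imp_le)
    then have "u \<noteq> 1" unfolding u_def by (metis power_inverse inverse_eq_1_iff)
    have "z ^ (i * d) = 1" using z by simp
    then have "u ^ d = 1" unfolding u_def by (simp add: power_mult[symmetric] power_inverse)
    then have "(\<Sum>j<d. u ^ j) = 0" using geometric_sum[OF \<open>u \<noteq> 1\<close>, of d] by simp
    then show ?thesis using False by (simp add: u_def power_mult)
  qed simp
  then have "(\<Sum>i<d. (\<Sum>j<d. inverse z ^ (i * j)) * a ((s ^^ i) x)) =
      (\<Sum>i<d. (if i = 0 then of_nat d * a x else 0))"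
    by (intro sum.cong) auto
  also have "\<dots> = of_nat d * a x" using d by simp
  finally show ?thesis
    unfolding resolvent_def by (subst sum.swap) (simp add: sum_distrib_right)
qed

lemma A_subset_adjoin_eig: "A \<subseteq> adjoin (\<Union>j. eig j)"
proof
  fix a assume a: "a \<in> A"
  let ?g = "\<lambda>x. inverse (of_nat d) * (\<Sum>j<d. resolvent j a x)"
  have g: "?g x = a x" for x using d by (simp add: sum_resolvent)
  have "?g \<in> adjoin (\<Union>j. eig j)"
    using resolvent_eig[OF a]
    by (intro subalg_mult subalg_const subalg_sum subalg_adjoin adjoin.incl) auto
  then show "a \<in> adjoin (\<Union>j. eig j)" by (simp add: g)
qed

text \<open>Products of nonzero functions are nonzero, so the occurring weights are closed under
  addition; as they also matter only modulo d, all are multiples of the least positive one,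
  \<open>g\<close>, which divides d. If \<open>g\<close> were not 1, the power
  \<open>d div g\<close> of \<open>s\<close> would fix every eigenfunction and hence every
  function.\<close>

lemma eig_1_nonzero: "\<exists>f\<in>eig 1. \<exists>x\<in>W. f x \<noteq> 0"
proof -
  define J where "J = {j. \<exists>f\<in>eig j. \<exists>x\<in>W. f x \<noteq> 0}"
  have dJ: "d \<in> J"
  proof -
    have "(\<lambda>x. 1) \<in> eig d" using z[of d] subalg_const[OF subalg, of 1] by (auto simp: eig_def)
    then show ?thesis unfolding J_def using nonempty by force
  qed
  define g where "g = (LEAST j. 0 < j \<and> j \<in> J)"
  have g: "0 < g" "g \<in> J"
    using LeastI[of "\<lambda>j. 0 < j \<and> j \<in> J" d] dJ d unfolding g_def by auto
  have least: "g \<le> j" if "0 < j" "j \<in> J" for j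
    unfolding g_def using that by (intro Least_le) auto
  have gdvd: "g dvd j" if "j \<in> J" for j
  proof (rule ccontr)
    assume "\<not> g dvd j"
    then have r: "0 < j mod g" "j mod g < g" using g(1) by (auto simp: dvd_eq_mod_eq_0)
    obtain f h where f: "f \<in> eig j" "\<exists>x\<in>W. f x \<noteq> 0" and h: "h \<in> eig g" "\<exists>x\<in>W. h x \<noteq> 0"
      using \<open>j \<in> J\<close> g(2) unfolding J_def by blast
    define q where "q = j div g"
    have "j = q * g + j mod g" by (simp add: q_def)
    \<comment> \<open>Division with remainder needs the weight \<open>-q g\<close>. Multiplying by
      \<open>h\<close> to the power \<open>q (d - 1)\<close> supplies it, up to a multiple of
      d.\<close>
    moreover have "q * g + q * (d - 1) * g = q * g * d"
      using d by (cases d) (simp_all add: algebra_simps)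
    ultimately have "j + q * (d - 1) * g = j mod g + q * g * d" by linarith
    then have "(\<lambda>x. f x * h x ^ (q * (d - 1))) \<in> eig (j mod g)"
      using eig_mult[OF f(1) eig_power[OF h(1), of "q * (d - 1)"]] eig_add_period by simp
    moreover have "\<exists>x\<in>W. f x * h x ^ (q * (d - 1)) \<noteq> 0"
    proof (rule mult_nonzero)
      show "f \<in> A" using f(1) eig_subset by blast
      show "(\<lambda>x. h x ^ (q * (d - 1))) \<in> A"
        by (rule subalg_power[OF subalg]) (use h(1) eig_subset in blast)
      show "\<exists>x\<in>W. h x ^ (q * (d - 1)) \<noteq> 0"
        by (rule power_nonzero) (use h eig_subset in blast)+
    qed (rule f(2))
    ultimately have "j mod g \<in> J"
      unfolding J_def by (intro CollectI bexI[of _ "\<lambda>x. f x * h x ^ (q * (d - 1))"])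
    then show False using least[of "j mod g"] r by simp
  qed
  have "g = 1"
  proof (rule ccontr)
    assume "g \<noteq> 1"
    define e where "e = d div g"
    have e: "d = e * g" using gdvd[OF dJ] by (simp add: e_def)
    have e': "0 < e" "e < d" using e d g(1) \<open>g \<noteq> 1\<close> by (auto intro: gr0I)
    \<comment> \<open>A resolvent of an occurring weight is multiplied by
      \<open>z ^ (e * j)\<close>, which is 1 because \<open>e g = d\<close> divides
      \<open>e j\<close>; every other resolvent is zero on \<open>W\<close>.\<close>
    have inv: "resolvent j a ((s ^^ e) x) = resolvent j a x" if "a \<in> A" "x \<in> W" for j a x
    proof (cases "j \<in> J")
      case True
      then have "d dvd e * j" using gdvd e by auto
      then show ?thesis using eig_funpow[OF resolvent_eig] that z by simp
    next
      case False
      then show ?thesis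
        using resolvent_eig[OF that(1), of j] funpow_closed[OF that(2), of e] that(2)
        unfolding J_def by auto
    qed
    have "a ((s ^^ e) x) = a x" if "a \<in> A" "x \<in> W" for a x
    proof -
      have "of_nat d * a ((s ^^ e) x) = of_nat d * a x"
        unfolding sum_resolvent[symmetric] using inv[OF that] by simp
      then show ?thesis using d by simp
    qed
    then show False using faithful[OF e'] by blast
  qed
  then show ?thesis using g(2) unfolding J_def by auto
qed

theorem semi_invariants:
  assumes "m > 0" "\<And>i. i < m \<Longrightarrow> y i \<in> A" "indep W {..<m} y"
  shows "\<exists>F. F 0 \<in> eig 1 \<and> (\<forall>i. 0 < i \<and> i < m \<longrightarrow> F i \<in> eig 0) \<and> indep W {..<m} F"
proof -
  have "\<exists>b. (\<forall>i\<in>{..<m}. b i \<in> (\<Union>j. eig j)) \<and> indep W {..<m} b"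
    using eig_subset A_subset_adjoin_eig
    by (intro exchange[of "{..<m}" y] assms(3)) (auto intro: assms(2))
  then obtain b where b: "\<And>i. i < m \<Longrightarrow> b i \<in> (\<Union>j. eig j)" "indep W {..<m} b" by auto
  define h where "h = (\<lambda>i x. b i x ^ d)"
  have h: "h i \<in> eig 0" if "i < m" for i
  proof -
    obtain j where "b i \<in> eig j" using b(1)[OF \<open>i < m\<close>] by blast
    then have "h i \<in> eig (d * j)" unfolding h_def by (rule eig_power)
    then show ?thesis using eig_add_period[of 0 j] by (simp add: mult.commute)
  qed
  have indep_h: "indep W {..<m} h"
    unfolding h_def using b(2) d by (rule indep_power)
  obtain f where f: "f \<in> eig 1" "\<exists>x\<in>W. f x \<noteq> 0" using eig_1_nonzero by blast
  let ?I = "{1..<m}"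
  have I: "insert 0 ?I = {..<m}" "0 \<notin> ?I" using assms(1) by auto
  \<comment> \<open>Only index 0 is exchanged, against a function of weight one. If every candidate
    failed, all functions of weight one would be algebraic over \<open>?B\<close>, in particular
    \<open>f\<close> and \<open>f h 0\<close>, and then so would \<open>h 0\<close>.\<close>
  have "\<exists>F0\<in>eig 1. indep W {..<m} (h(0 := F0))"
  proof (rule ccontr)
    assume no: "\<not> ?thesis"
    let ?B = "adjoin (h ` ?I)"
    have BA: "?B \<subseteq> A" using h eig_subset by (intro adjoin_least subalg) fastforce
    have alg: "alg_over ?B F0" if "F0 \<in> eig 1" for F0
    proof -
      have "indep W ?I (h(0 := F0))"
        by (rule indep_cong[OF indep_mono[OF indep_h, of W ?I]]) auto
      moreover have "\<not> indep W (insert 0 ?I) (h(0 := F0))" using no that I by auto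
      ultimately have "alg_over (adjoin (h(0 := F0) ` ?I)) ((h(0 := F0)) 0)"
        by (rule dependent_imp_alg)
      moreover have "h(0 := F0) ` ?I = h ` ?I" by auto
      ultimately show ?thesis by simp
    qed
    have "(\<lambda>x. f x * h 0 x) \<in> eig 1"
      using eig_mult[OF f(1) h[OF assms(1)]] by simp
    then have "alg_over ?B (h 0)"
      using alg_over_quotient[OF subalg_adjoin BA _ _ f(2) alg[OF f(1)] alg] f(1) h[OF assms(1)] eig_subset
      by blast
    moreover have "\<not> alg_over ?B (h 0)"
      using I indep_h by (intro indep_imp_not_alg) auto
    ultimately show False by blast
  qed
  then obtain F0 where "F0 \<in> eig 1" "indep W {..<m} (h(0 := F0))" by blast
  then show ?thesis using h by (intro exI[of _ "h(0 := F0)"]) auto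
qed

end

section \<open>Chains of irreducible closed sets\<close>

lemma topspace_zariski [simp]: "topspace (zariski N) = carrier_vec N"
proof
  show "topspace (zariski N) \<subseteq> carrier_vec N"
    unfolding topspace_def by (auto simp: openin_zariski)
  have "algebraic_set N {}"
    unfolding algebraic_set_def
    by (intro exI[of _ "{\<lambda>v. 1}"]) (auto simp: zero_locus_def intro: polynomial_functions.const)
  then show "carrier_vec N \<subseteq> topspace (zariski N)"
    unfolding topspace_def by (auto simp: openin_zariski intro!: exI[of _ "carrier_vec N"])
qed

lemma closedin_zariski: "closedin (zariski N) C \<longleftrightarrow> algebraic_set N C"
proof -
  have "algebraic_set N C \<Longrightarrow> C \<subseteq> carrier_vec N"
    by (auto simp: algebraic_set_def zero_locus_def)
  then show ?thesis
    unfolding closedin_def openin_zariski by (auto simp: double_diff)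
qed

lemma closedin_zero_set:
  assumes "f \<in> polynomial_functions N"
  shows "closedin (zariski N) {v \<in> carrier_vec N. f v = 0}"
  unfolding closedin_zariski algebraic_set_def zero_locus_def
  using assms by (intro exI[of _ "{f}"]) auto

lemma openin_nonzero_set:
  assumes "f \<in> polynomial_functions N"
  shows "openin (zariski N) {v \<in> carrier_vec N. f v \<noteq> 0}"
proof -
  have "{v \<in> carrier_vec N. f v \<noteq> 0} = carrier_vec N - {v \<in> carrier_vec N. f v = 0}" by auto
  then show ?thesis using openin_diff[OF openin_topspace closedin_zero_set[OF assms]] by simp
qed

lemma subalg_polynomial_functions: "subalg (polynomial_functions N)"
  unfolding subalg_def by (auto intro: polynomial_functions.intros)

text \<open>If a product vanishes on \<open>Y\<close>, the zero sets of its factors are closed and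
  cover \<open>Y\<close>, so one of them is all of \<open>Y\<close>.\<close>

lemma irreducible_function_domain:
  assumes "irreducible_topology (subtopology (zariski N) Y)" "Y \<subseteq> carrier_vec N"
  shows "function_domain Y (polynomial_functions N)"
proof
  have top: "topspace (subtopology (zariski N) Y) = Y" using assms(2) by auto
  show "Y \<noteq> {}" using assms(1) top unfolding irreducible_topology_def by auto
  fix f g :: "'a vec \<Rightarrow> 'a" assume fg: "f \<in> polynomial_functions N" "g \<in> polynomial_functions N" "\<forall>x\<in>Y. f x * g x = 0"
  have cl: "closedin (subtopology (zariski N) Y) {v \<in> Y. f v = 0}" if "f \<in> polynomial_functions N" for f
    using closedin_zero_set[OF that] assms(2) unfolding closedin_subtopology
    by (intro exI[of _ "{v \<in> carrier_vec N. f v = 0}"]) auto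
  have "{v \<in> Y. f v = 0} \<union> {v \<in> Y. g v = 0} = Y" using fg(3) by auto
  then show "(\<forall>x\<in>Y. f x = 0) \<or> (\<forall>x\<in>Y. g x = 0)"
    using assms(1) cl[OF fg(1)] cl[OF fg(2)] top unfolding irreducible_topology_def by blast
qed (rule subalg_polynomial_functions)

text \<open>Each strict inclusion of the chain provides a polynomial that vanishes on the smaller
  set but not on the larger one, and \<open>indep_extend\<close> adds it. This is the inequality
  between dimension and transcendence degree that the construction uses.\<close>

lemma chain_indep:
  fixes Y :: "nat \<Rightarrow> 'k::field vec set"
  assumes "\<And>i. i \<le> m \<Longrightarrow> algebraic_set N (Y i)"
    and "\<And>i. i \<le> m \<Longrightarrow> irreducible_topology (subtopology (zariski N) (Y i))"
    and "\<And>i. i < m \<Longrightarrow> Y i \<subset> Y (Suc i)"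
  shows "\<exists>a. (\<forall>i<m. a i \<in> polynomial_functions N) \<and> indep (Y m) {..<m} a"
  using assms
proof (induction m)
  case 0
  \<comment> \<open>For the empty family, independence says only that a constant vanishing on
    \<open>Y 0\<close> is zero, so one point is enough.\<close>
  have "Y 0 \<noteq> {}" using 0(2)[of 0] unfolding irreducible_topology_def by auto
  then obtain x where "x \<in> Y 0" by blast
  have "indep (Y 0) {..<0} (\<lambda>i x. 0 :: 'k)"
    unfolding indep_def
  proof (intro ballI impI allI)
    fix P :: "(nat \<Rightarrow> 'k) \<Rightarrow> 'k" and v
    assume P: "P \<in> poly_funs {..<0}" "\<forall>x\<in>Y 0. P (\<lambda>i. 0) = 0"
    have "P v = P (\<lambda>i. 0)" by (rule poly_funs_cong[OF P(1)]) simp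
    then show "P v = 0" using P(2) \<open>x \<in> Y 0\<close> by auto
  qed
  then show ?case by auto
next
  case (Suc m)
  have sub: "Y i \<subseteq> carrier_vec N" if "i \<le> Suc m" for i
    using Suc.prems(1)[OF that] by (auto simp: algebraic_set_def zero_locus_def)
  obtain a where a: "\<forall>i<m. a i \<in> polynomial_functions N" "indep (Y m) {..<m} a"
    using Suc.IH Suc.prems by (metis le_Suc_eq less_Suc_eq)
  obtain F where F: "F \<subseteq> polynomial_functions N" "Y m = zero_locus N F"
    using Suc.prems(1)[of m] unfolding algebraic_set_def by auto
  obtain y where y: "y \<in> Y (Suc m)" "y \<notin> Y m" using Suc.prems(3)[of m] by auto
  then obtain f where f: "f \<in> F" "f y \<noteq> 0"
    using sub[of "Suc m"] F(2) unfolding zero_locus_def by auto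
  have "indep (Y (Suc m)) (insert m {..<m}) (a(m := f))"
  proof (rule indep_extend[where Y = "Y m" and A = "polynomial_functions N"])
    show "function_domain (Y (Suc m)) (polynomial_functions N)"
      using Suc.prems(2) sub by (intro irreducible_function_domain) auto
    show "f x = 0" if "x \<in> Y m" for x using that f(1) F(2) by (auto simp: zero_locus_def)
  qed (use Suc.prems(3)[of m] a f F y in auto)
  moreover have "insert m {..<m} = {..<Suc m}" by auto
  moreover have "\<forall>i<Suc m. (a(m := f)) i \<in> polynomial_functions N"
    using a f F by (auto simp: less_Suc_eq)
  ultimately show ?case by (intro exI[of _ "a(m := f)"] conjI) (simp_all only:)
qed

section \<open>Regular functions and morphisms\<close>

context
  fixes X :: "('a, 'k::field) fspace" and U :: "'a set"
  assumes X: "sheaf_of_functions X" and U: "openin (ztop X) U"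
begin

lemma sheaf_extensional: "f \<in> sections X U \<Longrightarrow> f \<in> extensional U"
  using X[unfolded sheaf_of_functions_def, THEN conjunct1, THEN spec, THEN mp, OF U] by blast

lemma sheaf_const: "(\<lambda>x\<in>U. c) \<in> sections X U"
  using X[unfolded sheaf_of_functions_def, THEN conjunct1, THEN spec, THEN mp, OF U] by blast

lemma sheaf_add: "f \<in> sections X U \<Longrightarrow> g \<in> sections X U \<Longrightarrow> (\<lambda>x\<in>U. f x + g x) \<in> sections X U"
  using X[unfolded sheaf_of_functions_def, THEN conjunct1, THEN spec, THEN mp, OF U] by blast

lemma sheaf_mult: "f \<in> sections X U \<Longrightarrow> g \<in> sections X U \<Longrightarrow> (\<lambda>x\<in>U. f x * g x) \<in> sections X U"
  using X[unfolded sheaf_of_functions_def, THEN conjunct1, THEN spec, THEN mp, OF U] by blast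

lemma sheaf_restrict:
  "f \<in> sections X U \<Longrightarrow> openin (ztop X) V \<Longrightarrow> V \<subseteq> U \<Longrightarrow> restrict f V \<in> sections X V"
  using X[unfolded sheaf_of_functions_def, THEN conjunct2, THEN conjunct1] U by blast

lemma sheaf_local:
  assumes "f \<in> extensional U"
    and loc: "\<And>x. x \<in> U \<Longrightarrow> \<exists>O'. openin (ztop X) O' \<and> x \<in> O' \<and> O' \<subseteq> U \<and> restrict f O' \<in> sections X O'"
  shows "f \<in> sections X U"
proof -
  define \<U> where "\<U> = {O'. openin (ztop X) O' \<and> O' \<subseteq> U \<and> restrict f O' \<in> sections X O'}"
  have "\<Union>\<U> = U" using loc unfolding \<U>_def by blast
  moreover have "f \<in> sections X (\<Union>\<U>)" if "f \<in> extensional (\<Union>\<U>)"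
    using X[unfolded sheaf_of_functions_def, THEN conjunct2, THEN conjunct2] that
    by (auto simp: \<U>_def)
  ultimately show ?thesis using assms(1) by simp
qed

end

text \<open>The sheaf axioms do not relate the topology to the values of sections. The two added
  properties do, and they are what makes a map to affine space a morphism as soon as its coordinates
  are sections. They are established on affine sets and carried over to charts.\<close>

definition regular_space :: "('a, 'k::field) fspace \<Rightarrow> bool" where
  "regular_space Y \<longleftrightarrow> sheaf_of_functions Y \<and>
     (\<forall>U f. openin (ztop Y) U \<longrightarrow> f \<in> sections Y U \<longrightarrow>
        openin (ztop Y) {x \<in> U. f x \<noteq> 0} \<and>
        ((\<forall>x\<in>U. f x \<noteq> 0) \<longrightarrow> (\<lambda>x\<in>U. 1 / f x) \<in> sections Y U))"

lemma regular_space_sheaf: "regular_space Y \<Longrightarrow> sheaf_of_functions Y"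
  by (simp add: regular_space_def)

lemma regular_space_nonzero:
  "regular_space Y \<Longrightarrow> openin (ztop Y) U \<Longrightarrow> f \<in> sections Y U \<Longrightarrow> openin (ztop Y) {x \<in> U. f x \<noteq> 0}"
  by (simp add: regular_space_def)

lemma regular_space_inverse:
  "regular_space Y \<Longrightarrow> openin (ztop Y) U \<Longrightarrow> f \<in> sections Y U \<Longrightarrow> (\<And>x. x \<in> U \<Longrightarrow> f x \<noteq> 0) \<Longrightarrow>
    (\<lambda>x\<in>U. 1 / f x) \<in> sections Y U"
  by (simp add: regular_space_def)

lemma ztop_affine [simp]: "ztop (affine_variety N V) = subtopology (zariski N) V"
  by (simp add: affine_variety_def)

lemma points_affine: "V \<subseteq> carrier_vec N \<Longrightarrow> points (affine_variety N V) = V"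
  by auto

lemma ztop_affine_space [simp]: "subtopology (zariski N) (carrier_vec N) = zariski N"
  using subtopology_topspace[of "zariski N"] by simp

definition quotient_at ::
    "nat \<Rightarrow> 'k::field vec set \<Rightarrow> 'k vec set \<Rightarrow> ('k vec \<Rightarrow> 'k) \<Rightarrow> 'k vec \<Rightarrow> bool" where
  "quotient_at N V U f x \<longleftrightarrow>
     (\<exists>W. openin (subtopology (zariski N) V) W \<and> x \<in> W \<and> W \<subseteq> U \<and>
       (\<exists>g\<in>polynomial_functions N. \<exists>h\<in>polynomial_functions N.
          \<forall>y\<in>W. h y \<noteq> 0 \<and> f y = g y / h y))"

lemma sections_affine_iff:
  "f \<in> sections (affine_variety N V) U \<longleftrightarrow> f \<in> extensional U \<and> (\<forall>x\<in>U. quotient_at N V U f x)"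
  by (simp add: affine_variety_def quotient_at_def)

lemma section_affineI:
  "f \<in> extensional U \<Longrightarrow> (\<And>x. x \<in> U \<Longrightarrow> quotient_at N V U f x) \<Longrightarrow>
    f \<in> sections (affine_variety N V) U"
  by (simp add: sections_affine_iff)

lemma quotient_atI:
  assumes "openin (subtopology (zariski N) V) W" "x \<in> W" "W \<subseteq> U"
    and "g \<in> polynomial_functions N" "h \<in> polynomial_functions N"
    and "\<And>y. y \<in> W \<Longrightarrow> h y \<noteq> 0 \<and> f y = g y / h y"
  shows "quotient_at N V U f x"
proof -
  have "\<forall>y\<in>W. h y \<noteq> 0 \<and> f y = g y / h y" by (rule ballI[OF assms(6)])
  then have "\<exists>h\<in>polynomial_functions N. \<forall>y\<in>W. h y \<noteq> 0 \<and> f y = g y / h y"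
    by (rule bexI[where x = h]) (rule assms(5))
  then have "\<exists>g\<in>polynomial_functions N. \<exists>h\<in>polynomial_functions N. \<forall>y\<in>W. h y \<noteq> 0 \<and> f y = g y / h y"
    by (rule bexI[where x = g]) (rule assms(4))
  then show ?thesis
    unfolding quotient_at_def by (intro exI[of _ W] conjI assms(1-3))
qed

lemma section_affineE:
  assumes "f \<in> sections (affine_variety N V) U" "x \<in> U"
  obtains W g h where "openin (subtopology (zariski N) V) W" "x \<in> W" "W \<subseteq> U"
    "g \<in> polynomial_functions N" "h \<in> polynomial_functions N"
    "\<forall>y\<in>W. h y \<noteq> 0 \<and> f y = g y / h y"
proof -
  from assms have "quotient_at N V U f x"
    unfolding sections_affine_iff by simp
  then obtain W g h where W: "openin (subtopology (zariski N) V) W" "x \<in> W" "W \<subseteq> U"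
    "g \<in> polynomial_functions N" "h \<in> polynomial_functions N" "\<forall>y\<in>W. h y \<noteq> 0 \<and> f y = g y / h y"
    unfolding quotient_at_def by (elim exE conjE bexE)
  show thesis by (rule that[OF W])
qed

lemma section_affine_polynomial:
  assumes "P \<in> polynomial_functions N" "openin (subtopology (zariski N) V) U"
  shows "restrict P U \<in> sections (affine_variety N V) U"
proof (rule section_affineI)
  fix x assume "x \<in> U"
  then show "quotient_at N V U (restrict P U) x"
    by (rule quotient_atI[OF assms(2) _ subset_refl assms(1) polynomial_functions.const[of 1]]) simp
qed simp

lemma sheaf_affine: "sheaf_of_functions (affine_variety N V)"
  unfolding sheaf_of_functions_def
proof (intro conjI allI impI ballI)
  fix U assume U: "openin (ztop (affine_variety N V)) U"
  show "sections (affine_variety N V) U \<subseteq> extensional U" by (auto simp: sections_affine_iff)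
  show "(\<lambda>x\<in>U. c) \<in> sections (affine_variety N V) U" for c
    using section_affine_polynomial[OF polynomial_functions.const, of N V U c] U by simp
  fix f g assume f: "f \<in> sections (affine_variety N V) U" and g: "g \<in> sections (affine_variety N V) U"
  have "quotient_at N V U (\<lambda>x\<in>U. f x + g x) x \<and> quotient_at N V U (\<lambda>x\<in>U. f x * g x) x"
    if x: "x \<in> U" for x
  proof -
    obtain W p q where 1: "openin (subtopology (zariski N) V) W" "x \<in> W" "W \<subseteq> U"
      "p \<in> polynomial_functions N" "q \<in> polynomial_functions N"
      "\<forall>y\<in>W. q y \<noteq> 0 \<and> f y = p y / q y" by (rule section_affineE[OF f x])
    obtain W' p' q' where 2: "openin (subtopology (zariski N) V) W'" "x \<in> W'" "W' \<subseteq> U"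
      "p' \<in> polynomial_functions N" "q' \<in> polynomial_functions N"
      "\<forall>y\<in>W'. q' y \<noteq> 0 \<and> g y = p' y / q' y" by (rule section_affineE[OF g x])
    have W: "openin (subtopology (zariski N) V) (W \<inter> W')" "x \<in> W \<inter> W'" "W \<inter> W' \<subseteq> U"
      using 1 2 by auto
    have "quotient_at N V U (\<lambda>x\<in>U. f x + g x) x"
      by (rule quotient_atI[OF W, of "\<lambda>v. p v * q' v + p' v * q v" "\<lambda>v. q v * q' v"])
         (use 1 2 in \<open>auto intro!: polynomial_functions.intros simp: add_frac_eq subset_iff\<close>)
    moreover have "quotient_at N V U (\<lambda>x\<in>U. f x * g x) x"
      by (rule quotient_atI[OF W, of "\<lambda>v. p v * p' v" "\<lambda>v. q v * q' v"])
         (use 1 2 in \<open>auto intro!: polynomial_functions.intros simp: subset_iff\<close>)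
    ultimately show ?thesis ..
  qed
  then show "(\<lambda>x\<in>U. f x + g x) \<in> sections (affine_variety N V) U"
    "(\<lambda>x\<in>U. f x * g x) \<in> sections (affine_variety N V) U"
    by (auto intro!: section_affineI)
next
  fix U U' f assume U: "openin (ztop (affine_variety N V)) U" "openin (ztop (affine_variety N V)) U'"
    "U' \<subseteq> U" and f: "f \<in> sections (affine_variety N V) U"
  show "restrict f U' \<in> sections (affine_variety N V) U'"
  proof (rule section_affineI)
    fix x assume x: "x \<in> U'"
    then have "x \<in> U" using U by auto
    obtain W p q where 1: "openin (subtopology (zariski N) V) W" "x \<in> W" "W \<subseteq> U"
      "p \<in> polynomial_functions N" "q \<in> polynomial_functions N"
      "\<forall>y\<in>W. q y \<noteq> 0 \<and> f y = p y / q y"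
      by (rule section_affineE[OF f \<open>x \<in> U\<close>])
    show "quotient_at N V U' (restrict f U') x"
      by (rule quotient_atI[of N V "W \<inter> U'" _ _ p q]) (use 1 U x in auto)
  qed simp
next
  fix \<U> and f :: "'a vec \<Rightarrow> 'a"
  assume op: "\<forall>U\<in>\<U>. openin (ztop (affine_variety N V)) U" and ext: "f \<in> extensional (\<Union>\<U>)"
    and loc: "\<forall>U\<in>\<U>. restrict f U \<in> sections (affine_variety N V) U"
  show "f \<in> sections (affine_variety N V) (\<Union>\<U>)"
  proof (rule section_affineI[OF ext])
    fix x assume "x \<in> \<Union>\<U>"
    then obtain U where U: "U \<in> \<U>" "x \<in> U" by blast
    with loc have f: "restrict f U \<in> sections (affine_variety N V) U" by blast
    obtain W p q where 1: "openin (subtopology (zariski N) V) W" "x \<in> W" "W \<subseteq> U"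
      "p \<in> polynomial_functions N" "q \<in> polynomial_functions N"
      "\<forall>y\<in>W. q y \<noteq> 0 \<and> restrict f U y = p y / q y"
      by (rule section_affineE[OF f U(2)])
    show "quotient_at N V (\<Union>\<U>) f x"
      by (rule quotient_atI[OF 1(1,2) _ 1(4,5)]) (use 1(3,6) U(1) in \<open>auto simp: subset_iff\<close>)
  qed
qed

lemma openin_affine_nonzero:
  assumes "g \<in> polynomial_functions N" "V \<subseteq> carrier_vec N"
  shows "openin (subtopology (zariski N) V) {v \<in> V. g v \<noteq> 0}"
  unfolding openin_subtopology using openin_nonzero_set[OF assms(1)] assms(2)
  by (intro exI[of _ "{v \<in> carrier_vec N. g v \<noteq> 0}"]) auto

text \<open>Where a section is \<open>p / q\<close>, it is nonzero exactly where \<open>p\<close>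
  is, and its inverse is \<open>q / p\<close>.\<close>

lemma regular_affine:
  assumes "V \<subseteq> carrier_vec N"
  shows "regular_space (affine_variety N V)"
  unfolding regular_space_def
proof (intro conjI allI impI)
  show "sheaf_of_functions (affine_variety N V)" by (rule sheaf_affine)
  fix U f assume U: "openin (ztop (affine_variety N V)) U" and f: "f \<in> sections (affine_variety N V) U"
  show "openin (ztop (affine_variety N V)) {x \<in> U. f x \<noteq> 0}"
  proof (subst openin_subopen, intro ballI)
    fix x assume x: "x \<in> {x \<in> U. f x \<noteq> 0}"
    then have "x \<in> U" by simp
    obtain W p q where 1: "openin (subtopology (zariski N) V) W" "x \<in> W" "W \<subseteq> U"
      "p \<in> polynomial_functions N" "q \<in> polynomial_functions N"
      "\<forall>y\<in>W. q y \<noteq> 0 \<and> f y = p y / q y"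
      by (rule section_affineE[OF f \<open>x \<in> U\<close>])
    have "W \<subseteq> V" using openin_subset[OF 1(1)] by auto
    have "openin (subtopology (zariski N) V) (W \<inter> {v \<in> V. p v \<noteq> 0})"
      using 1 openin_affine_nonzero[OF _ assms] by blast
    moreover have "x \<in> W \<inter> {v \<in> V. p v \<noteq> 0}" using 1 x \<open>W \<subseteq> V\<close> by auto
    moreover have "W \<inter> {v \<in> V. p v \<noteq> 0} \<subseteq> {x \<in> U. f x \<noteq> 0}" using 1 by auto
    ultimately show "\<exists>T. openin (ztop (affine_variety N V)) T \<and> x \<in> T \<and> T \<subseteq> {x \<in> U. f x \<noteq> 0}"
      by auto
  qed
  assume nz: "\<forall>x\<in>U. f x \<noteq> 0"
  show "(\<lambda>x\<in>U. 1 / f x) \<in> sections (affine_variety N V) U"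
  proof (rule section_affineI)
    fix x assume x: "x \<in> U"
    obtain W p q where 1: "openin (subtopology (zariski N) V) W" "x \<in> W" "W \<subseteq> U"
      "p \<in> polynomial_functions N" "q \<in> polynomial_functions N"
      "\<forall>y\<in>W. q y \<noteq> 0 \<and> f y = p y / q y"
      by (rule section_affineE[OF f x])
    show "quotient_at N V U (\<lambda>x\<in>U. 1 / f x) x"
      by (rule quotient_atI[OF 1(1-3) 1(5,4)]) (use 1(3,6) nz in \<open>auto simp: subset_iff\<close>)
  qed simp
qed

section \<open>Morphisms, transport of regularity, and maps given by coordinates\<close>

lemma morphism_continuous: "morphism X Y f \<Longrightarrow> continuous_map (ztop X) (ztop Y) f"
  by (simp add: morphism_def)

lemma morphism_point: "morphism X Y f \<Longrightarrow> x \<in> points X \<Longrightarrow> f x \<in> points Y"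
  using morphism_continuous[of X Y f] unfolding continuous_map_def by blast

lemma morphism_preimage:
  "morphism X Y f \<Longrightarrow> openin (ztop Y) V \<Longrightarrow> openin (ztop X) {x \<in> points X. f x \<in> V}"
  using morphism_continuous[of X Y f] unfolding continuous_map_def by blast

lemma morphism_pullback:
  "morphism X Y f \<Longrightarrow> openin (ztop Y) V \<Longrightarrow> s \<in> sections Y V \<Longrightarrow>
    (\<lambda>x\<in>{x \<in> points X. f x \<in> V}. s (f x)) \<in> sections X {x \<in> points X. f x \<in> V}"
  by (simp add: morphism_def)

text \<open>A section on \<open>Y\<close> is pulled back to \<open>Z\<close> along
  \<open>\<psi>\<close>; its nonvanishing locus and its inverse are formed there and pulled back
  along \<open>\<phi>\<close>.\<close>

lemma regular_space_iso:
  assumes "sheaf_of_functions Y" "regular_space Z" "morphism Y Z \<phi>" "morphism Z Y \<psi>"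
    and inv: "\<And>x. x \<in> points Y \<Longrightarrow> \<psi> (\<phi> x) = x"
  shows "regular_space Y"
  unfolding regular_space_def
proof (intro conjI allI impI)
  fix U f assume U: "openin (ztop Y) U" and f: "f \<in> sections Y U"
  have UY: "U \<subseteq> points Y" using openin_subset[OF U] .
  let ?U = "{y \<in> points Z. \<psi> y \<in> U}"
  let ?f = "\<lambda>y\<in>?U. f (\<psi> y)"
  have U': "openin (ztop Z) ?U" using morphism_preimage[OF assms(4) U] .
  have f': "?f \<in> sections Z ?U" using morphism_pullback[OF assms(4) U f] .
  have pre: "{x \<in> points Y. \<phi> x \<in> ?U} = U"
    using UY inv morphism_point[OF assms(3)] by auto
  have val: "?f (\<phi> x) = f x" if "x \<in> U" for x
    using that UY inv morphism_point[OF assms(3)] by auto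
  have "{x \<in> points Y. \<phi> x \<in> {y \<in> ?U. ?f y \<noteq> 0}} = {x \<in> {x \<in> points Y. \<phi> x \<in> ?U}. ?f (\<phi> x) \<noteq> 0}"
    by blast
  also have "\<dots> = {x \<in> U. f x \<noteq> 0}"
    unfolding pre by (rule Collect_cong) (use val in metis)
  finally have "{x \<in> points Y. \<phi> x \<in> {y \<in> ?U. ?f y \<noteq> 0}} = {x \<in> U. f x \<noteq> 0}" .
  then show "openin (ztop Y) {x \<in> U. f x \<noteq> 0}"
    using morphism_preimage[OF assms(3) regular_space_nonzero[OF assms(2) U' f']] by simp
  assume nz: "\<forall>x\<in>U. f x \<noteq> 0"
  have "(\<lambda>y\<in>?U. 1 / ?f y) \<in> sections Z ?U"
    using nz by (intro regular_space_inverse[OF assms(2) U' f']) auto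
  from morphism_pullback[OF assms(3) U' this]
  have "(\<lambda>x\<in>U. (\<lambda>y\<in>?U. 1 / ?f y) (\<phi> x)) \<in> sections Y U" unfolding pre .
  moreover have "(\<lambda>x\<in>U. (\<lambda>y\<in>?U. 1 / ?f y) (\<phi> x)) = (\<lambda>x\<in>U. 1 / f x)"
  proof (rule restrict_ext)
    fix x assume x: "x \<in> U"
    then have "\<phi> x \<in> ?U" using pre by blast
    then show "(\<lambda>y\<in>?U. 1 / ?f y) (\<phi> x) = 1 / f x" using val[OF x] by simp
  qed
  ultimately show "(\<lambda>x\<in>U. 1 / f x) \<in> sections Y U" by simp
qed fact

lemma ztop_open_subspace [simp]: "ztop (open_subspace X U) = subtopology (ztop X) U"
  and sections_open_subspace [simp]: "sections (open_subspace X U) = sections X"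
  by (simp_all add: open_subspace_def)

lemma points_open_subspace: "openin (ztop X) U \<Longrightarrow> points (open_subspace X U) = U"
  using openin_subset by fastforce

lemma openin_open_subspace:
  "openin (ztop X) U \<Longrightarrow> openin (ztop (open_subspace X U)) V \<longleftrightarrow> openin (ztop X) V \<and> V \<subseteq> U"
  by (simp add: openin_open_subtopology)

lemma sheaf_open_subspace:
  assumes "sheaf_of_functions X" "openin (ztop X) U"
  shows "sheaf_of_functions (open_subspace X U)"
  unfolding sheaf_of_functions_def openin_open_subspace[OF assms(2)] sections_open_subspace
proof (intro conjI allI impI ballI)
  fix \<U> f
  assume *: "\<forall>V\<in>\<U>. openin (ztop X) V \<and> V \<subseteq> U" "f \<in> extensional (\<Union>\<U>)"
    "\<forall>U\<in>\<U>. restrict f U \<in> sections X U"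
  then show "f \<in> sections X (\<Union>\<U>)"
    by (intro sheaf_local[OF assms(1)]) auto
next
  fix V assume V: "openin (ztop X) V \<and> V \<subseteq> U"
  then have o: "openin (ztop X) V" by blast
  show "sections X V \<subseteq> extensional V" using sheaf_extensional[OF assms(1) o] by blast
  show "(\<lambda>x\<in>V. c) \<in> sections X V" for c by (rule sheaf_const[OF assms(1) o])
  fix f g assume "f \<in> sections X V" "g \<in> sections X V"
  then show "(\<lambda>x\<in>V. f x + g x) \<in> sections X V" "(\<lambda>x\<in>V. f x * g x) \<in> sections X V"
    by (rule sheaf_add[OF assms(1) o] sheaf_mult[OF assms(1) o])+
next
  fix V V' f assume "openin (ztop X) V \<and> V \<subseteq> U" "openin (ztop X) V' \<and> V' \<subseteq> U" "V' \<subseteq> V" "f \<in> sections X V"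
  then show "restrict f V' \<in> sections X V'" by (intro sheaf_restrict[OF assms(1)]) auto
qed

lemma regular_open_subspace:
  assumes "regular_space X" "openin (ztop X) U"
  shows "regular_space (open_subspace X U)"
  unfolding regular_space_def openin_open_subspace[OF assms(2)] sections_open_subspace
proof (intro conjI allI impI)
  show "sheaf_of_functions (open_subspace X U)"
    using sheaf_open_subspace[OF regular_space_sheaf] assms by blast
next
  fix V f assume V: "openin (ztop X) V \<and> V \<subseteq> U" and f: "f \<in> sections X V"
  then have o: "openin (ztop X) V" by blast
  show "openin (ztop X) {x \<in> V. f x \<noteq> 0}" by (rule regular_space_nonzero[OF assms(1) o f])
  show "{x \<in> V. f x \<noteq> 0} \<subseteq> U" using V by blast
  assume "\<forall>x\<in>V. f x \<noteq> 0"
  then show "(\<lambda>x\<in>V. 1 / f x) \<in> sections X V"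
    by (intro regular_space_inverse[OF assms(1) o f]) blast
qed

lemma open_subspace_points [simp]: "open_subspace X (points X) = X"
  by (simp add: open_subspace_def subtopology_topspace)

lemma morphism_id:
  assumes "sheaf_of_functions X"
  shows "morphism X X id"
  unfolding morphism_def
proof (intro conjI allI impI ballI)
  fix V s assume V: "openin (ztop X) V" and s: "s \<in> sections X V"
  have "{x \<in> points X. id x \<in> V} = V" using openin_subset[OF V] by auto
  moreover have "(\<lambda>x\<in>V. s (id x)) = s"
    using extensional_restrict[OF sheaf_extensional[OF assms V s]] by simp
  ultimately show "(\<lambda>x\<in>{x \<in> points X. id x \<in> V}. s (id x)) \<in> sections X {x \<in> points X. id x \<in> V}"
    using s by simp
qed (simp add: id_def)

text \<open>Polynomials in the coordinates are sections. A Zariski open set is a union of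
  nonvanishing loci of polynomials, so its preimage is open; a local quotient pulls back to a
  product with an inverse section, and these pieces glue.\<close>

lemma morphism_affine_spaceI:
  fixes Y :: "('a, 'k::field) fspace" and F :: "'a \<Rightarrow> 'k vec"
  assumes Y: "regular_space Y" and F: "\<And>x. x \<in> points Y \<Longrightarrow> F x \<in> carrier_vec m"
    and comp: "\<And>i. i < m \<Longrightarrow> (\<lambda>x\<in>points Y. F x $ i) \<in> sections Y (points Y)"
  shows "morphism Y (affine_space m) F"
proof -
  note sh = regular_space_sheaf[OF Y]
  let ?T = "points Y"
  have poly: "(\<lambda>x\<in>?T. P (F x)) \<in> sections Y ?T" if "P \<in> polynomial_functions m" for P
    using that
  proof induction
    case (const c)
    show ?case by (rule sheaf_const[OF sh openin_topspace])
  next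
    case (add f g)
    have "(\<lambda>x\<in>?T. (\<lambda>x\<in>?T. f (F x)) x + (\<lambda>x\<in>?T. g (F x)) x) \<in> sections Y ?T"
      by (rule sheaf_add[OF sh openin_topspace add.IH])
    moreover have "(\<lambda>x\<in>?T. (\<lambda>x\<in>?T. f (F x)) x + (\<lambda>x\<in>?T. g (F x)) x) = (\<lambda>x\<in>?T. f (F x) + g (F x))"
      by (rule restrict_ext) simp
    ultimately show ?case by (simp only:)
  next
    case (mult f g)
    have "(\<lambda>x\<in>?T. (\<lambda>x\<in>?T. f (F x)) x * (\<lambda>x\<in>?T. g (F x)) x) \<in> sections Y ?T"
      by (rule sheaf_mult[OF sh openin_topspace mult.IH])
    moreover have "(\<lambda>x\<in>?T. (\<lambda>x\<in>?T. f (F x)) x * (\<lambda>x\<in>?T. g (F x)) x) = (\<lambda>x\<in>?T. f (F x) * g (F x))"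
      by (rule restrict_ext) simp
    ultimately show ?case by (simp only:)
  qed (rule comp)
  have nz: "openin (ztop Y) {x \<in> ?T. P (F x) \<noteq> 0}" if "P \<in> polynomial_functions m" for P
  proof -
    have "{x \<in> ?T. P (F x) \<noteq> 0} = {x \<in> ?T. (\<lambda>x\<in>?T. P (F x)) x \<noteq> 0}" by auto
    then show ?thesis using regular_space_nonzero[OF Y openin_topspace poly[OF that]] by simp
  qed
  have pre: "openin (ztop Y) {x \<in> ?T. F x \<in> V}" if V: "openin (zariski m) V" for V
  proof -
    obtain G where G: "G \<subseteq> polynomial_functions m" "carrier_vec m - V = zero_locus m G"
      and Vc: "V \<subseteq> carrier_vec m"
      using V unfolding openin_zariski algebraic_set_def by auto
    have mem: "v \<in> V \<longleftrightarrow> (\<exists>g\<in>G. g v \<noteq> 0)" if "v \<in> carrier_vec m" for v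
      using G(2) that unfolding zero_locus_def by auto
    have "{x \<in> ?T. F x \<in> V} = (\<Union>g\<in>G. {x \<in> ?T. g (F x) \<noteq> 0})"
      using F mem by auto
    also have "openin (ztop Y) \<dots>" using nz G(1) by (intro openin_Union) auto
    finally show ?thesis .
  qed
  show ?thesis
    unfolding morphism_def
  proof (intro conjI allI impI ballI)
    show "continuous_map (ztop Y) (ztop (affine_space m)) F"
      unfolding continuous_map_def using F pre by (auto simp: Pi_def)
    fix V :: "'k vec set" and s
    assume V: "openin (ztop (affine_space m)) V" and s: "s \<in> sections (affine_space m) V"
    let ?V = "{x \<in> ?T. F x \<in> V}"
    show "(\<lambda>x\<in>?V. s (F x)) \<in> sections Y ?V"
    proof (rule sheaf_local[OF sh])
      show oV: "openin (ztop Y) ?V" using pre V by simp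
      fix x assume x: "x \<in> ?V"
      then have "F x \<in> V" by simp
      obtain W p q where 1: "openin (subtopology (zariski m) (carrier_vec m)) W" "F x \<in> W" "W \<subseteq> V"
        "p \<in> polynomial_functions m" "q \<in> polynomial_functions m"
        "\<forall>y\<in>W. q y \<noteq> 0 \<and> s y = p y / q y"
        by (rule section_affineE[OF s \<open>F x \<in> V\<close>])
      let ?W = "{x \<in> ?T. F x \<in> W}"
      have W: "openin (ztop Y) ?W" "?W \<subseteq> ?V" "?W \<subseteq> ?T" using pre 1 by auto
      have res: "(\<lambda>x\<in>?W. P (F x)) \<in> sections Y ?W" if "P \<in> polynomial_functions m" for P
      proof -
        have "restrict (\<lambda>x\<in>?T. P (F x)) ?W \<in> sections Y ?W"
          using sheaf_restrict[OF sh openin_topspace poly[OF that] W(1,3)] .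
        moreover have "restrict (\<lambda>x\<in>?T. P (F x)) ?W = (\<lambda>x\<in>?W. P (F x))" by (rule restrict_ext) auto
        ultimately show ?thesis by simp
      qed
      have "(\<lambda>x\<in>?W. 1 / (\<lambda>x\<in>?W. q (F x)) x) \<in> sections Y ?W"
        by (rule regular_space_inverse[OF Y W(1) res[OF 1(5)]]) (use 1(6) in auto)
      from sheaf_mult[OF sh W(1) res[OF 1(4)] this]
      have "(\<lambda>x\<in>?W. (\<lambda>x\<in>?W. p (F x)) x * (\<lambda>x\<in>?W. 1 / (\<lambda>x\<in>?W. q (F x)) x) x) \<in> sections Y ?W" .
      moreover have "(\<lambda>x\<in>?W. (\<lambda>x\<in>?W. p (F x)) x * (\<lambda>x\<in>?W. 1 / (\<lambda>x\<in>?W. q (F x)) x) x) =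
          restrict (\<lambda>x\<in>?V. s (F x)) ?W"
        by (rule restrict_ext) (use 1(3,6) in \<open>auto simp: subset_iff\<close>)
      ultimately have "restrict (\<lambda>x\<in>?V. s (F x)) ?W \<in> sections Y ?W" by simp
      then show "\<exists>O'. openin (ztop Y) O' \<and> x \<in> O' \<and> O' \<subseteq> ?V \<and> restrict (\<lambda>x\<in>?V. s (F x)) O' \<in> sections Y O'"
        using W 1(2) x by (intro exI[of _ ?W]) auto
    qed simp
  qed
qed

section \<open>Affine space\<close>

text \<open>Restricting to lines reduces questions about polynomial functions in many variables to
  roots and degrees of univariate polynomials.\<close>

lemma polynomial_function_line:
  assumes "P \<in> polynomial_functions N" "v \<in> carrier_vec N" "w \<in> carrier_vec N"
  shows "\<exists>p. \<forall>t. poly p t = P (v + t \<cdot>\<^sub>v w)"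
  using assms(1)
proof induction
  case (const c)
  show ?case by (intro exI[of _ "[:c:]"]) simp
next
  case (coord i)
  then show ?case using assms(2,3) by (intro exI[of _ "[:v $ i, w $ i:]"]) simp
next
  case (add f g)
  then obtain p q where "\<forall>t. poly p t = f (v + t \<cdot>\<^sub>v w)" "\<forall>t. poly q t = g (v + t \<cdot>\<^sub>v w)" by blast
  then show ?case by (intro exI[of _ "p + q"]) simp
next
  case (mult f g)
  then obtain p q where "\<forall>t. poly p t = f (v + t \<cdot>\<^sub>v w)" "\<forall>t. poly q t = g (v + t \<cdot>\<^sub>v w)" by blast
  then show ?case by (intro exI[of _ "p * q"]) simp
qed

text \<open>On the line through \<open>v\<close> and \<open>w\<close> the two restrictions are
  nonzero polynomials, one at parameter 0 and the other at parameter 1; their product is nonzero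
  somewhere because the field is infinite.\<close>

lemma polynomial_functions_nonzero:
  fixes P :: "'k::field_char_0 vec \<Rightarrow> 'k"
  assumes "P \<in> polynomial_functions N" "Q \<in> polynomial_functions N"
    and "v \<in> carrier_vec N" "P v \<noteq> 0" "w \<in> carrier_vec N" "Q w \<noteq> 0"
  shows "\<exists>u\<in>carrier_vec N. P u \<noteq> 0 \<and> Q u \<noteq> 0"
proof -
  have wv: "w - v \<in> carrier_vec N" using assms by simp
  obtain p where p: "\<And>t. poly p t = P (v + t \<cdot>\<^sub>v (w - v))"
    using polynomial_function_line[OF assms(1,3) wv] by blast
  obtain q where q: "\<And>t. poly q t = Q (v + t \<cdot>\<^sub>v (w - v))"
    using polynomial_function_line[OF assms(2,3) wv] by blast
  have "v + 0 \<cdot>\<^sub>v (w - v) = v" "v + 1 \<cdot>\<^sub>v (w - v) = w"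
    using assms(3,5) by (auto intro!: eq_vecI)
  then have "poly p 0 \<noteq> 0" "poly q 1 \<noteq> 0" using assms(4,6) p q by auto
  then have "p * q \<noteq> 0" by auto
  then obtain t where "poly (p * q) t \<noteq> 0" using poly_all_0_iff_0 by blast
  then show ?thesis using p q assms(3) wv by (intro bexI[of _ "v + t \<cdot>\<^sub>v (w - v)"]) auto
qed

lemma openin_zariski_nonzero:
  assumes "openin (zariski N) U" "v \<in> U"
  obtains P where "P \<in> polynomial_functions N" "P v \<noteq> 0" "\<And>u. u \<in> carrier_vec N \<Longrightarrow> P u \<noteq> 0 \<Longrightarrow> u \<in> U"
proof -
  obtain G where G: "G \<subseteq> polynomial_functions N" "carrier_vec N - U = zero_locus N G" "U \<subseteq> carrier_vec N"
    using assms(1) unfolding openin_zariski algebraic_set_def by auto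
  have mem: "u \<in> U \<longleftrightarrow> (\<exists>g\<in>G. g u \<noteq> 0)" if "u \<in> carrier_vec N" for u
    using G(2) that unfolding zero_locus_def by auto
  then obtain g where "g \<in> G" "g v \<noteq> 0" using assms(2) G(3) by blast
  then show thesis using that[of g] G(1) mem by blast
qed

lemma zariski_dense:
  fixes P :: "'k::field_char_0 vec \<Rightarrow> 'k"
  assumes "openin (zariski N) U" "U \<noteq> {}" "P \<in> polynomial_functions N" "\<And>u. u \<in> U \<Longrightarrow> P u = 0"
    and "v \<in> carrier_vec N"
  shows "P v = 0"
proof (rule ccontr)
  assume "P v \<noteq> 0"
  obtain w where w: "w \<in> U" using assms(2) by blast
  obtain Q where Q: "Q \<in> polynomial_functions N" "Q w \<noteq> 0"
    "\<And>u. u \<in> carrier_vec N \<Longrightarrow> Q u \<noteq> 0 \<Longrightarrow> u \<in> U" by (rule openin_zariski_nonzero[OF assms(1) w]) blast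
  have "w \<in> carrier_vec N" using openin_subset[OF assms(1)] w by auto
  then show False
    using polynomial_functions_nonzero[OF assms(3) Q(1) assms(5) \<open>P v \<noteq> 0\<close> _ Q(2)] Q(3) assms(4) by blast
qed

lemma irreducible_zariski: "irreducible_topology (zariski N :: 'k::field_char_0 vec topology)"
  unfolding irreducible_topology_def
proof (intro conjI allI impI)
  show "topspace (zariski N :: 'k vec topology) \<noteq> {}"
  proof -
    have "0\<^sub>v N \<in> (carrier_vec N :: 'k vec set)" by simp
    then show ?thesis by (metis empty_iff topspace_zariski)
  qed
  fix A B :: "'k vec set"
  assume AB: "closedin (zariski N) A" "closedin (zariski N) B" "A \<union> B = topspace (zariski N)"
  show "A = topspace (zariski N) \<or> B = topspace (zariski N)"
  proof (rule ccontr)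
    assume no: "\<not> ?thesis"
    then obtain v w where v: "v \<in> carrier_vec N - A" and w: "w \<in> carrier_vec N - B"
      using AB(3) by auto
    have o: "openin (zariski N) (carrier_vec N - A)" "openin (zariski N) (carrier_vec N - B)"
      using AB by (auto simp: closedin_def)
    obtain P where P: "P \<in> polynomial_functions N" "P v \<noteq> 0"
      "\<And>u. u \<in> carrier_vec N \<Longrightarrow> P u \<noteq> 0 \<Longrightarrow> u \<in> carrier_vec N - A"
      by (rule openin_zariski_nonzero[OF o(1) v]) blast
    obtain Q where Q: "Q \<in> polynomial_functions N" "Q w \<noteq> 0"
      "\<And>u. u \<in> carrier_vec N \<Longrightarrow> Q u \<noteq> 0 \<Longrightarrow> u \<in> carrier_vec N - B"
      by (rule openin_zariski_nonzero[OF o(2) w]) blast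
    obtain u where "u \<in> carrier_vec N" "P u \<noteq> 0" "Q u \<noteq> 0"
      using polynomial_functions_nonzero[OF P(1) Q(1) _ P(2) _ Q(2)] v w by blast
    then show False using P(3) Q(3) AB(3) by auto
  qed
qed

lemma algebraic_set_carrier: "algebraic_set N (carrier_vec N)"
  unfolding algebraic_set_def zero_locus_def by (intro exI[of _ "{}"]) auto

lemma algebraic_set_subset: "algebraic_set N V \<Longrightarrow> V \<subseteq> carrier_vec N"
  by (auto simp: algebraic_set_def zero_locus_def)

text \<open>One chart, the whole space. For separatedness, the set where two morphisms differ is the
  union over the coordinates of the nonvanishing loci of their differences.\<close>

lemma irreducible_variety_affine_space:
  "irreducible_variety (affine_space m :: ('k::field_char_0 vec, 'k) fspace)"
proof -
  let ?A = "affine_space m :: ('k vec, 'k) fspace"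
  have "prevariety ?A"
    unfolding prevariety_def
  proof (intro conjI exI[of _ "{points ?A}"])
    show "\<forall>U\<in>{points ?A}. openin (ztop ?A) U \<and> (\<exists>N V. algebraic_set N V \<and>
        isomorphic_fspaces (open_subspace ?A U) (affine_variety N V :: ('k vec, 'k) fspace))"
    proof (intro ballI conjI exI)
      fix U assume U: "U \<in> {points ?A}"
      then show "openin (ztop ?A) U" using openin_topspace[of "ztop ?A"] by blast
      show "algebraic_set m (carrier_vec m :: 'k vec set)" by (rule algebraic_set_carrier)
      have "open_subspace ?A U = ?A" using U open_subspace_points[of ?A] by blast
      then show "isomorphic_fspaces (open_subspace ?A U) ?A"
        using morphism_id[OF sheaf_affine[of m "carrier_vec m :: 'k vec set"]]
        unfolding isomorphic_fspaces_def by (intro exI[of _ id]) simp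
    qed
  qed (auto intro: sheaf_affine)
  moreover have "separated ?A"
    unfolding separated_def
  proof (intro allI impI)
    fix N :: nat and Z :: "'k vec set" and f g
    assume Z: "algebraic_set N Z" and f: "morphism (affine_variety N Z) ?A f"
      and g: "morphism (affine_variety N Z) ?A g"
    let ?Z = "affine_variety N Z"
    have Zc: "Z \<subseteq> carrier_vec N" using algebraic_set_subset[OF Z] .
    have pZ: "points ?Z = Z" using points_affine[OF Zc] .
    have pA: "points ?A = carrier_vec m" by simp
    have fc: "f z \<in> carrier_vec m" "g z \<in> carrier_vec m" if "z \<in> Z" for z
      using that morphism_point[OF f] morphism_point[OF g] pZ pA by auto
    have coord: "(\<lambda>z\<in>Z. h z $ i) \<in> sections ?Z Z" if h: "morphism ?Z ?A h" and i: "i < m" for h i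
    proof -
      have "restrict (\<lambda>v. v $ i) (carrier_vec m) \<in> sections ?A (carrier_vec m)"
        by (rule section_affine_polynomial) (use i polynomial_functions.coord openin_topspace[of "zariski m"] in auto)
      from morphism_pullback[OF h _ this]
      have "(\<lambda>z\<in>{z \<in> Z. h z \<in> carrier_vec m}. restrict (\<lambda>v. v $ i) (carrier_vec m) (h z))
          \<in> sections ?Z {z \<in> Z. h z \<in> carrier_vec m}"
        using openin_topspace[of "zariski m"] unfolding pZ by simp
      moreover have "{z \<in> Z. h z \<in> carrier_vec m} = Z"
        using morphism_point[OF h] pZ pA by auto
      moreover have "(\<lambda>z\<in>Z. restrict (\<lambda>v. v $ i) (carrier_vec m) (h z)) = (\<lambda>z\<in>Z. h z $ i)"
        by (rule restrict_ext) (use morphism_point[OF h] pZ pA in auto)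
      ultimately show ?thesis by simp
    qed
    have oZ: "openin (ztop ?Z) Z" using openin_topspace[of "ztop ?Z"] pZ by metis
    have "openin (ztop ?Z) {z \<in> Z. f z $ i \<noteq> g z $ i}" if i: "i < m" for i
    proof -
      \<comment> \<open>The difference is written as a sum with a multiple by -1, because the sheaf
        axioms speak of constants, sums and products.\<close>
      have "(\<lambda>z\<in>Z. (\<lambda>z\<in>Z. f z $ i) z + (\<lambda>z\<in>Z. (\<lambda>z\<in>Z. -1) z * (\<lambda>z\<in>Z. g z $ i) z) z) \<in> sections ?Z Z"
        by (intro sheaf_add sheaf_mult sheaf_const sheaf_affine oZ coord f g i)
      from regular_space_nonzero[OF regular_affine[OF Zc] oZ this]
      have "openin (ztop ?Z) {z \<in> Z. (\<lambda>z\<in>Z. (\<lambda>z\<in>Z. f z $ i) z + (\<lambda>z\<in>Z. (\<lambda>z\<in>Z. -1) z * (\<lambda>z\<in>Z. g z $ i) z) z) z \<noteq> 0}" .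
      moreover have "{z \<in> Z. (\<lambda>z\<in>Z. (\<lambda>z\<in>Z. f z $ i) z + (\<lambda>z\<in>Z. (\<lambda>z\<in>Z. -1) z * (\<lambda>z\<in>Z. g z $ i) z) z) z \<noteq> 0}
          = {z \<in> Z. f z $ i \<noteq> g z $ i}" by auto
      ultimately show ?thesis by simp
    qed
    then have "openin (ztop ?Z) (\<Union>i<m. {z \<in> Z. f z $ i \<noteq> g z $ i})"
      by (intro openin_Union) auto
    moreover have "(\<Union>i<m. {z \<in> Z. f z $ i \<noteq> g z $ i}) = Z - {z \<in> Z. f z = g z}"
    proof -
      have "f z = g z \<longleftrightarrow> (\<forall>i<m. f z $ i = g z $ i)" if "z \<in> Z" for z
        using fc[OF that] by (auto intro!: eq_vecI)
      then show ?thesis by auto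
    qed
    ultimately show "closedin (ztop ?Z) {z \<in> Z. f z = g z}"
      unfolding closedin_def pZ by auto
  qed
  ultimately show ?thesis
    unfolding irreducible_variety_def variety_def using irreducible_zariski by simp
qed

section \<open>Rational maps\<close>

lemma irreducible_Int_nonempty:
  assumes "irreducible_topology T" "openin T A" "openin T B" "A \<noteq> {}" "B \<noteq> {}"
  shows "A \<inter> B \<noteq> {}"
proof
  assume "A \<inter> B = {}"
  then have "(topspace T - A) \<union> (topspace T - B) = topspace T" by blast
  then have "topspace T - A = topspace T \<or> topspace T - B = topspace T"
    using assms(1-3) unfolding irreducible_topology_def by blast
  then show False using openin_subset[OF assms(2)] openin_subset[OF assms(3)] assms(4,5) by blast
qed

lemma morphism_cong:
  fixes X :: "('a, 'k) fspace" and Y :: "('b, 'k) fspace"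
  assumes "morphism X Y f" "\<And>x. x \<in> points X \<Longrightarrow> f x = g x"
  shows "morphism X Y g"
proof -
  have eq: "{x \<in> points X. f x \<in> V} = {x \<in> points X. g x \<in> V}" for V
    using assms(2) by auto
  have "(\<lambda>x\<in>{x \<in> points X. g x \<in> V}. s (f x)) = (\<lambda>x\<in>{x \<in> points X. g x \<in> V}. s (g x))"
    for V and s :: "'b \<Rightarrow> 'k"
    using assms(2) by (intro restrict_ext) auto
  moreover have "continuous_map (ztop X) (ztop Y) g"
    using continuous_map_eq[OF morphism_continuous[OF assms(1)]] assms(2) by blast
  ultimately show ?thesis using assms(1) unfolding morphism_def eq by simp
qed

lemma morphism_compose:
  assumes "morphism X Y f" "morphism Y Z g"
  shows "morphism X Z (\<lambda>x. g (f x))"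
  unfolding morphism_def
proof (intro conjI allI impI ballI)
  show "continuous_map (ztop X) (ztop Z) (\<lambda>x. g (f x))"
    using continuous_map_compose[OF morphism_continuous[OF assms(1)] morphism_continuous[OF assms(2)]]
    by (simp add: o_def)
  fix V s assume V: "openin (ztop Z) V" and s: "s \<in> sections Z V"
  let ?V = "{y \<in> points Y. g y \<in> V}"
  have eq: "{x \<in> points X. f x \<in> ?V} = {x \<in> points X. g (f x) \<in> V}"
    using morphism_point[OF assms(1)] by auto
  have "(\<lambda>x\<in>{x \<in> points X. f x \<in> ?V}. (\<lambda>y\<in>?V. s (g y)) (f x)) \<in> sections X {x \<in> points X. f x \<in> ?V}"
    by (rule morphism_pullback[OF assms(1) morphism_preimage[OF assms(2) V] morphism_pullback[OF assms(2) V s]])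
  moreover have "(\<lambda>x\<in>{x \<in> points X. f x \<in> ?V}. (\<lambda>y\<in>?V. s (g y)) (f x)) =
      (\<lambda>x\<in>{x \<in> points X. f x \<in> ?V}. s (g (f x)))"
    by (rule restrict_ext) simp
  ultimately show "(\<lambda>x\<in>{x \<in> points X. g (f x) \<in> V}. s (g (f x))) \<in> sections X {x \<in> points X. g (f x) \<in> V}"
    unfolding eq by simp
qed

lemma morphism_restrict:
  assumes "sheaf_of_functions X" "morphism X Y f" "openin (ztop X) U"
  shows "morphism (open_subspace X U) Y f"
  unfolding morphism_def points_open_subspace[OF assms(3)] sections_open_subspace
proof (intro conjI allI impI ballI)
  show "continuous_map (ztop (open_subspace X U)) (ztop Y) f"
    using continuous_map_from_subtopology[OF morphism_continuous[OF assms(2)]] by simp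
  fix V s assume V: "openin (ztop Y) V" and s: "s \<in> sections Y V"
  let ?V = "{x \<in> points X. f x \<in> V}" and ?W = "{x \<in> U. f x \<in> V}"
  have U: "U \<subseteq> points X" using openin_subset[OF assms(3)] .
  have "?W = U \<inter> ?V" using U by auto
  then have W: "openin (ztop X) ?W"
    using openin_Int[OF assms(3) morphism_preimage[OF assms(2) V]] by simp
  have "restrict (\<lambda>x\<in>?V. s (f x)) ?W \<in> sections X ?W"
    using U by (intro sheaf_restrict[OF assms(1) morphism_preimage[OF assms(2) V] morphism_pullback[OF assms(2) V s] W]) auto
  moreover have "restrict (\<lambda>x\<in>?V. s (f x)) ?W = (\<lambda>x\<in>?W. s (f x))"
    by (rule restrict_ext) (use U in auto)
  ultimately show "(\<lambda>x\<in>?W. s (f x)) \<in> sections X ?W" by simp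
qed

lemma morphism_into_open:
  assumes "morphism X Y f" "openin (ztop Y) V" "\<And>x. x \<in> points X \<Longrightarrow> f x \<in> V"
  shows "morphism X (open_subspace Y V) f"
  unfolding morphism_def openin_open_subspace[OF assms(2)] sections_open_subspace
  using morphism_continuous[OF assms(1)] assms(3) morphism_pullback[OF assms(1)]
  by (auto simp: continuous_map_in_subtopology)

lemma open_subspace_twice: "U' \<subseteq> U \<Longrightarrow> open_subspace (open_subspace X U) U' = open_subspace X U'"
  by (simp add: open_subspace_def subtopology_subtopology Int_absorb1)

lemma rational_reps_iff: "(U, f) \<in> rational_reps X Y \<longleftrightarrow> openin (ztop X) U \<and> U \<noteq> {} \<and>
    f \<in> extensional U \<and> morphism (open_subspace X U) Y f"
  by (simp add: rational_reps_def)

lemma rational_eq_iff: "((U, f), (V, g)) \<in> rational_eq X Y \<longleftrightarrow>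
    (U, f) \<in> rational_reps X Y \<and> (V, g) \<in> rational_reps X Y \<and>
    (\<exists>W. openin (ztop X) W \<and> W \<noteq> {} \<and> W \<subseteq> U \<inter> V \<and> (\<forall>x\<in>W. f x = g x))"
  by (simp add: rational_eq_def)

lemma rational_rep_preimage:
  assumes "(U, f) \<in> rational_reps X Y" "openin (ztop Y) V"
  shows "openin (ztop X) {x \<in> U. f x \<in> V}"
proof -
  have U: "openin (ztop X) U" "morphism (open_subspace X U) Y f"
    using assms(1) by (auto simp: rational_reps_iff)
  from morphism_preimage[OF U(2) assms(2)]
  have "openin (ztop (open_subspace X U)) {x \<in> U. f x \<in> V}"
    unfolding points_open_subspace[OF U(1)] .
  then show ?thesis unfolding openin_open_subspace[OF U(1)] ..
qed

lemma rational_rep_dense_preimage: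
  assumes "(U, f) \<in> rational_reps X Y" "ztop Y closure_of (f ` U) = points Y"
    and "openin (ztop Y) V" "V \<noteq> {}"
  shows "{x \<in> U. f x \<in> V} \<noteq> {}"
  using assms(2-4) unfolding dense_intersects_open by blast

text \<open>Any two nonempty open sets meet here. This makes generic agreement of representatives
  transitive and lets density of the image pass between representatives.\<close>

locale irreducible_space =
  fixes X :: "('a, 'k::field) fspace"
  assumes sheaf: "sheaf_of_functions X" and irreducible: "irreducible_topology (ztop X)"
begin

lemma equiv_rational: "equiv (rational_reps X Y) (rational_eq X Y)"
proof (rule equivI)
  show "rational_eq X Y \<subseteq> rational_reps X Y \<times> rational_reps X Y"
    by (auto simp: rational_eq_def)
  show "refl_on (rational_reps X Y) (rational_eq X Y)"
    unfolding refl_on_def by (auto simp: rational_eq_iff rational_reps_iff)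
  show "sym (rational_eq X Y)"
  proof (rule symI)
    fix p q assume "(p, q) \<in> rational_eq X Y"
    then show "(q, p) \<in> rational_eq X Y"
      by (cases p; cases q) (simp add: rational_eq_iff, metis)
  qed
  show "trans (rational_eq X Y)"
  proof (rule transI)
    fix p q r assume pq: "(p, q) \<in> rational_eq X Y" and qr: "(q, r) \<in> rational_eq X Y"
    obtain U f V g U' h where [simp]: "p = (U, f)" "q = (V, g)" "r = (U', h)"
      by (cases p; cases q; cases r)
    obtain W where W: "openin (ztop X) W" "W \<noteq> {}" "W \<subseteq> U \<inter> V" "\<forall>x\<in>W. f x = g x"
      using pq by (auto simp: rational_eq_iff)
    obtain W' where W': "openin (ztop X) W'" "W' \<noteq> {}" "W' \<subseteq> V \<inter> U'" "\<forall>x\<in>W'. g x = h x"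
      using qr by (auto simp: rational_eq_iff)
    have "W \<inter> W' \<noteq> {}" using irreducible_Int_nonempty[OF irreducible] W W' by blast
    then have "\<exists>W. openin (ztop X) W \<and> W \<noteq> {} \<and> W \<subseteq> U \<inter> U' \<and> (\<forall>x\<in>W. f x = h x)"
      using W W' by (intro exI[of _ "W \<inter> W'"]) auto
    then show "(p, r) \<in> rational_eq X Y" using pq qr by (simp add: rational_eq_iff)
  qed
qed

lemma rational_class:
  assumes "\<Phi> \<in> rational_maps X Y" "p \<in> \<Phi>"
  shows "p \<in> rational_reps X Y" "\<Phi> = rational_eq X Y `` {p}"
  using assms equiv_rational[of Y] unfolding rational_maps_def
  by (auto elim!: quotientE simp: equiv_class_eq_iff dest: equiv_class_eq)

lemma rational_map_nonempty:
  assumes "\<Phi> \<in> rational_maps X Y"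
  obtains U f where "(U, f) \<in> \<Phi>" "(U, f) \<in> rational_reps X Y"
proof -
  obtain p where "p \<in> \<Phi>"
    using assms in_quotient_imp_non_empty[OF equiv_rational] unfolding rational_maps_def by blast
  then show thesis using that[of "fst p" "snd p"] rational_class[OF assms] by simp
qed

lemma class_in_rational_maps: "p \<in> rational_reps X Y \<Longrightarrow> rational_eq X Y `` {p} \<in> rational_maps X Y"
  unfolding rational_maps_def by (rule quotientI)

lemma rep_in_class: "p \<in> rational_reps X Y \<Longrightarrow> p \<in> rational_eq X Y `` {p}"
  using equiv_class_self[OF equiv_rational] by blast

lemma class_eqI: "(p, q) \<in> rational_eq X Y \<Longrightarrow> rational_eq X Y `` {p} = rational_eq X Y `` {q}"
  by (rule equiv_class_eq[OF equiv_rational])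

lemma same_class: "\<Phi> \<in> rational_maps X Y \<Longrightarrow> p \<in> \<Phi> \<Longrightarrow> q \<in> \<Phi> \<Longrightarrow> (p, q) \<in> rational_eq X Y"
  using rational_class(2)[of \<Phi> Y p] by blast

lemma dominant_classI:
  assumes "(U, f) \<in> rational_reps X Y" "ztop Y closure_of (f ` U) = points Y"
  shows "dominant X Y (rational_eq X Y `` {(U, f)})"
  unfolding dominant_def
proof (intro ballI, clarify)
  fix V g assume "((U, f), (V, g)) \<in> rational_eq X Y"
  then obtain W where W: "openin (ztop X) W" "W \<noteq> {}" "W \<subseteq> U \<inter> V" "\<forall>x\<in>W. f x = g x"
    by (auto simp: rational_eq_iff)
  show "ztop Y closure_of (g ` V) = points Y"
    unfolding dense_intersects_open
  proof (intro allI impI)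
    fix T assume T: "openin (ztop Y) T \<and> T \<noteq> {}"
    then have "openin (ztop X) {x \<in> U. f x \<in> T}" "{x \<in> U. f x \<in> T} \<noteq> {}"
      using rational_rep_preimage[OF assms(1)] rational_rep_dense_preimage[OF assms] by auto
    then have "{x \<in> U. f x \<in> T} \<inter> W \<noteq> {}"
      using irreducible_Int_nonempty[OF irreducible] W by blast
    then obtain x where "x \<in> W" "f x \<in> T" by blast
    then have "g x \<in> g ` V \<inter> T" using W by auto
    then show "g ` V \<inter> T \<noteq> {}" by blast
  qed
qed

text \<open>Density of the image guarantees that the preimage of the open set \<open>V\<close> is
  not empty, so the composite has a legitimate domain.\<close>

lemma compose_reps_in_reps:
  assumes p: "(U, f) \<in> rational_reps X Y" "ztop Y closure_of (f ` U) = points Y"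
    and q: "(V, g) \<in> rational_reps Y Z"
  shows "compose_reps (U, f) (V, g) \<in> rational_reps X Z"
proof -
  let ?W = "{x \<in> U. f x \<in> V}"
  have U: "openin (ztop X) U" "morphism (open_subspace X U) Y f"
    and V: "openin (ztop Y) V" "V \<noteq> {}" "morphism (open_subspace Y V) Z g"
    using p q by (auto simp: rational_reps_iff)
  have W: "openin (ztop X) ?W" "?W \<noteq> {}"
    using rational_rep_preimage[OF p(1) V(1)] rational_rep_dense_preimage[OF p V(1,2)] by auto
  have "openin (ztop (open_subspace X U)) ?W"
    using W U openin_open_subspace[OF U(1)] by auto
  from morphism_restrict[OF sheaf_open_subspace[OF sheaf U(1)] U(2) this]
  have "morphism (open_subspace X ?W) Y f" by (simp add: open_subspace_twice)
  then have "morphism (open_subspace X ?W) (open_subspace Y V) f"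
    by (rule morphism_into_open[OF _ V(1)]) (simp add: points_open_subspace[OF W(1)])
  from morphism_compose[OF this V(3)] have "morphism (open_subspace X ?W) Z (\<lambda>x. g (f x))" .
  then have "morphism (open_subspace X ?W) Z (\<lambda>x\<in>?W. g (f x))"
    by (rule morphism_cong) (simp add: points_open_subspace[OF W(1)])
  then show ?thesis using W by (simp add: compose_reps_def rational_reps_iff)
qed

lemma compose_reps_cong:
  assumes "((U, f), (U', f')) \<in> rational_eq X Y" "((V, g), (V', g')) \<in> rational_eq Y Z"
    and "ztop Y closure_of (f ` U) = points Y" "ztop Y closure_of (f' ` U') = points Y"
  shows "(compose_reps (U, f) (V, g), compose_reps (U', f') (V', g')) \<in> rational_eq X Z"
proof -
  obtain W where W: "openin (ztop X) W" "W \<noteq> {}" "W \<subseteq> U \<inter> U'" "\<forall>x\<in>W. f x = f' x"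
    and reps: "(U, f) \<in> rational_reps X Y" "(U', f') \<in> rational_reps X Y"
    using assms(1) by (auto simp: rational_eq_iff)
  obtain T where T: "openin (ztop Y) T" "T \<noteq> {}" "T \<subseteq> V \<inter> V'" "\<forall>y\<in>T. g y = g' y"
    and reps': "(V, g) \<in> rational_reps Y Z" "(V', g') \<in> rational_reps Y Z"
    using assms(2) by (auto simp: rational_eq_iff)
  let ?S = "{x \<in> U. f x \<in> T} \<inter> W"
  have "openin (ztop X) {x \<in> U. f x \<in> T}" "{x \<in> U. f x \<in> T} \<noteq> {}"
    using rational_rep_preimage[OF reps(1) T(1)] rational_rep_dense_preimage[OF reps(1) assms(3) T(1,2)] by auto
  then have S: "openin (ztop X) ?S" "?S \<noteq> {}"
    using irreducible_Int_nonempty[OF irreducible] W by blast+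
  have "compose_reps (U, f) (V, g) \<in> rational_reps X Z" "compose_reps (U', f') (V', g') \<in> rational_reps X Z"
    using compose_reps_in_reps reps reps' assms by blast+
  then show ?thesis
    unfolding compose_reps_def prod.case rational_eq_iff
    using S W(3,4) T(3,4) by (intro conjI exI[of _ ?S]) auto
qed

text \<open>The union over all pairs of representatives in \<open>rational_comp\<close> collapses to
  a single class. From here on, composites are computed with one convenient pair.\<close>

lemma rational_comp_class:
  assumes \<Phi>: "\<Phi> \<in> rational_maps X Y" "dominant X Y \<Phi>" "p \<in> \<Phi>"
    and \<Psi>: "\<Psi> = rational_eq Y Z `` {q}" "q \<in> rational_reps Y Z" "irreducible_space Y"
  shows "rational_comp X Z \<Psi> \<Phi> = rational_eq X Z `` {compose_reps p q}"
proof -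
  interpret Y: irreducible_space Y by fact
  have q: "q \<in> \<Psi>" using Y.rep_in_class[OF \<Psi>(2)] \<Psi>(1) by simp
  have "rational_eq X Z `` {compose_reps p' q'} = rational_eq X Z `` {compose_reps p q}"
    if "p' \<in> \<Phi>" "q' \<in> \<Psi>" for p' q'
  proof (rule class_eqI)
    obtain U f V g U' f' V' g' where [simp]: "p = (U, f)" "q = (V, g)" "p' = (U', f')" "q' = (V', g')"
      by (cases p; cases q; cases p'; cases q')
    have "(p', p) \<in> rational_eq X Y" using same_class[OF \<Phi>(1) that(1) \<Phi>(3)] .
    moreover have "(q', q) \<in> rational_eq Y Z"
      using Y.same_class[OF Y.class_in_rational_maps[OF \<Psi>(2)]] that(2) q \<Psi>(1) by blast
    ultimately show "(compose_reps p' q', compose_reps p q) \<in> rational_eq X Z"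
      using \<Phi> that(1) unfolding dominant_def by (simp, intro compose_reps_cong) auto
  qed
  then show ?thesis unfolding rational_comp_def using \<Phi>(3) q by blast
qed

end

lemma irreducible_variety_space: "irreducible_variety X \<Longrightarrow> irreducible_space X"
  by (simp add: irreducible_variety_def variety_def prevariety_def irreducible_space_def)

section \<open>The linear action\<close>

lemma cyclic_generator:
  assumes "group G" "cyclic_group G" "Coset.order G = d" "d > 0"
  shows "\<exists>\<gamma>\<in>carrier G. (\<forall>n::nat. \<gamma> [^]\<^bsub>G\<^esub> n = \<one>\<^bsub>G\<^esub> \<longleftrightarrow> d dvd n) \<and>
    carrier G = (\<lambda>i::nat. \<gamma> [^]\<^bsub>G\<^esub> i) ` {..<d}"
proof -
  interpret group G by fact
  obtain \<gamma> where \<gamma>: "\<gamma> \<in> carrier G" "subgroup_generated G {\<gamma>} = G"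
    using assms(2) unfolding cyclic_group_def by blast
  have gen: "generate G {\<gamma>} = carrier G"
    using \<gamma> by (metis carrier_subgroup_generated Int_insert_right_if1 Int_empty_right)
  then have ord: "ord \<gamma> = d"
    using generate_pow_card[OF \<gamma>(1)] assms(3) by (simp add: Coset.order_def)
  have "carrier G = {\<gamma> [^]\<^bsub>G\<^esub> x | x::nat. x \<in> {0..ord \<gamma> - 1}}"
    using generate_pow_nat[OF \<gamma>(1)] ord_elems_inf_carrier[OF \<gamma>(1)] gen ord assms(4) by simp
  also have "\<dots> = (\<lambda>i. \<gamma> [^]\<^bsub>G\<^esub> i) ` {..<d}" using ord assms(4) by auto
  finally show ?thesis using \<gamma>(1) pow_eq_id[OF \<gamma>(1)] ord by blast
qed

section \<open>The matrices of the target group and the rational maps they induce\<close>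

definition dmat :: "nat \<Rightarrow> 'k::field \<Rightarrow> 'k mat" where
  "dmat m t = mat m m (\<lambda>(i, j). if i = j then (if i = 0 then t else 1) else 0)"

lemma dmat_carrier [simp]: "dmat m t \<in> carrier_mat m m"
  by (simp add: dmat_def)

lemma dmat_mult_vec:
  assumes "v \<in> carrier_vec m"
  shows "dmat m t *\<^sub>v v = vec m (\<lambda>i. if i = 0 then t * v $ 0 else v $ i)"
proof (rule eq_vecI)
  fix i assume "i < dim_vec (vec m (\<lambda>i. if i = 0 then t * v $ 0 else v $ i))"
  then have i: "i < m" by simp
  have "(dmat m t *\<^sub>v v) $ i = (\<Sum>j = 0..<m. (if i = j then (if i = 0 then t else 1) else 0) * v $ j)"
    using i assms by (auto simp: dmat_def scalar_prod_def intro!: sum.cong)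
  also have "\<dots> = (\<Sum>j = 0..<m. if j = i then (if i = 0 then t else 1) * v $ i else 0)"
    by (intro sum.cong) auto
  also have "\<dots> = (if i = 0 then t else 1) * v $ i" using i by simp
  finally show "(dmat m t *\<^sub>v v) $ i = vec m (\<lambda>i. if i = 0 then t * v $ 0 else v $ i) $ i"
    using i by simp
qed (simp add: dmat_def)

lemma dmat_vec_carrier: "v \<in> carrier_vec m \<Longrightarrow> dmat m t *\<^sub>v v \<in> carrier_vec m"
  by (simp add: dmat_mult_vec)

lemma dmat_twice: "v \<in> carrier_vec m \<Longrightarrow> dmat m s *\<^sub>v (dmat m t *\<^sub>v v) = dmat m (s * t) *\<^sub>v v"
  by (auto simp: dmat_mult_vec intro!: eq_vecI)

lemma dmat_1: "dmat m 1 = 1\<^sub>m m"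
  by (auto simp: dmat_def one_mat_def intro!: eq_matI)

lemma dmat_mult: "dmat m s * dmat m t = dmat m (s * t)"
proof (rule eq_matI)
  fix i j assume "i < dim_row (dmat m (s * t))" "j < dim_col (dmat m (s * t))"
  then have ij: "i < m" "j < m" by (auto simp: dmat_def)
  have "(dmat m s * dmat m t) $$ (i, j) = (dmat m s *\<^sub>v col (dmat m t) j) $ i"
    using ij by (simp add: dmat_def)
  also have "\<dots> = (if i = 0 then s * col (dmat m t) j $ 0 else col (dmat m t) j $ i)"
    using ij by (subst dmat_mult_vec) (auto simp: dmat_def)
  also have "\<dots> = dmat m (s * t) $$ (i, j)" using ij by (auto simp: dmat_def)
  finally show "(dmat m s * dmat m t) $$ (i, j) = dmat m (s * t) $$ (i, j)" .
qed (auto simp: dmat_def)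

lemma dmat_inj: "m > 0 \<Longrightarrow> dmat m s = dmat m t \<Longrightarrow> s = t"
proof -
  assume "m > 0" "dmat m s = dmat m t"
  then have "dmat m s $$ (0, 0) = dmat m t $$ (0, 0)" by simp
  then show "s = t" using \<open>m > 0\<close> by (simp add: dmat_def)
qed

lemma dmat_GL:
  assumes "t \<noteq> 0"
  shows "dmat m t \<in> carrier (GL m)"
  unfolding GL_def units_of_carrier Units_def ring_mat_simps
  using assms by (auto intro!: bexI[of _ "dmat m (inverse t)"] simp: dmat_mult dmat_1)

lemma T_group_dmat: "T_group m d = dmat m ` {t. t ^ d = 1}"
  by (auto simp: T_group_def dmat_def)

definition lin_rep :: "nat \<Rightarrow> 'k::field \<Rightarrow> ('k vec, 'k vec) partial_map" where
  "lin_rep m t = (carrier_vec m, \<lambda>v\<in>carrier_vec m. dmat m t *\<^sub>v v)"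

definition lin_map :: "nat \<Rightarrow> 'k::field \<Rightarrow> ('k vec, 'k vec) partial_map set" where
  "lin_map m t = rational_eq (affine_space m) (affine_space m) `` {lin_rep m t}"

lemma linear_rational_action_dmat:
  "linear_rational_action m \<Lambda> g = lin_map m t" if "\<Lambda> g = dmat m t"
  using that by (simp add: linear_rational_action_def rational_of_morphism_def lin_map_def lin_rep_def)

lemma irreducible_space_affine_space:
  "irreducible_space (affine_space m :: ('k::field_char_0 vec, 'k) fspace)"
  by (rule irreducible_variety_space[OF irreducible_variety_affine_space])

lemma lin_rep_in_reps:
  assumes "m > 0"
  shows "lin_rep m (t :: 'k::field_char_0) \<in> rational_reps (affine_space m) (affine_space m)"
proof -
  let ?A = "affine_space m :: ('k vec, 'k) fspace"
  have pA: "points ?A = carrier_vec m" by simp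
  have o: "openin (subtopology (zariski m) (carrier_vec m)) (carrier_vec m)"
    using openin_topspace[of "zariski m"] by simp
  have "morphism ?A ?A (\<lambda>v. dmat m t *\<^sub>v v)"
  proof (rule morphism_affine_spaceI)
    show "regular_space ?A" by (rule regular_affine) simp
    show "dmat m t *\<^sub>v v \<in> carrier_vec m" if "v \<in> points ?A" for v
      using that pA dmat_vec_carrier by blast
    fix i assume i: "i < m"
    let ?P = "\<lambda>v :: 'k vec. if i = 0 then t * v $ 0 else v $ i"
    have "?P \<in> polynomial_functions m"
      using i assms by (cases "i = 0") (auto intro!: polynomial_functions.intros)
    from section_affine_polynomial[OF this o]
    have "restrict ?P (carrier_vec m) \<in> sections ?A (carrier_vec m)" .
    moreover have "restrict ?P (carrier_vec m) = (\<lambda>v\<in>carrier_vec m. (dmat m t *\<^sub>v v) $ i)"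
      by (rule restrict_ext) (use i in \<open>simp add: dmat_mult_vec\<close>)
    ultimately show "(\<lambda>v\<in>points ?A. (dmat m t *\<^sub>v v) $ i) \<in> sections ?A (points ?A)"
      unfolding pA by simp
  qed
  then have "morphism ?A ?A (\<lambda>v\<in>carrier_vec m. dmat m t *\<^sub>v v)"
    by (rule morphism_cong) (simp add: pA)
  moreover have sub: "open_subspace ?A (carrier_vec m) = ?A"
    using open_subspace_points[of ?A] unfolding pA .
  moreover have "0\<^sub>v m \<in> (carrier_vec m :: 'k vec set)" by simp
  then have "carrier_vec m \<noteq> ({} :: 'k vec set)" by (metis empty_iff)
  ultimately show ?thesis unfolding lin_rep_def rational_reps_iff sub using o by simp
qed

text \<open>The map is onto: the matrix with \<open>inverse t\<close> supplies preimages.\<close>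

lemma lin_rep_dense:
  assumes "(t :: 'k::field_char_0) \<noteq> 0"
  shows "ztop (affine_space m) closure_of (snd (lin_rep m t) ` fst (lin_rep m t)) = points (affine_space m)"
proof -
  have "snd (lin_rep m t) ` fst (lin_rep m t) = carrier_vec m"
  proof
    show "carrier_vec m \<subseteq> snd (lin_rep m t) ` fst (lin_rep m t)"
    proof
      fix v :: "'k vec" assume v: "v \<in> carrier_vec m"
      have "v = snd (lin_rep m t) (dmat m (inverse t) *\<^sub>v v)"
        using v assms by (simp add: lin_rep_def dmat_vec_carrier dmat_twice dmat_1)
      then show "v \<in> snd (lin_rep m t) ` fst (lin_rep m t)"
        using v by (intro image_eqI[of _ _ "dmat m (inverse t) *\<^sub>v v"]) (auto simp: lin_rep_def dmat_vec_carrier)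
    qed
  qed (auto simp: lin_rep_def dmat_vec_carrier)
  then show ?thesis using closure_of_topspace[of "zariski m"] by simp
qed

lemma lin_map_in_rational_maps:
  "m > 0 \<Longrightarrow> lin_map m (t :: 'k::field_char_0) \<in> rational_maps (affine_space m) (affine_space m)"
  unfolding lin_map_def
  by (rule irreducible_space.class_in_rational_maps[OF irreducible_space_affine_space lin_rep_in_reps])

lemma lin_rep_in_lin_map: "m > 0 \<Longrightarrow> lin_rep m (t :: 'k::field_char_0) \<in> lin_map m t"
  unfolding lin_map_def
  by (rule irreducible_space.rep_in_class[OF irreducible_space_affine_space lin_rep_in_reps])

lemma lin_map_dominant:
  assumes "m > 0" "(t :: 'k::field_char_0) \<noteq> 0"
  shows "dominant (affine_space m) (affine_space m) (lin_map m t)"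
proof -
  have "dominant (affine_space m) (affine_space m)
    (rational_eq (affine_space m) (affine_space m) `` {(fst (lin_rep m t), snd (lin_rep m t))})"
    by (rule irreducible_space.dominant_classI[OF irreducible_space_affine_space])
       (simp_all only: prod.collapse lin_rep_in_reps[OF assms(1)] lin_rep_dense[OF assms(2)])
  then show ?thesis by (simp only: prod.collapse lin_map_def)
qed

lemma lin_map_comp:
  assumes "m > 0" "(s :: 'k::field_char_0) \<noteq> 0" "t \<noteq> 0"
  shows "rational_comp (affine_space m) (affine_space m) (lin_map m s) (lin_map m t) = lin_map m (s * t)"
proof -
  have "compose_reps (lin_rep m t) (lin_rep m s) = lin_rep m (s * t)"
  proof -
    have "{x \<in> carrier_vec m. (\<lambda>v\<in>carrier_vec m. dmat m t *\<^sub>v v) x \<in> carrier_vec m} = carrier_vec m"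
      by (auto simp: dmat_vec_carrier)
    then show ?thesis
      unfolding compose_reps_def lin_rep_def prod.case
      by (auto simp: dmat_vec_carrier dmat_twice intro!: restrict_ext)
  qed
  then show ?thesis
    using irreducible_space.rational_comp_class[OF irreducible_space_affine_space
        lin_map_in_rational_maps[OF assms(1)] lin_map_dominant[OF assms(1,3)] lin_rep_in_lin_map[OF assms(1)]
        lin_map_def[of m s] lin_rep_in_reps[OF assms(1)] irreducible_space_affine_space]
    by (simp add: lin_map_def)
qed

lemma lin_map_1: "lin_map m (1 :: 'k::field_char_0) = rational_of_morphism (affine_space m) (affine_space m) id"
proof -
  have "(\<lambda>v\<in>carrier_vec m. dmat m (1 :: 'k) *\<^sub>v v) = restrict id (carrier_vec m)"
    by (rule restrict_ext) (simp add: dmat_1)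
  then show ?thesis by (simp add: lin_map_def rational_of_morphism_def lin_rep_def)
qed

lemma lin_map_birational:
  assumes "m > 0" "(t :: 'k::field_char_0) \<noteq> 0"
  shows "birational (affine_space m) (affine_space m) (lin_map m t)"
  unfolding birational_def
proof (intro conjI bexI[of _ "lin_map m (inverse t)"])
  show "rational_comp (affine_space m) (affine_space m) (lin_map m (inverse t)) (lin_map m t) =
      rational_of_morphism (affine_space m) (affine_space m) id"
    "rational_comp (affine_space m) (affine_space m) (lin_map m t) (lin_map m (inverse t)) =
      rational_of_morphism (affine_space m) (affine_space m) id"
    using assms by (simp_all add: lin_map_comp flip: lin_map_1)
qed (use assms in \<open>simp_all add: lin_map_in_rational_maps lin_map_dominant\<close>)

text \<open>Equal classes agree on a nonempty open set. By density the coordinate of index 0 is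
  nonzero at some point there, where the two scalars can be compared.\<close>

lemma lin_map_inj:
  assumes "m > 0" "lin_map m (s :: 'k::field_char_0) = lin_map m t"
  shows "s = t"
proof -
  have "(lin_rep m s, lin_rep m t) \<in> rational_eq (affine_space m) (affine_space m)"
    using irreducible_space.same_class[OF irreducible_space_affine_space lin_map_in_rational_maps[OF assms(1)]]
      lin_rep_in_lin_map[OF assms(1)] assms(2) by metis
  then obtain W where W: "openin (zariski m) W" "W \<noteq> {}"
    "\<forall>v\<in>W. (\<lambda>v\<in>carrier_vec m. dmat m s *\<^sub>v v) v = (\<lambda>v\<in>carrier_vec m. dmat m t *\<^sub>v v) v"
    unfolding lin_rep_def rational_eq_iff by auto
  have Wc: "W \<subseteq> carrier_vec m" using openin_subset[OF W(1)] by simp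
  have "\<exists>v\<in>W. v $ 0 \<noteq> 0"
  proof (rule ccontr)
    assume "\<not> ?thesis"
    then have "unit_vec m 0 $ 0 = (0 :: 'k)"
      using zariski_dense[OF W(1,2) polynomial_functions.coord[OF assms(1)]] by auto
    then show False using assms(1) by simp
  qed
  then obtain v where v: "v \<in> W" "v $ 0 \<noteq> 0" by blast
  then have "(dmat m s *\<^sub>v v) $ 0 = (dmat m t *\<^sub>v v) $ 0" using W(3) Wc by (auto simp: subset_iff)
  then have "s * v $ 0 = t * v $ 0" using v Wc assms(1) by (subst (asm) (1 2) dmat_mult_vec) auto
  then show ?thesis using v(2) by simp
qed

lemma dmat_rational_action:
  fixes \<chi> :: "'g \<Rightarrow> 'k::field_char_0"
  assumes "m > 0" "\<And>g h. g \<in> carrier G \<Longrightarrow> h \<in> carrier G \<Longrightarrow> \<chi> (g \<otimes>\<^bsub>G\<^esub> h) = \<chi> g * \<chi> h"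
    and nz: "\<And>g. g \<in> carrier G \<Longrightarrow> \<chi> g \<noteq> 0" and "inj_on \<chi> (carrier G)"
  shows "rational_action G (affine_space m) (linear_rational_action m (\<lambda>g. dmat m (\<chi> g)))"
proof -
  have eq: "linear_rational_action m (\<lambda>g. dmat m (\<chi> g)) g = lin_map m (\<chi> g)" for g
    by (rule linear_rational_action_dmat) simp
  have "(\<lambda>g. lin_map m (\<chi> g)) \<in> hom G (Bir (affine_space m))"
  proof (rule homI)
    fix g h assume "g \<in> carrier G" "h \<in> carrier G"
    then show "lin_map m (\<chi> (g \<otimes>\<^bsub>G\<^esub> h)) = lin_map m (\<chi> g) \<otimes>\<^bsub>Bir (affine_space m)\<^esub> lin_map m (\<chi> h)"
      using assms(2) lin_map_comp[OF assms(1) nz nz] by (simp add: Bir_def)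
  qed (use lin_map_birational[OF assms(1) nz] in \<open>simp add: Bir_def\<close>)
  moreover have "inj_on (\<lambda>g. lin_map m (\<chi> g)) (carrier G)"
  proof (rule inj_onI)
    fix g h assume gh: "g \<in> carrier G" "h \<in> carrier G" and "lin_map m (\<chi> g) = lin_map m (\<chi> h)"
    from lin_map_inj[OF assms(1) this(3)] show "g = h" using inj_onD[OF assms(4)] gh by blast
  qed
  ultimately show ?thesis
    unfolding rational_action_def eq using irreducible_variety_affine_space by (simp add: eq)
qed

text \<open>
  Comparing degrees in the first variable of \<open>P\<^sup>n = x\<^sub>0 Q\<^sup>n\<close>; this is what keeps the map
  constructed below from being birational, whatever the dimension of the source.
\<close>

lemma coordinate_no_root:
  fixes P Q :: "'k::field_char_0 vec \<Rightarrow> 'k"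
  assumes "m > 0" "n > 1" "openin (zariski m) U" "U \<noteq> {}"
    and P: "P \<in> polynomial_functions m" and Q: "Q \<in> polynomial_functions m"
    and nz: "\<And>u. u \<in> U \<Longrightarrow> Q u \<noteq> 0" and eq: "\<And>u. u \<in> U \<Longrightarrow> (P u / Q u) ^ n = u $ 0"
  shows False
proof -
  obtain v where v: "v \<in> U" using assms(4) by blast
  then have vc: "v \<in> carrier_vec m" using openin_subset[OF assms(3)] by auto
  \<comment> \<open>The equation with denominators cleared. Being polynomial, it extends from
    \<open>U\<close> to the whole space, so it may be evaluated on a line that leaves
    \<open>U\<close>.\<close>
  let ?R = "\<lambda>u. P u ^ n - u $ 0 * Q u ^ n"
  have R: "?R \<in> polynomial_functions m"
    using P Q polynomial_functions.coord[OF assms(1)]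
    by (intro subalg_diff subalg_mult subalg_power subalg_polynomial_functions)
  have "?R u = 0" if "u \<in> U" for u
    using eq[OF that] nz[OF that] by (simp add: power_divide field_simps)
  then have R0: "?R u = 0" if "u \<in> carrier_vec m" for u
    using zariski_dense[OF assms(3,4) R _ that] by blast
  \<comment> \<open>On a line in this direction the coordinate of index 0 has degree exactly one.
    Starting from a point of \<open>U\<close> makes \<open>q\<close> nonzero.\<close>
  have e: "unit_vec m 0 \<in> (carrier_vec m :: 'k vec set)" by simp
  obtain p where p: "\<And>t. poly p t = P (v + t \<cdot>\<^sub>v unit_vec m 0)"
    using polynomial_function_line[OF P vc e] by blast
  obtain q where q: "\<And>t. poly q t = Q (v + t \<cdot>\<^sub>v unit_vec m 0)"
    using polynomial_function_line[OF Q vc e] by blast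
  have "v + 0 \<cdot>\<^sub>v unit_vec m 0 = v" using vc by (auto intro!: eq_vecI)
  then have "q \<noteq> 0" using nz[OF v] q[of 0] by auto
  have "poly (p ^ n) t = poly ([:v $ 0, 1:] * q ^ n) t" for t
    using R0[of "v + t \<cdot>\<^sub>v unit_vec m 0"] vc assms(1) by (simp add: p[symmetric] q[symmetric] poly_power algebra_simps)
  then have pq: "p ^ n = [:v $ 0, 1:] * q ^ n" by (intro poly_ext) 
  have "[:v $ 0, 1:] * q ^ n \<noteq> 0" unfolding mult_eq_0_iff using \<open>q \<noteq> 0\<close> by simp
  then have "p \<noteq> 0" using pq assms(2) by (metis power_0_left not_one_less_zero)
  have "n * degree p = 1 + n * degree q"
  proof -
    have "degree (p ^ n) = n * degree p" "degree (q ^ n) = n * degree q"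
      using \<open>p \<noteq> 0\<close> \<open>q \<noteq> 0\<close> by (simp_all add: degree_power_eq)
    moreover have "degree ([:v $ 0, 1:] * q ^ n) = 1 + degree (q ^ n)"
      using \<open>q \<noteq> 0\<close> by (subst degree_mult_eq) auto
    ultimately show ?thesis using pq by simp
  qed
  then have "n dvd 1" by (metis dvd_add_left_iff dvd_triv_left)
  then show False using assms(2) by simp
qed

section \<open>Finite groups of birational maps\<close>

lemma irreducible_finite_Inter:
  assumes "irreducible_topology T" "finite I" "openin T U" "U \<noteq> {}"
    and "\<And>i. i \<in> I \<Longrightarrow> openin T (A i)" "\<And>i. i \<in> I \<Longrightarrow> A i \<noteq> {}"
  shows "openin T (U \<inter> (\<Inter>i\<in>I. A i)) \<and> U \<inter> (\<Inter>i\<in>I. A i) \<noteq> {}"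
  using assms(2,5,6)
proof (induction I rule: finite_induct)
  case empty
  then show ?case using assms(3,4) by simp
next
  case (insert i I)
  then have IH: "openin T (U \<inter> (\<Inter>i\<in>I. A i))" "U \<inter> (\<Inter>i\<in>I. A i) \<noteq> {}" by auto
  have "U \<inter> (\<Inter>i\<in>insert i I. A i) = (U \<inter> (\<Inter>i\<in>I. A i)) \<inter> A i" by auto
  then show ?case
    using irreducible_Int_nonempty[OF assms(1) IH(1) _ IH(2), of "A i"] openin_Int[OF IH(1), of "A i"] insert.prems
    by simp
qed

context irreducible_space
begin

lemma rational_eq_restrict:
  assumes "(U, f) \<in> rational_reps X Y" "openin (ztop X) W" "W \<noteq> {}" "W \<subseteq> U"
  shows "((U, f), (W, restrict f W)) \<in> rational_eq X Y"
proof -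
  have U: "openin (ztop X) U" "morphism (open_subspace X U) Y f"
    using assms(1) by (auto simp: rational_reps_iff)
  have "openin (ztop (open_subspace X U)) W"
    using assms U openin_open_subspace[OF U(1)] by auto
  from morphism_restrict[OF sheaf_open_subspace[OF sheaf U(1)] U(2) this]
  have "morphism (open_subspace X W) Y f" using assms(4) by (simp add: open_subspace_twice)
  then have "morphism (open_subspace X W) Y (restrict f W)"
    by (rule morphism_cong) (simp add: points_open_subspace[OF assms(2)])
  then have "(W, restrict f W) \<in> rational_reps X Y"
    using assms(2,3) by (simp add: rational_reps_iff)
  then show ?thesis unfolding rational_eq_iff using assms by (auto intro!: exI[of _ W])
qed

text \<open>
  Finitely many generic identities hold simultaneously on a nonempty open set, which is then
  shrunk to the points all of whose translates lie in it.
\<close>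

lemma honest_action:
  fixes G (structure)
  assumes G: "group G" "finite (carrier G)" and \<rho>: "\<rho> \<in> hom G (Bir X)"
    and U\<^sub>0: "openin (ztop X) U\<^sub>0" "U\<^sub>0 \<noteq> {}"
  shows "\<exists>W f. openin (ztop X) W \<and> W \<noteq> {} \<and> W \<subseteq> U\<^sub>0 \<and>
    (\<forall>g\<in>carrier G. \<forall>x\<in>W. f g x \<in> W) \<and> (\<forall>x\<in>W. f \<one> x = x) \<and>
    (\<forall>g\<in>carrier G. \<forall>h\<in>carrier G. \<forall>x\<in>W. f g (f h x) = f (g \<otimes> h) x) \<and>
    (\<forall>g\<in>carrier G. (W, restrict (f g) W) \<in> \<rho> g)"
proof -
  interpret group G by fact
  have bir: "birational X X (\<rho> g)" if "g \<in> carrier G" for g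
    using hom_in_carrier[OF \<rho> that] by (simp add: Bir_def)
  then have maps: "\<rho> g \<in> rational_maps X X" "dominant X X (\<rho> g)" if "g \<in> carrier G" for g
    using that by (auto simp: birational_def)
  have "\<forall>g. \<exists>p. g \<in> carrier G \<longrightarrow> p \<in> \<rho> g"
    using maps(1) rational_map_nonempty by metis
  from choice[OF this] obtain p where "\<forall>g. g \<in> carrier G \<longrightarrow> p g \<in> \<rho> g" ..
  then have p: "p g \<in> \<rho> g" if "g \<in> carrier G" for g using that by blast
  define D where "D g = fst (p g)" for g
  define f where "f g = snd (p g)" for g
  have Df: "(D g, f g) \<in> \<rho> g" if "g \<in> carrier G" for g
    using p[OF that] by (simp add: D_def f_def)
  have reps: "(D g, f g) \<in> rational_reps X X" and cls: "\<rho> g = rational_eq X X `` {(D g, f g)}"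
    if "g \<in> carrier G" for g
    using rational_class[OF maps(1)[OF that] Df[OF that]] by auto
  have dense: "ztop X closure_of (f g ` D g) = points X" if "g \<in> carrier G" for g
    using maps(2)[OF that] Df[OF that] by (auto simp: dominant_def)
  \<comment> \<open>Multiplicativity of \<open>\<rho>\<close> holds only for classes; for each pair
    it becomes a pointwise identity, with all maps defined, on some nonempty open set.\<close>
  have "\<exists>E. openin (ztop X) E \<and> E \<noteq> {} \<and> (\<forall>x\<in>E. x \<in> D h \<and> f h x \<in> D g \<and> f g (f h x) = f (g \<otimes> h) x)"
    if gh: "g \<in> carrier G" "h \<in> carrier G" for g h
  proof -
    have "\<rho> (g \<otimes> h) = rational_comp X X (\<rho> g) (\<rho> h)"
      using hom_mult[OF \<rho> gh] by (simp add: Bir_def)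
    also have "\<dots> = rational_eq X X `` {compose_reps (D h, f h) (D g, f g)}"
      by (rule rational_comp_class[OF maps[OF gh(2)] Df[OF gh(2)] cls[OF gh(1)] reps[OF gh(1)]])
         (rule irreducible_space_axioms)
    finally have "compose_reps (D h, f h) (D g, f g) \<in> \<rho> (g \<otimes> h)"
      using rep_in_class[OF compose_reps_in_reps[OF reps[OF gh(2)] dense[OF gh(2)] reps[OF gh(1)]]] by simp
    then have "(compose_reps (D h, f h) (D g, f g), (D (g \<otimes> h), f (g \<otimes> h))) \<in> rational_eq X X"
      using same_class[OF maps(1)] Df gh by blast
    then show ?thesis unfolding compose_reps_def prod.case rational_eq_iff by (auto simp: subset_iff)
  qed
  then have "\<forall>gh. \<exists>E. gh \<in> carrier G \<times> carrier G \<longrightarrow> openin (ztop X) E \<and> E \<noteq> {} \<and>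
    (\<forall>x\<in>E. x \<in> D (snd gh) \<and> f (snd gh) x \<in> D (fst gh) \<and>
       f (fst gh) (f (snd gh) x) = f (fst gh \<otimes> snd gh) x)"
    by auto
  from choice[OF this] obtain E where "\<forall>gh. gh \<in> carrier G \<times> carrier G \<longrightarrow> openin (ztop X) (E gh) \<and> E gh \<noteq> {} \<and>
    (\<forall>x\<in>E gh. x \<in> D (snd gh) \<and> f (snd gh) x \<in> D (fst gh) \<and>
       f (fst gh) (f (snd gh) x) = f (fst gh \<otimes> snd gh) x)" ..
  then have E: "openin (ztop X) (E gh)" "E gh \<noteq> {}"
    and E': "\<And>x. x \<in> E gh \<Longrightarrow> x \<in> D (snd gh) \<and> f (snd gh) x \<in> D (fst gh) \<and>
       f (fst gh) (f (snd gh) x) = f (fst gh \<otimes> snd gh) x"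
    if "gh \<in> carrier G \<times> carrier G" for gh
    using that by blast+
  have pre: "openin (ztop X) {x \<in> D g. f g x \<in> T}" "{x \<in> D g. f g x \<in> T} \<noteq> {}"
    if "g \<in> carrier G" "openin (ztop X) T" "T \<noteq> {}" for g T
    using rational_rep_preimage[OF reps] rational_rep_dense_preimage[OF reps dense] that by auto
  \<comment> \<open>A homomorphism is only required to respect products, so the action of the unit
    has to be identified. It is generically idempotent and has a left inverse \<open>q\<close>;
    applying \<open>q\<close> to \<open>f \<one> (f \<one> x) = f \<one> x\<close> gives the
    claim.\<close>
  obtain E1 where E1: "openin (ztop X) E1" "E1 \<noteq> {}" "\<And>x. x \<in> E1 \<Longrightarrow> f \<one> x = x"
  proof -
    obtain \<Psi> where \<Psi>: "\<Psi> \<in> rational_maps X X" "rational_comp X X \<Psi> (\<rho> \<one>) = rational_of_morphism X X id"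
      using bir[OF one_closed] by (auto simp: birational_def)
    obtain V q where q: "(V, q) \<in> \<Psi>" "(V, q) \<in> rational_reps X X" by (rule rational_map_nonempty[OF \<Psi>(1)])
    have "rational_comp X X \<Psi> (\<rho> \<one>) = rational_eq X X `` {compose_reps (D \<one>, f \<one>) (V, q)}"
      by (rule rational_comp_class[OF maps[OF one_closed] Df[OF one_closed] rational_class(2)[OF \<Psi>(1) q(1)] q(2)])
         (rule irreducible_space_axioms)
    then have "compose_reps (D \<one>, f \<one>) (V, q) \<in> rational_of_morphism X X id"
      using rep_in_class[OF compose_reps_in_reps[OF reps[OF one_closed] dense[OF one_closed] q(2)]] \<Psi>(2) by simp
    then have "((points X, restrict id (points X)), compose_reps (D \<one>, f \<one>) (V, q)) \<in> rational_eq X X"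
      unfolding rational_of_morphism_def by simp
    then obtain O' where O': "openin (ztop X) O'" "O' \<noteq> {}"
      and sub: "O' \<subseteq> points X \<inter> {x \<in> D \<one>. f \<one> x \<in> V}"
      and eq: "\<forall>x\<in>O'. restrict id (points X) x = (\<lambda>x\<in>{x \<in> D \<one>. f \<one> x \<in> V}. q (f \<one> x)) x"
      unfolding compose_reps_def prod.case rational_eq_iff by blast
    have q_f: "q (f \<one> x) = x" if "x \<in> O'" for x
    proof -
      have "x \<in> points X" "x \<in> {x \<in> D \<one>. f \<one> x \<in> V}" using sub that by blast+
      then show ?thesis using eq[rule_format, OF that] by simp
    qed
    let ?E1 = "O' \<inter> (E (\<one>, \<one>) \<inter> {x \<in> D \<one>. f \<one> x \<in> O'})"
    have "E (\<one>, \<one>) \<inter> {x \<in> D \<one>. f \<one> x \<in> O'} \<noteq> {}" "openin (ztop X) (E (\<one>, \<one>) \<inter> {x \<in> D \<one>. f \<one> x \<in> O'})"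
      using E[of "(\<one>, \<one>)"] pre[OF one_closed O'(1,2)]
      by (simp_all add: irreducible_Int_nonempty[OF irreducible] openin_Int)
    then have "openin (ztop X) ?E1" "?E1 \<noteq> {}"
      by (simp_all only: irreducible_Int_nonempty[OF irreducible O'(1) _ O'(2)] openin_Int O'(1) not_False_eq_True)
    moreover have "f \<one> x = x" if "x \<in> ?E1" for x
    proof -
      have "f \<one> (f \<one> x) = f \<one> x" using E'[of "(\<one>, \<one>)" x] that by simp
      then show ?thesis using q_f[of x] q_f[of "f \<one> x"] that by auto
    qed
    ultimately show thesis using that by blast
  qed
  define B where "B = (U\<^sub>0 \<inter> E1) \<inter> (\<Inter>gh\<in>carrier G \<times> carrier G. E gh)"
  have "openin (ztop X) (U\<^sub>0 \<inter> E1)" "U\<^sub>0 \<inter> E1 \<noteq> {}"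
    using U\<^sub>0 E1 irreducible_Int_nonempty[OF irreducible] by auto
  then have B: "openin (ztop X) B \<and> B \<noteq> {}"
    unfolding B_def using E G(2) by (intro irreducible_finite_Inter[OF irreducible]) auto
  define W where "W = B \<inter> (\<Inter>g\<in>carrier G. {x \<in> D g. f g x \<in> B})"
  have W: "openin (ztop X) W \<and> W \<noteq> {}"
    unfolding W_def using B pre G(2) by (intro irreducible_finite_Inter[OF irreducible]) auto
  have "W \<subseteq> U\<^sub>0" by (auto simp: W_def B_def)
  have mult: "f g (f h x) = f (g \<otimes> h) x" if "g \<in> carrier G" "h \<in> carrier G" "x \<in> W" for g h x
    using E'[of "(g, h)" x] that by (auto simp: W_def B_def)
  have WD: "W \<subseteq> D g" if "g \<in> carrier G" for g
    using that by (auto simp: W_def)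
  have fB: "f g x \<in> B" if "g \<in> carrier G" "x \<in> W" for g x
    using that by (auto simp: W_def)
  have fD: "f g x \<in> D h" if "g \<in> carrier G" "h \<in> carrier G" "x \<in> W" for g h x
    using E'[of "(h, g)" x] that by (auto simp: W_def B_def)
  have fW: "f g x \<in> W" if "g \<in> carrier G" "x \<in> W" for g x
  proof -
    \<comment> \<open>A translate of a translate is the single translate by
      \<open>h \<otimes> g\<close>, which lies in \<open>B\<close> by the choice of
      \<open>W\<close>; this is why \<open>W\<close> is invariant although \<open>B\<close> need not
      be.\<close>
    have "f h (f g x) \<in> B" if "h \<in> carrier G" for h
      using mult[OF that \<open>g \<in> carrier G\<close> \<open>x \<in> W\<close>] fB[OF m_closed[OF that \<open>g \<in> carrier G\<close>] \<open>x \<in> W\<close>] by simp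
    then have "f g x \<in> B \<inter> (\<Inter>h\<in>carrier G. {y \<in> D h. f h y \<in> B})"
      using fB[OF that] fD[OF \<open>g \<in> carrier G\<close> _ \<open>x \<in> W\<close>] by blast
    then show ?thesis unfolding W_def .
  qed
  have fr: "(W, restrict (f g) W) \<in> \<rho> g" if "g \<in> carrier G" for g
    using rational_eq_restrict[OF reps[OF that] _ _ WD[OF that]] W cls[OF that] by auto
  have f1: "f \<one> x = x" if "x \<in> W" for x
    using E1(3)[of x] that by (auto simp: W_def B_def)
  show ?thesis
    by (intro exI[of _ W] exI[of _ f] conjI ballI)
       (simp_all add: W \<open>W \<subseteq> U\<^sub>0\<close> fr f1 fW mult del: restrict_apply)
qed

end

section \<open>Regular functions on a chart\<close>

text \<open>Total functions rather than extensional ones, so that \<open>W\<close> and this set fit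
  the convention of \<open>function_domain\<close>.\<close>

definition regular_on :: "('a, 'k) fspace \<Rightarrow> 'a set \<Rightarrow> ('a \<Rightarrow> 'k) set" where
  "regular_on X W = {a. restrict a W \<in> sections X W}"

lemma regular_on_cong: "a \<in> regular_on X W \<Longrightarrow> (\<And>x. x \<in> W \<Longrightarrow> a x = b x) \<Longrightarrow> b \<in> regular_on X W"
  by (simp add: regular_on_def cong: restrict_cong)

lemma subalg_regular_on:
  assumes "sheaf_of_functions X" "openin (ztop X) W"
  shows "subalg (regular_on X W)"
  unfolding subalg_def
proof (intro conjI allI ballI)
  show "(\<lambda>x. c) \<in> regular_on X W" for c
    using sheaf_const[OF assms] by (simp add: regular_on_def)
  fix f g assume fg: "f \<in> regular_on X W" "g \<in> regular_on X W"
  have "(\<lambda>x\<in>W. restrict f W x + restrict g W x) \<in> sections X W" "(\<lambda>x\<in>W. restrict f W x * restrict g W x) \<in> sections X W"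
    using fg by (auto simp only: regular_on_def mem_Collect_eq intro!: sheaf_add[OF assms] sheaf_mult[OF assms])
  moreover have "(\<lambda>x\<in>W. restrict f W x + restrict g W x) = (\<lambda>x\<in>W. f x + g x)"
    "(\<lambda>x\<in>W. restrict f W x * restrict g W x) = (\<lambda>x\<in>W. f x * g x)"
    by (auto intro!: restrict_ext)
  ultimately show "(\<lambda>x. f x + g x) \<in> regular_on X W" "(\<lambda>x. f x * g x) \<in> regular_on X W"
    by (simp_all add: regular_on_def)
qed

lemma regular_on_restrict:
  assumes "sheaf_of_functions X" "openin (ztop X) U" "openin (ztop X) W" "W \<subseteq> U"
  shows "regular_on X U \<subseteq> regular_on X W"
proof
  fix a assume "a \<in> regular_on X U"
  then have "restrict a U \<in> sections X U" by (simp add: regular_on_def)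
  from sheaf_restrict[OF assms(1,2) this assms(3,4)]
  have "restrict (restrict a U) W \<in> sections X W" .
  moreover have "restrict (restrict a U) W = restrict a W"
    by (rule restrict_ext) (use assms(4) in auto)
  ultimately show "a \<in> regular_on X W" by (simp only: regular_on_def mem_Collect_eq)
qed

locale chart = irreducible_space X
  for X :: "('a, 'k::{alg_closed_field, field_char_0}) fspace" +
  fixes U :: "'a set" and N :: nat and V :: "'k vec set" and \<phi> \<psi>
  assumes U: "openin (ztop X) U" "U \<noteq> {}" and V: "algebraic_set N V"
    and \<phi>: "morphism (open_subspace X U) (affine_variety N V) \<phi>"
    and \<psi>: "morphism (affine_variety N V) (open_subspace X U) \<psi>"
    and \<psi>\<phi>: "x \<in> U \<Longrightarrow> \<psi> (\<phi> x) = x" and \<phi>\<psi>: "v \<in> V \<Longrightarrow> \<phi> (\<psi> v) = v"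
begin

lemma V_carrier: "V \<subseteq> carrier_vec N"
  using algebraic_set_subset[OF V] .

lemma regular_chart: "regular_space (open_subspace X U)"
  by (rule regular_space_iso[OF sheaf_open_subspace[OF sheaf U(1)] regular_affine[OF V_carrier] \<phi> \<psi>])
     (simp add: points_open_subspace[OF U(1)] \<psi>\<phi>)

lemma regular_subchart:
  assumes "openin (ztop X) W" "W \<subseteq> U"
  shows "regular_space (open_subspace X W)"
  using regular_open_subspace[OF regular_chart, of W] assms U(1)
  by (simp add: open_subspace_twice openin_open_subtopology)

lemma \<phi>_in: "x \<in> U \<Longrightarrow> \<phi> x \<in> V"
  using morphism_point[OF \<phi>, of x] by (simp only: points_open_subspace[OF U(1)] points_affine[OF V_carrier])

lemma \<psi>_in: "v \<in> V \<Longrightarrow> \<psi> v \<in> U"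
  using morphism_point[OF \<psi>, of v] V_carrier by (auto simp: points_open_subspace[OF U(1)])

lemma polynomial_regular:
  assumes "P \<in> polynomial_functions N" "openin (ztop X) W" "W \<subseteq> U"
  shows "(\<lambda>x. P (\<phi> x)) \<in> regular_on X W"
proof -
  have o: "openin (subtopology (zariski N) V) V"
    using openin_topspace[of "subtopology (zariski N) V"] V_carrier by (simp add: Int_absorb1)
  have eq: "{x \<in> points (open_subspace X U). \<phi> x \<in> V} = U"
    using \<phi>_in by (auto simp only: points_open_subspace[OF U(1)])
  have "(\<lambda>x\<in>U. restrict P V (\<phi> x)) \<in> sections X U"
    using morphism_pullback[OF \<phi> _ section_affine_polynomial[OF assms(1) o]] o
    unfolding eq ztop_affine sections_open_subspace by blast
  moreover have "(\<lambda>x\<in>U. restrict P V (\<phi> x)) = (\<lambda>x\<in>U. P (\<phi> x))"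
    by (rule restrict_ext) (simp add: \<phi>_in)
  ultimately have "(\<lambda>x. P (\<phi> x)) \<in> regular_on X U" by (simp add: regular_on_def)
  then show ?thesis using regular_on_restrict[OF sheaf U(1) assms(2,3)] by blast
qed

lemma regular_nonzero:
  assumes "openin (ztop X) W" "W \<subseteq> U" "a \<in> regular_on X W"
  shows "openin (ztop X) {x \<in> W. a x \<noteq> 0}"
proof -
  have o: "openin (ztop (open_subspace X W)) W" using openin_open_subspace[OF assms(1)] assms(1) by simp
  have "restrict a W \<in> sections (open_subspace X W) W" using assms(3) by (simp add: regular_on_def)
  from regular_space_nonzero[OF regular_subchart[OF assms(1,2)] o this]
  have "openin (ztop (open_subspace X W)) {x \<in> W. restrict a W x \<noteq> 0}" .
  moreover have "{x \<in> W. restrict a W x \<noteq> 0} = {x \<in> W. a x \<noteq> 0}" by auto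
  ultimately show ?thesis using openin_open_subspace[OF assms(1)] by simp
qed

text \<open>Nonvanishing loci of regular functions are open on a chart, and two nonempty ones
  meet.\<close>

lemma regular_function_domain:
  assumes W: "openin (ztop X) W" "W \<noteq> {}" "W \<subseteq> U"
  shows "function_domain W (regular_on X W)"
proof
  show "subalg (regular_on X W)" by (rule subalg_regular_on[OF sheaf W(1)])
  show "W \<noteq> {}" by fact
  fix f g assume f: "f \<in> regular_on X W" and g: "g \<in> regular_on X W" and fg: "\<forall>x\<in>W. f x * g x = 0"
  show "(\<forall>x\<in>W. f x = 0) \<or> (\<forall>x\<in>W. g x = 0)"
  proof (rule ccontr)
    assume "\<not> ?thesis"
    then have "{x \<in> W. f x \<noteq> 0} \<noteq> {}" "{x \<in> W. g x \<noteq> 0} \<noteq> {}" by auto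
    then have "{x \<in> W. f x \<noteq> 0} \<inter> {x \<in> W. g x \<noteq> 0} \<noteq> {}"
      by (intro irreducible_Int_nonempty[OF irreducible] regular_nonzero W f g)
    then show False using fg by auto
  qed
qed

text \<open>A relation that fails somewhere on \<open>U\<close> fails on a nonempty open set, which
  meets \<open>W\<close>. Hence a relation on \<open>W\<close> holds on \<open>U\<close>, and
  through the chart on \<open>V\<close>.\<close>

lemma indep_open:
  assumes a: "\<And>i. i < m \<Longrightarrow> a i \<in> polynomial_functions N" and "indep V {..<m} a"
    and W: "openin (ztop X) W" "W \<noteq> {}" "W \<subseteq> U"
  shows "indep W {..<m} (\<lambda>i x. a i (\<phi> x))"
  unfolding indep_def
proof (intro ballI impI allI)
  fix P and v :: "nat \<Rightarrow> 'k"
  assume P: "P \<in> poly_funs {..<m}" and zero: "\<forall>x\<in>W. P (\<lambda>i. a i (\<phi> x)) = 0"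
  have "(\<lambda>v. P (\<lambda>i. a i v)) \<in> polynomial_functions N"
    by (rule poly_funs_subst[OF P subalg_polynomial_functions]) (simp add: a)
  from polynomial_regular[OF this U(1) subset_refl]
  have reg: "openin (ztop X) {x \<in> U. P (\<lambda>i. a i (\<phi> x)) \<noteq> 0}"
    by (rule regular_nonzero[OF U(1) subset_refl])
  have "P (\<lambda>i. a i (\<phi> x)) = 0" if "x \<in> U" for x
  proof (rule ccontr)
    assume "P (\<lambda>i. a i (\<phi> x)) \<noteq> 0"
    then have "{x \<in> U. P (\<lambda>i. a i (\<phi> x)) \<noteq> 0} \<noteq> {}" using that by blast
    then have "{x \<in> U. P (\<lambda>i. a i (\<phi> x)) \<noteq> 0} \<inter> W \<noteq> {}"
      by (intro irreducible_Int_nonempty[OF irreducible] reg W)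
    then show False using zero by blast
  qed
  then have "P (\<lambda>i. a i w) = 0" if "w \<in> V" for w
    using \<psi>_in[OF that] \<phi>\<psi>[OF that] by metis
  then show "P v = 0" using indepD[OF assms(2) P] by blast
qed

text \<open>The chain is cut down to the chart. Since its smallest member meets \<open>U\<close>,
  every member does, and the trace on \<open>U\<close> is a nonempty open part of an irreducible
  set: it stays irreducible and still determines the member, so inclusions stay strict.\<close>

lemma chart_chain:
  assumes Z: "\<And>i. i \<le> m \<Longrightarrow> closedin (ztop X) (Z i) \<and> irreducible_topology (subtopology (ztop X) (Z i))"
    "\<And>i. i < m \<Longrightarrow> Z i \<subset> Z (Suc i)" and "Z 0 \<inter> U \<noteq> {}"
  shows "\<exists>a. (\<forall>i<m. a i \<in> polynomial_functions N) \<and> indep V {..<m} a"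
proof -
  define Y where "Y i = {v \<in> V. \<psi> v \<in> Z i}" for i
  have Zsub: "Z i \<subseteq> points X" if "i \<le> m" for i using Z(1)[OF that] closedin_subset by blast
  have topZ: "topspace (subtopology (ztop X) (Z i)) = Z i" if "i \<le> m" for i
    using Zsub[OF that] by auto
  have "Z 0 \<subseteq> Z i" if "i \<le> m" for i using that
  proof (induction i)
    case (Suc i)
    then show ?case using Z(2)[of i] by auto
  qed simp
  then have ZU: "Z i \<inter> U \<noteq> {}" if "i \<le> m" for i using assms(3) that by blast
  \<comment> \<open>Adding the complement of \<open>U\<close> to both closed sets turns a covering
    of the trace into a covering of \<open>Z i\<close>.\<close>
  have split: "Z i \<inter> U \<subseteq> A \<or> Z i \<inter> U \<subseteq> B"
    if "i \<le> m" "closedin (ztop X) A" "closedin (ztop X) B" "Z i \<inter> U \<subseteq> A \<union> B" for i A B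
  proof -
    let ?T = "subtopology (ztop X) (Z i)"
    have cl: "closedin ?T (Z i \<inter> (C \<union> (points X - U)))" if "closedin (ztop X) C" for C
      using that U(1) closedin_subtopology[of "ztop X" "Z i"]
      by (metis closedin_Un closedin_diff closedin_topspace inf_commute)
    have "Z i \<inter> (A \<union> (points X - U)) \<union> Z i \<inter> (B \<union> (points X - U)) = topspace ?T"
      using that(4) Zsub[OF that(1)] topZ[OF that(1)] by auto
    then have "Z i \<inter> (A \<union> (points X - U)) = Z i \<or> Z i \<inter> (B \<union> (points X - U)) = Z i"
      using Z(1)[OF that(1)] cl[OF that(2)] cl[OF that(3)] topZ[OF that(1)]
      unfolding irreducible_topology_def by metis
    then show ?thesis by blast
  qed
  have clY: "closedin (subtopology (zariski N) V) (Y i)" if "i \<le> m" for i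
  proof -
    have "closedin (ztop (open_subspace X U)) (U \<inter> Z i)"
      using Z(1)[OF that] by (auto simp: closedin_subtopology)
    then have "closedin (ztop (affine_variety N V)) {v \<in> points (affine_variety N V). \<psi> v \<in> U \<inter> Z i}"
      using continuous_map_closedin[THEN iffD1, OF morphism_continuous[OF \<psi>]] by blast
    moreover have "{v \<in> points (affine_variety N V). \<psi> v \<in> U \<inter> Z i} = Y i"
      using V_carrier \<psi>_in by (auto simp: Y_def)
    ultimately show ?thesis by simp
  qed
  have clV: "closedin (zariski N) V" using V closedin_zariski by blast
  have alg: "algebraic_set N (Y i)" if "i \<le> m" for i
    using closedin_trans_full[OF clY[OF that] clV] closedin_zariski by blast
  have irr: "irreducible_topology (subtopology (zariski N) (Y i))" if i: "i \<le> m" for i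
  proof -
    let ?T = "subtopology (zariski N) (Y i)"
    have YV: "Y i \<subseteq> V" by (auto simp: Y_def)
    have topY: "topspace ?T = Y i" using YV V_carrier by auto
    obtain x where "x \<in> Z i" "x \<in> U" using ZU[OF i] by blast
    then have "\<phi> x \<in> Y i" using \<phi>_in \<psi>\<phi> by (simp add: Y_def)
    moreover have "A = Y i \<or> B = Y i" if A: "closedin ?T A" and B: "closedin ?T B" and AB: "A \<union> B = Y i" for A B
    proof -
      have pull: "\<exists>A'. closedin (ztop X) A' \<and> {x \<in> U. \<phi> x \<in> A} = U \<inter> A'" if A: "closedin ?T A" for A
      proof -
        have "closedin (zariski N) A"
          using closedin_trans_full[OF A] alg[OF i] closedin_zariski by blast
        moreover have "A \<subseteq> V" using closedin_subset[OF A] YV unfolding topY by (rule subset_trans)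
        ultimately have "closedin (ztop (affine_variety N V)) A"
          using closedin_subset_topspace by (simp add: closedin_subset_topspace)
        then have "closedin (ztop (open_subspace X U)) {x \<in> points (open_subspace X U). \<phi> x \<in> A}"
          using continuous_map_closedin[THEN iffD1, OF morphism_continuous[OF \<phi>]] by blast
        then show ?thesis unfolding points_open_subspace[OF U(1)]
          by (auto simp: closedin_subtopology)
      qed
      obtain A' where A': "closedin (ztop X) A'" "{x \<in> U. \<phi> x \<in> A} = U \<inter> A'" using pull[OF A] by blast
      obtain B' where B': "closedin (ztop X) B'" "{x \<in> U. \<phi> x \<in> B} = U \<inter> B'" using pull[OF B] by blast
      have "Z i \<inter> U \<subseteq> A' \<union> B'"
      proof
        fix x assume x: "x \<in> Z i \<inter> U"
        then have "\<phi> x \<in> Y i" using \<phi>_in \<psi>\<phi> by (simp add: Y_def)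
        then show "x \<in> A' \<union> B'" using AB A'(2) B'(2) x by blast
      qed
      from split[OF i A'(1) B'(1) this]
      have "Z i \<inter> U \<subseteq> A' \<or> Z i \<inter> U \<subseteq> B'" .
      moreover have "Y i \<subseteq> C" if "Z i \<inter> U \<subseteq> C'" "{x \<in> U. \<phi> x \<in> C} = U \<inter> C'" for C C'
      proof
        fix v assume v: "v \<in> Y i"
        then have "\<psi> v \<in> U \<inter> C'" using \<psi>_in that(1) by (auto simp: Y_def)
        then have "\<phi> (\<psi> v) \<in> C" using that(2) by blast
        then show "v \<in> C" using v \<phi>\<psi> by (simp add: Y_def)
      qed
      ultimately have "Y i \<subseteq> A \<or> Y i \<subseteq> B" using A'(2) B'(2) by blast
      then show ?thesis using AB by blast
    qed
    ultimately show ?thesis unfolding irreducible_topology_def topY by blast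
  qed
  \<comment> \<open>If two traces agreed, \<open>Z (Suc i)\<close> would be the union of
    \<open>Z i\<close> and its part outside \<open>U\<close>; the first is too small, and the second
    misses the points in \<open>U\<close>.\<close>
  have strict: "Y i \<subset> Y (Suc i)" if i: "i < m" for i
  proof
    show "Y i \<subseteq> Y (Suc i)" using Z(2)[OF i] by (auto simp: Y_def)
    show "Y i \<noteq> Y (Suc i)"
    proof
      assume eq: "Y i = Y (Suc i)"
      have sub: "Z (Suc i) \<inter> U \<subseteq> Z i"
      proof
        fix x assume x: "x \<in> Z (Suc i) \<inter> U"
        then have "\<phi> x \<in> Y (Suc i)" using \<phi>_in \<psi>\<phi> by (simp add: Y_def)
        then have "\<phi> x \<in> Y i" using eq by blast
        then show "x \<in> Z i" using x \<psi>\<phi> by (simp add: Y_def)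
      qed
      let ?T = "subtopology (ztop X) (Z (Suc i))"
      have le: "i \<le> m" "Suc i \<le> m" using i by auto
      have "closedin ?T (Z i)"
        using Z(1)[OF le(1)] Z(2)[OF i] closedin_subset_topspace by blast
      moreover have "closedin ?T (Z (Suc i) \<inter> (points X - U))"
        using U(1) by (metis closedin_subtopology closedin_diff closedin_topspace inf_commute)
      moreover have "Z i \<union> Z (Suc i) \<inter> (points X - U) = topspace ?T"
        using sub Z(2)[OF i] Zsub[OF le(2)] topZ[OF le(2)] by auto
      ultimately have "Z i = Z (Suc i) \<or> Z (Suc i) \<inter> (points X - U) = Z (Suc i)"
        using Z(1)[OF le(2)] topZ[OF le(2)] unfolding irreducible_topology_def by metis
      then show False using Z(2)[OF i] ZU[OF le(2)] by blast
    qed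
  qed
  obtain a where "\<forall>i<m. a i \<in> polynomial_functions N" "indep (Y m) {..<m} a"
    using chain_indep[of m N Y] alg irr strict by blast
  moreover have "Y m \<subseteq> V" by (auto simp: Y_def)
  ultimately show ?thesis using indep_mono[of "Y m" "{..<m}" a V "{..<m}"] by blast
qed

end

section \<open>Equivariant maps to affine space\<close>

lemma polynomial_function_vec:
  assumes "P \<in> polynomial_functions m"
  shows "(\<lambda>u. P (vec m u)) \<in> poly_funs {..<m}"
  using assms
proof induction
  case (coord i)
  then show ?case using poly_funs_coord[of i "{..<m}"] by simp
qed (auto intro: subalg_const subalg_add subalg_mult subalg_poly_funs)

context chart
begin

lemma vec_map_rep:
  assumes W: "openin (ztop X) W" "W \<noteq> {}" "W \<subseteq> U" and H: "\<And>i. i < m \<Longrightarrow> H i \<in> regular_on X W"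
  shows "(W, \<lambda>x\<in>W. vec m (\<lambda>i. H i x)) \<in> rational_reps X (affine_space m)"
proof -
  have "morphism (open_subspace X W) (affine_space m) (\<lambda>x\<in>W. vec m (\<lambda>i. H i x))"
  proof (rule morphism_affine_spaceI[OF regular_subchart[OF W(1,3)]], unfold points_open_subspace[OF W(1)])
    fix i assume i: "i < m"
    have "(\<lambda>x\<in>W. (\<lambda>x\<in>W. vec m (\<lambda>i. H i x)) x $ i) = restrict (H i) W"
      by (rule restrict_ext) (simp add: i)
    then show "(\<lambda>x\<in>W. (\<lambda>x\<in>W. vec m (\<lambda>i. H i x)) x $ i) \<in> sections (open_subspace X W) W"
      using H[OF i] by (simp add: regular_on_def)
  qed simp
  then show ?thesis using W by (simp add: rational_reps_iff)
qed

text \<open>Independence is dominance: a nonempty open set contains the nonvanishing locus of a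
  polynomial that is nonzero somewhere, and such a polynomial cannot vanish on all of the
  image.\<close>

lemma vec_map_dense:
  fixes H :: "nat \<Rightarrow> 'a \<Rightarrow> 'k"
  assumes "indep W {..<m} H"
  shows "ztop (affine_space m) closure_of ((\<lambda>x\<in>W. vec m (\<lambda>i. H i x)) ` W) = points (affine_space m)"
  unfolding dense_intersects_open
proof (intro allI impI)
  fix T :: "'k vec set" assume T: "openin (ztop (affine_space m)) T \<and> T \<noteq> {}"
  then obtain v where v: "v \<in> T" by blast
  have oT: "openin (zariski m) T" using T by simp
  have vc: "v \<in> carrier_vec m" using openin_subset[OF oT] v by auto
  obtain P where P: "P \<in> polynomial_functions m" "P v \<noteq> 0" "\<And>u. u \<in> carrier_vec m \<Longrightarrow> P u \<noteq> 0 \<Longrightarrow> u \<in> T"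
    by (rule openin_zariski_nonzero[OF oT v]) blast
  have "vec m (\<lambda>i. v $ i) = v" using vc by (auto intro!: eq_vecI)
  then have "\<exists>x\<in>W. P (vec m (\<lambda>i. H i x)) \<noteq> 0"
    using indepD[OF assms polynomial_function_vec[OF P(1)], of "\<lambda>i. v $ i"] P(2) by metis
  then show "(\<lambda>x\<in>W. vec m (\<lambda>i. H i x)) ` W \<inter> T \<noteq> {}"
    using P(3) by fastforce
qed

text \<open>A rational inverse \<open>q\<close> would give \<open>u $ 0 = g (q u) ^ n\<close>
  generically. Near a suitable point \<open>g (q u)\<close> is a quotient of polynomials, which
  \<open>coordinate_no_root\<close> excludes.\<close>

lemma vec_map_not_birational:
  assumes "m > 0" and W: "openin (ztop X) W" "W \<noteq> {}" "W \<subseteq> U" and H: "\<And>i. i < m \<Longrightarrow> H i \<in> regular_on X W"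
    and g: "g \<in> regular_on X W" "\<And>x. x \<in> W \<Longrightarrow> H 0 x = g x ^ n" "n > 1"
  shows "\<not> birational X (affine_space m) (rational_eq X (affine_space m) `` {(W, \<lambda>x\<in>W. vec m (\<lambda>i. H i x))})"
proof
  let ?A = "affine_space m :: ('k vec, 'k) fspace"
  let ?F = "\<lambda>x\<in>W. vec m (\<lambda>i. H i x)"
  let ?\<Phi> = "rational_eq X ?A `` {(W, ?F)}"
  interpret A: irreducible_space ?A by (rule irreducible_space_affine_space)
  assume "birational X ?A ?\<Phi>"
  then obtain \<Psi> where \<Psi>: "\<Psi> \<in> rational_maps ?A X" "dominant ?A X \<Psi>"
    "rational_comp ?A ?A ?\<Phi> \<Psi> = rational_of_morphism ?A ?A id"
    unfolding birational_def by blast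
  obtain V' q where q: "(V', q) \<in> \<Psi>" "(V', q) \<in> rational_reps ?A X" by (rule A.rational_map_nonempty[OF \<Psi>(1)])
  have F: "(W, ?F) \<in> rational_reps X ?A" by (rule vec_map_rep[OF W H])
  have dense: "ztop X closure_of (q ` V') = points X"
    using \<Psi>(2) q(1) by (auto simp: dominant_def)
  have "rational_comp ?A ?A ?\<Phi> \<Psi> = rational_eq ?A ?A `` {compose_reps (V', q) (W, ?F)}"
    by (rule A.rational_comp_class[OF \<Psi>(1,2) q(1) refl F]) (rule irreducible_space_axioms)
  then have "compose_reps (V', q) (W, ?F) \<in> rational_of_morphism ?A ?A id"
    using A.rep_in_class[OF A.compose_reps_in_reps[OF q(2) dense F]] \<Psi>(3) by simp
  then have "((points ?A, restrict id (points ?A)), compose_reps (V', q) (W, ?F)) \<in> rational_eq ?A ?A"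
    unfolding rational_of_morphism_def by simp
  then obtain T where T: "openin (ztop ?A) T" "T \<noteq> {}"
    and sub: "T \<subseteq> points ?A \<inter> {y \<in> V'. q y \<in> W}"
    and eq: "\<forall>y\<in>T. restrict id (points ?A) y = (\<lambda>y\<in>{y \<in> V'. q y \<in> W}. ?F (q y)) y"
    unfolding compose_reps_def prod.case rational_eq_iff by blast
  have Fq: "?F (q y) = y" "q y \<in> W" if "y \<in> T" for y
  proof -
    have "y \<in> points ?A" "y \<in> {y \<in> V'. q y \<in> W}" using sub that by blast+
    then show "?F (q y) = y" "q y \<in> W" using eq[rule_format, OF that] by simp_all
  qed
  have V': "openin (ztop ?A) V'" "morphism (open_subspace ?A V') X q"
    using q(2) by (auto simp: rational_reps_iff)
  let ?S = "{y \<in> V'. q y \<in> W}"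
  have "restrict g W \<in> sections X W" using g(1) by (simp add: regular_on_def)
  from morphism_pullback[OF V'(2) W(1) this]
  have sec: "(\<lambda>y\<in>?S. restrict g W (q y)) \<in> sections ?A ?S"
    unfolding points_open_subspace[OF V'(1)] sections_open_subspace .
  obtain y where y: "y \<in> T" using T(2) by blast
  then have "y \<in> ?S" using sub by blast
  obtain R P Q where R: "openin (subtopology (zariski m) (carrier_vec m)) R" "y \<in> R" "R \<subseteq> ?S"
    "P \<in> polynomial_functions m" "Q \<in> polynomial_functions m"
    "\<forall>u\<in>R. Q u \<noteq> 0 \<and> (\<lambda>y\<in>?S. restrict g W (q y)) u = P u / Q u"
    by (rule section_affineE[OF sec \<open>y \<in> ?S\<close>])
  show False
  proof (rule coordinate_no_root[OF assms(1) g(3) _ _ R(4,5)])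
    show "openin (zariski m) (R \<inter> T)" using R(1) T(1) by (intro openin_Int) simp_all
    show "R \<inter> T \<noteq> {}" using y R(2) by blast
    fix u assume u: "u \<in> R \<inter> T"
    then have uR: "u \<in> R" and uT: "u \<in> T" and uS: "u \<in> ?S" using R(3) by blast+
    show "Q u \<noteq> 0" using R(6) uR by blast
    have "P u / Q u = g (q u)" using R(6)[rule_format, OF uR] uS Fq(2)[OF uT] by simp
    then have "(P u / Q u) ^ n = H 0 (q u)" using g(2)[OF Fq(2)[OF uT]] by simp
    also have "\<dots> = ?F (q u) $ 0" using Fq(2)[OF uT] assms(1) by simp
    also have "\<dots> = u $ 0" using Fq(1)[OF uT] by simp
    finally show "(P u / Q u) ^ n = u $ 0" .
  qed
qed

end

text \<open>If all chains were shorter than \<open>m\<close>, the supremum would be at most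
  \<open>m - 1\<close>. Otherwise the initial segment of a longer chain will do.\<close>

lemma dimension_chain:
  assumes "enat m \<le> dimension X" "m > 0"
  shows "\<exists>Z. (\<forall>i\<le>m. closedin (ztop X) (Z i) \<and> irreducible_topology (subtopology (ztop X) (Z i))) \<and>
    (\<forall>i<m. Z i \<subset> Z (Suc i))"
proof -
  let ?C = "\<lambda>n Z. (\<forall>i\<le>n. closedin (ztop X) (Z i) \<and> irreducible_topology (subtopology (ztop X) (Z i))) \<and>
    (\<forall>i<n. Z i \<subset> Z (Suc i))"
  have "\<exists>n\<ge>m. \<exists>Z. ?C n Z"
  proof (rule ccontr)
    assume no: "\<not> ?thesis"
    have "dimension X \<le> enat (m - 1)"
      unfolding dimension_def krull_dim_def
    proof (rule Sup_least)
      fix e assume "e \<in> {enat n | n. \<exists>Z. ?C n Z}"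
      then obtain n where n: "e = enat n" "\<exists>Z. ?C n Z" by blast
      then have "n < m" using no not_le by blast
      then show "e \<le> enat (m - 1)" using n(1) by simp
    qed
    then have "enat m \<le> enat (m - 1)" using assms(1) by (rule order_trans[rotated])
    then show False using assms(2) by simp
  qed
  then obtain n Z where "n \<ge> m" "?C n Z" by blast
  then show ?thesis by (intro exI[of _ Z]) auto
qed

lemma chart_exists:
  fixes X :: "('a, 'k::{alg_closed_field, field_char_0}) fspace"
  assumes X: "irreducible_variety X" and x: "x \<in> points X"
  shows "\<exists>U N V \<phi> \<psi>. x \<in> U \<and> chart X U N V \<phi> \<psi>"
proof -
  interpret irreducible_space X by (rule irreducible_variety_space[OF X])
  obtain \<U> where \<U>: "\<Union>\<U> = points X" "\<forall>U\<in>\<U>. openin (ztop X) U \<and>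
     (\<exists>N V. algebraic_set N V \<and> isomorphic_fspaces (open_subspace X U) (affine_variety N V))"
    using X unfolding irreducible_variety_def variety_def prevariety_def by blast
  obtain U where U: "U \<in> \<U>" "x \<in> U" using x \<U>(1) by blast
  then have oU: "openin (ztop X) U" using \<U>(2) by blast
  obtain N V where V: "algebraic_set N V" "isomorphic_fspaces (open_subspace X U) (affine_variety N V)"
    using \<U>(2) U(1) by blast
  obtain \<phi> \<psi> where *: "morphism (open_subspace X U) (affine_variety N V) \<phi>"
    "morphism (affine_variety N V) (open_subspace X U) \<psi>"
    "\<forall>x\<in>points (open_subspace X U). \<psi> (\<phi> x) = x" "\<forall>y\<in>points (affine_variety N V). \<phi> (\<psi> y) = y"
    using V(2) unfolding isomorphic_fspaces_def by blast
  have "chart X U N V \<phi> \<psi>"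
  proof
    show "\<psi> (\<phi> x) = x" if "x \<in> U" for x using *(3) that unfolding points_open_subspace[OF oU] by blast
    show "\<phi> (\<psi> v) = v" if "v \<in> V" for v
      using *(4) that unfolding points_affine[OF algebraic_set_subset[OF V(1)]] by blast
  qed (use oU U V(1) * in auto)
  then show ?thesis using U(2) by blast
qed

theorem theorem2p14:
  fixes n m d :: nat
    and G :: "('g, 'r) monoid_scheme"
    and X :: "('a, 'k::{alg_closed_field, field_char_0}) fspace"
    and \<rho> :: "'g \<Rightarrow> ('a, 'a) partial_map set"
  assumes "n > 0" and "m > 0" and "d > 0" and "n \<ge> m"
    and "group G" and "cyclic_group G" and "Coset.order G = d"
    and "irreducible_variety X" and "dimension X = enat n"
    and "rational_action G X \<rho>"
  shows "\<exists>\<Lambda> :: 'g \<Rightarrow> 'k mat.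
    \<Lambda> \<in> hom G (GL m) \<and> inj_on \<Lambda> (carrier G) \<and> \<Lambda> ` carrier G = T_group m d \<and>
    nontrivial_base_change G X \<rho> (affine_space m) (linear_rational_action m \<Lambda>)"
proof -
  interpret group G by fact
  obtain \<gamma> where \<gamma>: "\<gamma> \<in> carrier G" and ord: "\<And>n::nat. \<gamma> [^]\<^bsub>G\<^esub> n = \<one>\<^bsub>G\<^esub> \<longleftrightarrow> d dvd n"
    and carrier: "carrier G = (\<lambda>i::nat. \<gamma> [^]\<^bsub>G\<^esub> i) ` {..<d}"
    using cyclic_generator[OF assms(5,6,7,3)] by blast
  have fin: "finite (carrier G)" unfolding carrier by simp
  obtain z :: 'k where z: "\<And>n. z ^ n = 1 \<longleftrightarrow> d dvd n"
    using primitive_root_exists[OF assms(3)] by blast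
  have z0: "z \<noteq> 0" using z[of d] assms(3) by (auto simp: power_0_left)
  have \<rho>: "\<rho> \<in> hom G (Bir X)" "inj_on \<rho> (carrier G)"
    using assms(10) by (auto simp: rational_action_def)

  \<comment> \<open>The generator and \<open>z\<close> have the same exact order, so their powers
    coincide for the same exponents. This makes the character below independent of the chosen
    exponent and injective.\<close>
  have pow_iff: "\<gamma> [^]\<^bsub>G\<^esub> i = \<gamma> [^]\<^bsub>G\<^esub> j \<longleftrightarrow> z ^ i = z ^ j" for i j :: nat
  proof -
    have "\<gamma> [^]\<^bsub>G\<^esub> i = \<gamma> [^]\<^bsub>G\<^esub> j \<longleftrightarrow> z ^ i = z ^ j" if "i \<le> j" for i j :: nat
    proof -
      have j: "j = i + (j - i)" using that by simp
      have "\<gamma> [^]\<^bsub>G\<^esub> j = \<gamma> [^]\<^bsub>G\<^esub> i \<otimes>\<^bsub>G\<^esub> \<gamma> [^]\<^bsub>G\<^esub> (j - i)"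
        using nat_pow_mult[OF \<gamma>, of i "j - i"] j by simp
      then have "\<gamma> [^]\<^bsub>G\<^esub> i = \<gamma> [^]\<^bsub>G\<^esub> j \<longleftrightarrow> \<gamma> [^]\<^bsub>G\<^esub> (j - i) = \<one>\<^bsub>G\<^esub>"
        using \<gamma> Units_l_cancel[of "\<gamma> [^]\<^bsub>G\<^esub> i" "\<one>\<^bsub>G\<^esub>" "\<gamma> [^]\<^bsub>G\<^esub> (j - i)"] by auto
      moreover have "z ^ j = z ^ i * z ^ (j - i)" using j by (metis power_add)
      then have "z ^ i = z ^ j \<longleftrightarrow> z ^ (j - i) = 1" using z0 by auto
      ultimately show ?thesis using ord z by simp
    qed
    then show ?thesis by (metis nat_le_linear)
  qed
  \<comment> \<open>\<open>inv_into\<close> merely picks some exponent of \<open>g\<close> with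
    respect to the generator.\<close>
  define \<chi> where "\<chi> g = z ^ inv_into {..<d} (\<lambda>i::nat. \<gamma> [^]\<^bsub>G\<^esub> i) g" for g
  have in_carrier: "\<exists>i. g = \<gamma> [^]\<^bsub>G\<^esub> (i::nat)" if "g \<in> carrier G" for g
    using that carrier by blast
  have \<chi>_pow: "\<chi> (\<gamma> [^]\<^bsub>G\<^esub> i) = z ^ i" for i :: nat
  proof -
    have "\<gamma> [^]\<^bsub>G\<^esub> i \<in> (\<lambda>i::nat. \<gamma> [^]\<^bsub>G\<^esub> i) ` {..<d}"
      using nat_pow_closed[OF \<gamma>] carrier by simp
    then have "\<gamma> [^]\<^bsub>G\<^esub> inv_into {..<d} (\<lambda>i::nat. \<gamma> [^]\<^bsub>G\<^esub> i) (\<gamma> [^]\<^bsub>G\<^esub> i) = \<gamma> [^]\<^bsub>G\<^esub> i"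
      by (rule f_inv_into_f)
    then show ?thesis unfolding \<chi>_def using pow_iff by blast
  qed
  have \<chi>_mult: "\<chi> (g \<otimes>\<^bsub>G\<^esub> h) = \<chi> g * \<chi> h" if gh: "g \<in> carrier G" "h \<in> carrier G" for g h
  proof -
    obtain i j :: nat where ij: "g = \<gamma> [^]\<^bsub>G\<^esub> i" "h = \<gamma> [^]\<^bsub>G\<^esub> j" using in_carrier gh by blast
    then have "g \<otimes>\<^bsub>G\<^esub> h = \<gamma> [^]\<^bsub>G\<^esub> (i + j)" using nat_pow_mult[OF \<gamma>] by simp
    then show ?thesis using ij \<chi>_pow by (simp add: power_add)
  qed
  have \<chi>_nz: "\<chi> g \<noteq> 0" for g using z0 by (simp add: \<chi>_def)
  have \<chi>_inj: "inj_on \<chi> (carrier G)"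
  proof (rule inj_onI)
    fix g h assume gh: "g \<in> carrier G" "h \<in> carrier G" "\<chi> g = \<chi> h"
    obtain i j :: nat where "g = \<gamma> [^]\<^bsub>G\<^esub> i" "h = \<gamma> [^]\<^bsub>G\<^esub> j" using in_carrier gh by blast
    then show "g = h" using gh(3) \<chi>_pow pow_iff by simp
  qed
  have \<chi>_image: "\<chi> ` carrier G = {t. t ^ d = 1}"
    unfolding roots_of_unity_eq_powers[OF assms(3) z] carrier image_image \<chi>_pow ..
  define \<Lambda> where "\<Lambda> g = dmat m (\<chi> g)" for g
  have \<Lambda>_hom: "\<Lambda> \<in> hom G (GL m)"
  proof (rule homI)
    show "\<Lambda> g \<in> carrier (GL m)" for g unfolding \<Lambda>_def by (rule dmat_GL[OF \<chi>_nz])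
    show "\<Lambda> (g \<otimes>\<^bsub>G\<^esub> h) = \<Lambda> g \<otimes>\<^bsub>GL m\<^esub> \<Lambda> h" if "g \<in> carrier G" "h \<in> carrier G" for g h
      unfolding \<Lambda>_def GL_def units_of_mult ring_mat_simps \<chi>_mult[OF that] dmat_mult ..
  qed
  have \<Lambda>_inj: "inj_on \<Lambda> (carrier G)"
    using \<chi>_inj dmat_inj[OF assms(2)] unfolding \<Lambda>_def inj_on_def by blast
  have \<Lambda>_image: "\<Lambda> ` carrier G = T_group m d"
    unfolding T_group_dmat \<chi>_image[symmetric] image_image \<Lambda>_def ..
  have \<Lambda>_action: "rational_action G (affine_space m) (linear_rational_action m \<Lambda>)"
    unfolding \<Lambda>_def by (rule dmat_rational_action[OF assms(2) \<chi>_mult \<chi>_nz \<chi>_inj])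
  have \<Lambda>_lin: "linear_rational_action m \<Lambda> g = lin_map m (\<chi> g)" for g
    by (rule linear_rational_action_dmat) (simp add: \<Lambda>_def)

  obtain Z where Z: "\<And>i. i \<le> m \<Longrightarrow> closedin (ztop X) (Z i) \<and> irreducible_topology (subtopology (ztop X) (Z i))"
    "\<And>i. i < m \<Longrightarrow> Z i \<subset> Z (Suc i)"
    using dimension_chain[of m X] assms(2,4,9) by auto
  \<comment> \<open>The chart is taken around a point of the smallest member of the chain, as
    \<open>chart_chain\<close> requires.\<close>
  have "Z 0 \<noteq> {}" "Z 0 \<subseteq> points X"
    using Z(1)[of 0] closedin_subset[of "ztop X" "Z 0"] by (auto simp: irreducible_topology_def)
  then obtain x\<^sub>0 where x\<^sub>0: "x\<^sub>0 \<in> Z 0" "x\<^sub>0 \<in> points X" by blast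
  obtain U N V \<phi> \<psi> where "x\<^sub>0 \<in> U" "chart X U N V \<phi> \<psi>"
    using chart_exists[OF assms(8) x\<^sub>0(2)] by blast
  interpret chart X U N V \<phi> \<psi> by fact
  obtain a where a: "\<And>i. i < m \<Longrightarrow> a i \<in> polynomial_functions N" "indep V {..<m} a"
    using chart_chain[of m Z] Z x\<^sub>0(1) \<open>x\<^sub>0 \<in> U\<close> by blast
  from honest_action[OF assms(5) fin \<rho>(1) U] obtain W f
    where Wf: "openin (ztop X) W" "W \<noteq> {}" "W \<subseteq> U"
    "\<forall>g\<in>carrier G. \<forall>x\<in>W. f g x \<in> W" "\<forall>x\<in>W. f \<one>\<^bsub>G\<^esub> x = x"
    "\<forall>g\<in>carrier G. \<forall>h\<in>carrier G. \<forall>x\<in>W. f g (f h x) = f (g \<otimes>\<^bsub>G\<^esub> h) x"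
    "\<forall>g\<in>carrier G. (W, restrict (f g) W) \<in> \<rho> g"
    by (elim exE conjE)
  note W = Wf(1-3) and fW = Wf(4)[rule_format] and f1 = Wf(5)[rule_format]
    and fmult = Wf(6)[rule_format] and frep = Wf(7)[rule_format]
  have bir: "\<rho> g \<in> rational_maps X X" "dominant X X (\<rho> g)" if "g \<in> carrier G" for g
    using hom_in_carrier[OF \<rho>(1) that] by (auto simp: Bir_def birational_def)
  have freps: "(W, restrict (f g) W) \<in> rational_reps X X" if "g \<in> carrier G" for g
    using rational_class(1)[OF bir(1)[OF that] frep[OF that]] .
  have funpow: "(f \<gamma> ^^ i) x = f (\<gamma> [^]\<^bsub>G\<^esub> i) x" if "x \<in> W" for i x
  proof (induction i)
    case 0
    then show ?case using f1[OF that] by simp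
  next
    case (Suc i)
    then have "(f \<gamma> ^^ Suc i) x = f (\<gamma> \<otimes>\<^bsub>G\<^esub> \<gamma> [^]\<^bsub>G\<^esub> i) x"
      using fmult[OF \<gamma> nat_pow_closed[OF \<gamma>] that] by simp
    then show ?case using nat_pow_Suc2[OF \<gamma>] by simp
  qed

  \<comment> \<open>The generator acting on the regular functions of the invariant open set\<close>
  interpret C: cyclic_function_domain W "regular_on X W" "f \<gamma>" d z
  proof -
    interpret function_domain W "regular_on X W" by (rule regular_function_domain[OF W])
    show "cyclic_function_domain W (regular_on X W) (f \<gamma>) d z"
    proof
      show "d > 0" "z ^ n = 1 \<longleftrightarrow> d dvd n" for n using assms(3) z by auto
      show "f \<gamma> x \<in> W" if "x \<in> W" for x using fW[OF \<gamma> that] .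
      show "(f \<gamma> ^^ d) x = x" if "x \<in> W" for x
        using funpow[OF that] f1[OF that] ord[of d] by simp
      show "b \<in> regular_on X W" if "a \<in> regular_on X W" "\<And>x. x \<in> W \<Longrightarrow> a x = b x" for a b
        using regular_on_cong[OF that] .
      show "(\<lambda>x. a (f \<gamma> x)) \<in> regular_on X W" if "a \<in> regular_on X W" for a
      proof -
        have mor: "morphism (open_subspace X W) X (restrict (f \<gamma>) W)"
          using freps[OF \<gamma>] by (simp add: rational_reps_iff)
        have pre: "{x \<in> points (open_subspace X W). restrict (f \<gamma>) W x \<in> W} = W"
          unfolding points_open_subspace[OF W(1)] using fW[OF \<gamma>] by auto
        have "restrict a W \<in> sections X W" using that by (simp add: regular_on_def)
        from morphism_pullback[OF mor W(1) this]
        have "(\<lambda>x\<in>W. restrict a W (restrict (f \<gamma>) W x)) \<in> sections X W" unfolding pre by simp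
        moreover have "(\<lambda>x\<in>W. restrict a W (restrict (f \<gamma>) W x)) = (\<lambda>x\<in>W. a (f \<gamma> x))"
          by (rule restrict_ext) (simp add: fW[OF \<gamma>])
        ultimately show ?thesis by (simp add: regular_on_def)
      qed
      \<comment> \<open>The chart coordinates are regular functions. If a power of the generator
        fixed them all, it would fix every point of \<open>W\<close>, its class would be that of the
        unit, and injectivity of \<open>\<rho>\<close> would give a contradiction.\<close>
      show "\<exists>a\<in>regular_on X W. \<exists>x\<in>W. a ((f \<gamma> ^^ i) x) \<noteq> a x" if i: "0 < i" "i < d" for i
      proof (rule ccontr)
        assume no: "\<not> ?thesis"
        let ?g = "\<gamma> [^]\<^bsub>G\<^esub> i"
        have g: "?g \<in> carrier G" using \<gamma> by simp
        have fix_all: "f ?g x = f \<one>\<^bsub>G\<^esub> x" if x: "x \<in> W" for x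
        proof -
          have gx: "f ?g x \<in> W" using fW[OF g x] .
          have "\<phi> (f ?g x) $ j = \<phi> x $ j" if "j < N" for j
          proof -
            have "(\<lambda>x. \<phi> x $ j) \<in> regular_on X W"
              by (rule polynomial_regular[OF polynomial_functions.coord[OF that] W(1,3)])
            then have "\<forall>x\<in>W. \<phi> ((f \<gamma> ^^ i) x) $ j = \<phi> x $ j"
              by (rule bspec[rotated]) (use no in simp)
            from bspec[OF this x] show ?thesis unfolding funpow[OF x] .
          qed
          moreover have "\<phi> (f ?g x) \<in> carrier_vec N" "\<phi> x \<in> carrier_vec N"
            using \<phi>_in V_carrier W(3) x gx by blast+
          ultimately have "\<phi> (f ?g x) = \<phi> x" by (intro eq_vecI) auto
          then have "f ?g x = x" using \<psi>\<phi> W(3) x gx by (metis subsetD)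
          then show ?thesis using f1[OF x] by simp
        qed
        have "restrict (f ?g) W = restrict (f \<one>\<^bsub>G\<^esub>) W"
          by (rule restrict_ext) (rule fix_all)
        then have "\<rho> ?g = \<rho> \<one>\<^bsub>G\<^esub>"
          using rational_class(2)[OF bir(1)[OF g] frep[OF g]]
            rational_class(2)[OF bir(1)[OF one_closed] frep[OF one_closed]] by simp
        then have "?g = \<one>\<^bsub>G\<^esub>" using inj_onD[OF \<rho>(2) _ g one_closed] by blast
        then show False using ord[of i] i by (auto dest: dvd_imp_le)
      qed
    qed
  qed

  obtain F where F: "F 0 \<in> C.eig 1" "\<And>i. 0 < i \<Longrightarrow> i < m \<Longrightarrow> F i \<in> C.eig 0" "indep W {..<m} F"
    using C.semi_invariants[of m "\<lambda>i x. a i (\<phi> x)"] assms(2) polynomial_regular[OF a(1) W(1,3)]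
      indep_open[OF a W] by blast
  \<comment> \<open>Only the component of weight one is raised to a power. The exponent 1 elsewhere
    leaves the invariants as they are, and all exponents are positive, as \<open>indep_power\<close>
    demands.\<close>
  define H where "H i x = F i x ^ (if i = 0 then Suc d else 1)" for i x
  have H_indep: "indep W {..<m} H"
    unfolding H_def by (rule indep_power[OF F(3)]) simp
  have H0: "H 0 \<in> C.eig 1"
  proof -
    have "(\<lambda>x. F 0 x ^ Suc d) \<in> C.eig (Suc d * 1)" by (rule C.eig_power[OF F(1)])
    then show ?thesis using C.eig_add_period[of 1 1] by (simp add: H_def[abs_def])
  qed
  have Hi: "H i \<in> C.eig 0" if "0 < i" "i < m" for i
    using F(2)[OF that] that(1) by (simp add: H_def[abs_def])
  have Hreg: "H i \<in> regular_on X W" if "i < m" for i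
    using H0 Hi that C.eig_subset by (cases "i = 0") blast+
  have H_equiv: "H i (f (\<gamma> [^]\<^bsub>G\<^esub> k) x) = (if i = 0 then z ^ k else 1) * H i x"
    if "i < m" "x \<in> W" for i k x
    using C.eig_funpow[OF H0 that(2), of k] C.eig_funpow[OF Hi that(2), of i k] that funpow[OF that(2), of k]
    by (cases "i = 0") auto

  let ?A = "affine_space m :: ('k vec, 'k) fspace"
  let ?F = "\<lambda>x\<in>W. vec m (\<lambda>i. H i x)"
  let ?\<Phi> = "rational_eq X ?A `` {(W, ?F)}"
  have rep: "(W, ?F) \<in> rational_reps X ?A" by (rule vec_map_rep[OF W Hreg])
  have dense: "ztop ?A closure_of (?F ` W) = points ?A" by (rule vec_map_dense[OF H_indep])
  have \<Phi>: "?\<Phi> \<in> rational_maps X ?A" "dominant X ?A ?\<Phi>" "(W, ?F) \<in> ?\<Phi>"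
    using class_in_rational_maps[OF rep] dominant_classI[OF rep dense] rep_in_class[OF rep] by auto
  have equivariant: "rational_comp X ?A ?\<Phi> (\<rho> g) = rational_comp X ?A (linear_rational_action m \<Lambda> g) ?\<Phi>"
    if g: "g \<in> carrier G" for g
  proof -
    obtain k :: nat where k: "g = \<gamma> [^]\<^bsub>G\<^esub> k" using in_carrier[OF g] by blast
    have "rational_comp X ?A ?\<Phi> (\<rho> g) = rational_eq X ?A `` {compose_reps (W, restrict (f g) W) (W, ?F)}"
      by (rule rational_comp_class[OF bir[OF g] frep[OF g] refl rep]) (rule irreducible_space_axioms)
    also have "compose_reps (W, restrict (f g) W) (W, ?F) = (W, \<lambda>x\<in>W. ?F (f g x))"
    proof -
      have "{x \<in> W. restrict (f g) W x \<in> W} = W" using fW[OF g] by auto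
      then show ?thesis unfolding compose_reps_def prod.case by (auto intro!: restrict_ext)
    qed
    \<comment> \<open>For \<open>g\<close> the k-th power of the generator, the component of weight
      one is multiplied by \<open>z ^ k = \<chi> g\<close> and the invariants do not change; this is
      multiplication by \<open>dmat m (\<chi> g)\<close>.\<close>
    also have "(\<lambda>x\<in>W. ?F (f g x)) = (\<lambda>x\<in>W. dmat m (\<chi> g) *\<^sub>v ?F x)"
    proof (rule restrict_ext)
      fix x assume x: "x \<in> W"
      have "vec m (\<lambda>i. H i (f g x)) = dmat m (\<chi> g) *\<^sub>v vec m (\<lambda>i. H i x)"
        using H_equiv[OF _ x, of _ k] assms(2) unfolding k \<chi>_pow
        by (subst dmat_mult_vec) (auto intro!: eq_vecI)
      then show "?F (f g x) = dmat m (\<chi> g) *\<^sub>v ?F x" using x fW[OF g x] by simp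
    qed
    also have "(W, \<lambda>x\<in>W. dmat m (\<chi> g) *\<^sub>v ?F x) = compose_reps (W, ?F) (lin_rep m (\<chi> g))"
    proof -
      have "{x \<in> W. ?F x \<in> carrier_vec m} = W" by auto
      then show ?thesis unfolding compose_reps_def lin_rep_def prod.case by (auto intro!: restrict_ext)
    qed
    also have "rational_eq X ?A `` {\<dots>} = rational_comp X ?A (lin_map m (\<chi> g)) ?\<Phi>"
      by (rule rational_comp_class[OF \<Phi> lin_map_def lin_rep_in_reps[OF assms(2)], symmetric])
         (rule irreducible_space_affine_space)
    finally show ?thesis unfolding \<Lambda>_lin .
  qed
  have "\<not> birational X ?A ?\<Phi>"
  proof (rule vec_map_not_birational[OF assms(2) W Hreg])
    show "F 0 \<in> regular_on X W" using F(1) C.eig_subset by blast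
    show "H 0 x = F 0 x ^ Suc d" for x by (simp add: H_def)
    show "Suc d > 1" using assms(3) by simp
  qed
  then have "nontrivial_base_change G X \<rho> ?A (linear_rational_action m \<Lambda>)"
    unfolding nontrivial_base_change_def using assms(10) \<Lambda>_action \<Phi>(1,2) equivariant by blast
  then show ?thesis using \<Lambda>_hom \<Lambda>_inj \<Lambda>_image by blast
qed

end
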